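(* The morphism $\widehat\mu^*_\varepsilon\colon U(\mathfrak h^* )\to(A,\ast_\varepsilon)$ is a quantum comoment map for the quantum base-changing action on $A$; that is, $\widehat\mu_\varepsilon^*$ is a morphism of associative algebras and $$\rho(\Lambda).b=\big[\widehat\mu^*_\varepsilon(\Lambda),b\big]\qquad\text{for all }\Lambda\in\mathfrak h^*,\ b\in A,$$ where $\rho\colon\mathfrak h^*\to\mathrm{Der}(A)$ is the infinitesimal quantum base-changing action.
   Context: All vector spaces and algebras are over $\mathbb{C}$. Let $\mathcal G$ be a finite simply-laced graph (at most one edge between two distinct nodes, no loop edges) with node set $I$, viewed as a quiver by replacing each edge with a pair of opposite arrows; $\mathcal G_1$ is the set of arrows, $s,t$ source and target, $\alpha^*$ the arrow opposite to $\alpha$. Let $V=\bigoplus_{i\in I}V_i$ be finite-dimensional with a chosen basis of each $V_i$, $\mathbb{M}=\bigoplus_{\alpha\in\mathcal G_1}\mathrm{Hom}(V_{s(\alpha)},V_{t(\alpha)})$ with elements $(B_\alpha)$ and matrix entries $B_\alpha^{kl}\in\mathbb{M}^*$. Let $\varepsilon\colon\mathcal G_1\to\mathbb{C}^*$ satisfy $\varepsilon_\alpha+\varepsilon_{\alpha^*}=0$, $\omega_\varepsilon=\sum_\alpha\frac{\varepsilon_\alpha}2\mathrm{Tr}(dB_\alpha\wedge dB_{\alpha^*})$, and let $\{\cdot,\cdot\}_\varepsilon=\omega_\varepsilon^{-1}$ be the Poisson bracket: $\{B_\alpha^{kl},B_\beta^{k'l'}\}_\varepsilon=\varepsilon_\alpha^{-1}\delta_{\alpha^*\beta}\delta_{kl'}\delta_{k'l}$.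 The Weyl algebra $(A,\ast_\varepsilon)$ is $\mathrm{Tens}(\mathbb{M}^* )$ modulo $f\otimes h-h\otimes f=\{f,h\}_\varepsilon$ ($f,h\in\mathbb{M}^*$), $\widehat f$ denotes the image of $f\in\mathbb{M}^*$, and $\widehat B_\alpha$ is the matrix with entries $\widehat B_\alpha^{kl}$. Let $\widehat H=\prod_{i\in I}\mathrm{GL}(V_i)$, $\mathfrak h=\bigoplus_i\mathfrak{gl}(V_i)$, and give $\mathfrak h^*=\bigoplus_i\mathfrak{gl}(V_i)^*$ the Lie bracket transported from $\mathfrak h$ by the trace duality $X\mapsto\mathrm{Tr}(X\,\cdot)$. Let $\Lambda^i_{kl}\in\mathfrak{gl}(V_i)^*$ be the matrix entries, and define $\widehat\mu^*_\varepsilon$ by $$\widehat\mu^*_\varepsilon(\Lambda^i_{kl})=\tfrac12\sum_{\alpha\in t^{-1}(i)}\varepsilon_\alpha\sum_m\big(\widehat B_\alpha^{km}\ast_\varepsilon\widehat B_{\alpha^*}^{ml}+\widehat B_{\alpha^*}^{ml}\ast_\varepsilon\widehat B_\alpha^{km}\big),$$ extended multiplicatively via $U(\mathfrak h^* )\cong\bigotimes_iU(\mathfrak{gl}(V_i)^* )$. The quantum base-changing action $\widehat H\to\mathrm{Aut}(A)$ is the action by algebra automorphisms given on generators by $(g_i)_{i}.(\widehat B_\alpha)_\alpha=(g_{t(\alpha)}^{-1}\widehat B_\alpha g_{s(\alpha)})_\alpha$. Its derivative at the identity is an action of $\mathfrak h$ on $A$ by derivations, with $(X_i)_i.(\widehat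 B_\alpha)_\alpha=(\widehat B_\alpha X_{s(\alpha)}-X_{t(\alpha)}\widehat B_\alpha)_\alpha$; composing with the trace duality $\mathfrak h^*\cong\mathfrak h$ gives $\rho\colon\mathfrak h^*\to\mathrm{Der}(A)$. For a Lie algebra $\mathfrak g$ acting on an associative algebra $B$ by $\rho\colon\mathfrak g\to\mathrm{Der}(B)$, a quantum comoment map is a morphism of associative algebras $\widehat\mu^*\colon U(\mathfrak g)\to B$ with $\rho(x).b=[\widehat\mu^*(x),b]$ for all $x\in\mathfrak g$, $b\in B$. *)

theory Defs
  imports
    "HOL-Algebra.QuotRing"
    "HOL-Algebra.Product_Groups"
    "HOL-Analysis.Analysis"
    "HOL-Library.Poly_Mapping"
    "Jordan_Normal_Form.VS_Connect"
    "Graph_Theory.Digraph"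
    "Graph_Theory.Bidirected_Digraph"
begin

no_notation Finite_Cartesian_Product.vec_nth (infixl \<open>$\<close> 90)
hide_const (open) Multiset.mult

section \<open>Complex vector spaces, associative algebras and Lie algebras\<close>

text \<open>
  Vector spaces are \<^locale>\<open>module\<close>s over the field \<^term>\<open>class_ring :: complex ring\<close>; the
  multiplicative fields of the record are irrelevant for them.
\<close>

locale complex_algebra = module "class_ring :: complex ring" A + ring A for A (structure) +
  assumes smult_mult_left:
      "\<And>c x y. x \<in> carrier A \<Longrightarrow> y \<in> carrier A \<Longrightarrow> (c \<odot> x) \<otimes> y = c \<odot> (x \<otimes> y)"
    and smult_mult_right:
      "\<And>c x y. x \<in> carrier A \<Longrightarrow> y \<in> carrier A \<Longrightarrow> x \<otimes> (c \<odot> y) = c \<odot> (x \<otimes> y)"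

definition algebra_hom ::
    "(complex, 'a, 'm) module_scheme \<Rightarrow> (complex, 'b, 'n) module_scheme \<Rightarrow> ('a \<Rightarrow> 'b) set" where
  "algebra_hom A B = {h \<in> Ring.ring_hom A B. \<forall>c. \<forall>x\<in>carrier A. h (c \<odot>\<^bsub>A\<^esub> x) = c \<odot>\<^bsub>B\<^esub> h x}"

definition Der :: "(complex, 'a, 'm) module_scheme \<Rightarrow> ('a \<Rightarrow> 'a) set" where
  "Der A = {\<delta> \<in> carrier A \<rightarrow> carrier A.
     (\<forall>x\<in>carrier A. \<forall>y\<in>carrier A. \<delta> (x \<oplus>\<^bsub>A\<^esub> y) = \<delta> x \<oplus>\<^bsub>A\<^esub> \<delta> y) \<and>
     (\<forall>c. \<forall>x\<in>carrier A. \<delta> (c \<odot>\<^bsub>A\<^esub> x) = c \<odot>\<^bsub>A\<^esub> \<delta> x) \<and>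
     (\<forall>x\<in>carrier A. \<forall>y\<in>carrier A.
        \<delta> (x \<otimes>\<^bsub>A\<^esub> y) = (\<delta> x \<otimes>\<^bsub>A\<^esub> y) \<oplus>\<^bsub>A\<^esub> (x \<otimes>\<^bsub>A\<^esub> \<delta> y))}"

record 'a lie_record = "(complex, 'a) module" +
  lie_bracket :: "'a \<Rightarrow> 'a \<Rightarrow> 'a"

locale complex_lie_algebra = module "class_ring :: complex ring" L
  for L :: "('a, 'm) lie_record_scheme" (structure) +
  assumes bracket_closed:
      "\<And>x y. x \<in> carrier L \<Longrightarrow> y \<in> carrier L \<Longrightarrow> lie_bracket L x y \<in> carrier L"
    and bracket_add_left: "\<And>x y z. x \<in> carrier L \<Longrightarrow> y \<in> carrier L \<Longrightarrow> z \<in> carrier L \<Longrightarrow>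
      lie_bracket L (x \<oplus> y) z = lie_bracket L x z \<oplus> lie_bracket L y z"
    and bracket_smult_left: "\<And>c x y. x \<in> carrier L \<Longrightarrow> y \<in> carrier L \<Longrightarrow>
      lie_bracket L (c \<odot> x) y = c \<odot> lie_bracket L x y"
    and bracket_add_right: "\<And>x y z. x \<in> carrier L \<Longrightarrow> y \<in> carrier L \<Longrightarrow> z \<in> carrier L \<Longrightarrow>
      lie_bracket L x (y \<oplus> z) = lie_bracket L x y \<oplus> lie_bracket L x z"
    and bracket_smult_right: "\<And>c x y. x \<in> carrier L \<Longrightarrow> y \<in> carrier L \<Longrightarrow>
      lie_bracket L x (c \<odot> y) = c \<odot> lie_bracket L x y"
    and bracket_self: "\<And>x. x \<in> carrier L \<Longrightarrow> lie_bracket L x x = \<zero>"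
    and jacobi: "\<And>x y z. x \<in> carrier L \<Longrightarrow> y \<in> carrier L \<Longrightarrow> z \<in> carrier L \<Longrightarrow>
      lie_bracket L x (lie_bracket L y z) \<oplus> lie_bracket L y (lie_bracket L z x)
        \<oplus> lie_bracket L z (lie_bracket L x y) = \<zero>"


section \<open>Quotients of tensor algebras\<close>

text \<open>
  With lists as a monoid under concatenation, the type \<^typ>\<open>'w list \<Rightarrow>\<^sub>0 complex\<close> with its library
  (convolution) product is the free associative algebra on the letters \<^typ>\<open>'w\<close>.
\<close>

instantiation list :: (type) monoid_add
begin

definition zero_list :: "'a list" where "zero_list = []"

definition plus_list :: "'a list \<Rightarrow> 'a list \<Rightarrow> 'a list" where "plus_list = (@)"

instance
  by standard (simp_all add: zero_list_def plus_list_def)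

end

definition scal :: "complex \<Rightarrow> ('w list \<Rightarrow>\<^sub>0 complex)" where
  "scal c = Poly_Mapping.single [] c"

definition letter :: "'w \<Rightarrow> ('w list \<Rightarrow>\<^sub>0 complex)" where
  "letter w = Poly_Mapping.single [w] 1"

definition free_algebra :: "'w set \<Rightarrow> (complex, 'w list \<Rightarrow>\<^sub>0 complex) module" where
  "free_algebra S = \<lparr>carrier = {p. Poly_Mapping.keys p \<subseteq> lists S}, mult = (*), one = 1,
     zero = 0, add = (+), smult = (\<lambda>c p. scal c * p)\<rparr>"

definition quotient_algebra ::
    "(complex, 'a, 'm) module_scheme \<Rightarrow> 'a set \<Rightarrow> (complex, 'a set) module" where
  "quotient_algebra A J =
     ring.extend (A Quot J) (module.fields (\<lambda>c X. \<Union>x\<in>X. J +>\<^bsub>A\<^esub> (c \<odot>\<^bsub>A\<^esub> x)))"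

text \<open>
  For a vector space \<open>W\<close>, the tensor algebra \<open>Tens(W)\<close> is the free algebra on the underlying set of
  \<open>W\<close> modulo the relations making the inclusion of \<open>W\<close> linear.  The algebra \<open>Tens(W)\<close> modulo
  \<open>x \<otimes> y - y \<otimes> x = c x y\<close> is obtained by imposing both families of relations at once.
\<close>

definition tensor_relations ::
    "(complex, 'w, 'm) module_scheme \<Rightarrow> ('w \<Rightarrow> 'w \<Rightarrow> ('w list \<Rightarrow>\<^sub>0 complex)) \<Rightarrow>
     ('w list \<Rightarrow>\<^sub>0 complex) set" where
  "tensor_relations W c =
     {letter (x \<oplus>\<^bsub>W\<^esub> y) - letter x - letter y |x y. x \<in> carrier W \<and> y \<in> carrier W} \<union>
     {letter (a \<odot>\<^bsub>W\<^esub> x) - scal a * letter x |a x. x \<in> carrier W} \<union>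
     {letter x * letter y - letter y * letter x - c x y |x y. x \<in> carrier W \<and> y \<in> carrier W}"

definition tensor_ideal ::
    "(complex, 'w, 'm) module_scheme \<Rightarrow> ('w \<Rightarrow> 'w \<Rightarrow> ('w list \<Rightarrow>\<^sub>0 complex)) \<Rightarrow>
     ('w list \<Rightarrow>\<^sub>0 complex) set" where
  "tensor_ideal W c = genideal (free_algebra (carrier W)) (tensor_relations W c)"

definition tensor_quotient ::
    "(complex, 'w, 'm) module_scheme \<Rightarrow> ('w \<Rightarrow> 'w \<Rightarrow> ('w list \<Rightarrow>\<^sub>0 complex)) \<Rightarrow>
     (complex, ('w list \<Rightarrow>\<^sub>0 complex) set) module" where
  "tensor_quotient W c = quotient_algebra (free_algebra (carrier W)) (tensor_ideal W c)"

definition tensor_class ::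
    "(complex, 'w, 'm) module_scheme \<Rightarrow> ('w \<Rightarrow> 'w \<Rightarrow> ('w list \<Rightarrow>\<^sub>0 complex)) \<Rightarrow> 'w \<Rightarrow>
     ('w list \<Rightarrow>\<^sub>0 complex) set" where
  "tensor_class W c x = tensor_ideal W c +>\<^bsub>free_algebra (carrier W)\<^esub> letter x"

definition free_extension ::
    "(complex, 'b, 'n) module_scheme \<Rightarrow> ('w \<Rightarrow> 'b) \<Rightarrow> ('w list \<Rightarrow>\<^sub>0 complex) \<Rightarrow> 'b" where
  "free_extension B \<phi> p = (\<Oplus>\<^bsub>B\<^esub>w\<in>Poly_Mapping.keys p.
     Poly_Mapping.lookup p w \<odot>\<^bsub>B\<^esub> foldr (\<otimes>\<^bsub>B\<^esub>) (map \<phi> w) \<one>\<^bsub>B\<^esub>)"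

text \<open>
  The map on a quotient of the free algebra induced by prescribing the values \<open>\<phi>\<close> on letters: it
  sends a coset to the common value of the free extension on it (meaningful only if there is one).
\<close>

definition induced_map ::
    "(complex, 'b, 'n) module_scheme \<Rightarrow> ('w \<Rightarrow> 'b) \<Rightarrow> ('w list \<Rightarrow>\<^sub>0 complex) set \<Rightarrow> 'b" where
  "induced_map B \<phi> X = the_elem (free_extension B \<phi> ` X)"


section \<open>Enveloping algebras and quantum comoment maps\<close>

definition enveloping_algebra :: "('a, 'm) lie_record_scheme \<Rightarrow> (complex, ('a list \<Rightarrow>\<^sub>0 complex) set) module" where
  "enveloping_algebra L = tensor_quotient L (\<lambda>x y. letter (lie_bracket L x y))"

definition enveloping_incl :: "('a, 'm) lie_record_scheme \<Rightarrow> 'a \<Rightarrow> ('a list \<Rightarrow>\<^sub>0 complex) set" where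
  "enveloping_incl L = tensor_class L (\<lambda>x y. letter (lie_bracket L x y))"

locale derivation_action =
  L: complex_lie_algebra L + B: complex_algebra B
  for L :: "('a, 'm) lie_record_scheme" and B :: "(complex, 'b, 'n) module_scheme" +
  fixes \<rho> :: "'a \<Rightarrow> 'b \<Rightarrow> 'b"
  assumes action_Der: "\<And>x. x \<in> carrier L \<Longrightarrow> \<rho> x \<in> Der B"
    and action_add: "\<And>x y b. x \<in> carrier L \<Longrightarrow> y \<in> carrier L \<Longrightarrow> b \<in> carrier B \<Longrightarrow>
      \<rho> (x \<oplus>\<^bsub>L\<^esub> y) b = \<rho> x b \<oplus>\<^bsub>B\<^esub> \<rho> y b"
    and action_smult: "\<And>c x b. x \<in> carrier L \<Longrightarrow> b \<in> carrier B \<Longrightarrow>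
      \<rho> (c \<odot>\<^bsub>L\<^esub> x) b = c \<odot>\<^bsub>B\<^esub> \<rho> x b"
    and action_bracket: "\<And>x y b. x \<in> carrier L \<Longrightarrow> y \<in> carrier L \<Longrightarrow> b \<in> carrier B \<Longrightarrow>
      \<rho> (lie_bracket L x y) b = \<rho> x (\<rho> y b) \<ominus>\<^bsub>B\<^esub> \<rho> y (\<rho> x b)"

locale quantum_comoment_map = derivation_action L B \<rho>
  for L :: "('a, 'm) lie_record_scheme" and B :: "(complex, 'b, 'n) module_scheme"
    and \<rho> :: "'a \<Rightarrow> 'b \<Rightarrow> 'b" +
  fixes \<mu> :: "('a list \<Rightarrow>\<^sub>0 complex) set \<Rightarrow> 'b"
  assumes comoment_hom: "\<mu> \<in> algebra_hom (enveloping_algebra L) B"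
    and comoment_eq: "\<And>x b. x \<in> carrier L \<Longrightarrow> b \<in> carrier B \<Longrightarrow>
      \<rho> x b = (\<mu> (enveloping_incl L x) \<otimes>\<^bsub>B\<^esub> b) \<ominus>\<^bsub>B\<^esub> (b \<otimes>\<^bsub>B\<^esub> \<mu> (enveloping_incl L x))"


section \<open>Direct sums of matrix spaces and their duals\<close>

definition mat_sum ::
    "'x set \<Rightarrow> ('x \<Rightarrow> nat) \<Rightarrow> ('x \<Rightarrow> nat) \<Rightarrow> (complex, 'x \<Rightarrow> complex mat) module" where
  "mat_sum X r c = \<lparr>carrier = (\<Pi>\<^sub>E x\<in>X. carrier_mat (r x) (c x)),
     mult = undefined, one = undefined,
     zero = (\<lambda>x\<in>X. 0\<^sub>m (r x) (c x)), add = (\<lambda>B C. \<lambda>x\<in>X. B x + C x),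
     smult = (\<lambda>a B. \<lambda>x\<in>X. a \<cdot>\<^sub>m B x)\<rparr>"

definition dual_space ::
    "(complex, 'v, 'm) module_scheme \<Rightarrow> (complex, 'v \<Rightarrow> complex) module" where
  "dual_space V = \<lparr>carrier = {f \<in> extensional (carrier V).
       (\<forall>x\<in>carrier V. \<forall>y\<in>carrier V. f (x \<oplus>\<^bsub>V\<^esub> y) = f x + f y) \<and>
       (\<forall>a. \<forall>x\<in>carrier V. f (a \<odot>\<^bsub>V\<^esub> x) = a * f x)},
     mult = undefined, one = undefined,
     zero = (\<lambda>x\<in>carrier V. 0), add = (\<lambda>f h. \<lambda>x\<in>carrier V. f x + h x),
     smult = (\<lambda>a f. \<lambda>x\<in>carrier V. a * f x)\<rparr>"

definition unit_family ::
    "'x set \<Rightarrow> ('x \<Rightarrow> nat) \<Rightarrow> ('x \<Rightarrow> nat) \<Rightarrow> 'x \<Rightarrow> nat \<Rightarrow> nat \<Rightarrow> ('x \<Rightarrow> complex mat)" where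
  "unit_family X r c x k l =
     (\<lambda>y\<in>X. mat (r y) (c y) (\<lambda>(p, q). if y = x \<and> p = k \<and> q = l then 1 else 0))"

definition entry_functional ::
    "'x set \<Rightarrow> ('x \<Rightarrow> nat) \<Rightarrow> ('x \<Rightarrow> nat) \<Rightarrow> 'x \<Rightarrow> nat \<Rightarrow> nat \<Rightarrow> ('x \<Rightarrow> complex mat) \<Rightarrow> complex" where
  "entry_functional X r c x k l = (\<lambda>B\<in>carrier (mat_sum X r c). B x $$ (k, l))"


section \<open>The Weyl algebra of a quiver\<close>

text \<open>
  The graph is a symmetric digraph \<open>G\<close> whose arcs are the arrows \<open>\<G>\<^sub>1\<close>, with \<open>s = tail G\<close>,
  \<open>t = head G\<close> and \<open>\<alpha>\<^sup>* = arev \<alpha>\<close>.  The chosen bases identify \<open>V\<^sub>i\<close> with \<open>\<complex>\<^bsup>d i\<^esup>\<close>, so an element of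
  \<open>Hom(V\<^bsub>s \<alpha>\<^esub>, V\<^bsub>t \<alpha>\<^esub>)\<close> is a matrix with \<open>d (t \<alpha>)\<close> rows and \<open>d (s \<alpha>)\<close> columns.
\<close>

definition rep_space ::
    "('v, 'e) pre_digraph \<Rightarrow> ('v \<Rightarrow> nat) \<Rightarrow> (complex, 'e \<Rightarrow> complex mat) module" where
  "rep_space G d = mat_sum (arcs G) (d \<circ> head G) (d \<circ> tail G)"

definition rep_unit ::
    "('v, 'e) pre_digraph \<Rightarrow> ('v \<Rightarrow> nat) \<Rightarrow> 'e \<Rightarrow> nat \<Rightarrow> nat \<Rightarrow> ('e \<Rightarrow> complex mat)" where
  "rep_unit G d = unit_family (arcs G) (d \<circ> head G) (d \<circ> tail G)"

text \<open>
  The bilinear extension to the dual of the representation space of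
  \<open>{B\<^sub>\<alpha>\<^bsup>kl\<^esup>, B\<^sub>\<beta>\<^bsup>k'l'\<^esup>} = \<epsilon>\<^sub>\<alpha>\<^sup>-\<^sup>1 \<delta>\<^bsub>\<alpha>*,\<beta>\<^esub> \<delta>\<^bsub>kl'\<^esub> \<delta>\<^bsub>k'l\<^esub>\<close>; the coefficient of \<open>B\<^sub>\<alpha>\<^bsup>kl\<^esup>\<close> in \<open>f\<close> is
  \<open>f (rep_unit G d \<alpha> k l)\<close>.
\<close>

definition poisson ::
    "('v, 'e) pre_digraph \<Rightarrow> ('e \<Rightarrow> 'e) \<Rightarrow> ('v \<Rightarrow> nat) \<Rightarrow> ('e \<Rightarrow> complex) \<Rightarrow>
     (('e \<Rightarrow> complex mat) \<Rightarrow> complex) \<Rightarrow> (('e \<Rightarrow> complex mat) \<Rightarrow> complex) \<Rightarrow> complex" where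
  "poisson G arev d \<epsilon> f h =
     (\<Sum>\<alpha>\<in>arcs G. \<Sum>k<d (head G \<alpha>). \<Sum>l<d (tail G \<alpha>).
      \<Sum>\<beta>\<in>arcs G. \<Sum>k'<d (head G \<beta>). \<Sum>l'<d (tail G \<beta>).
        f (rep_unit G d \<alpha> k l) * h (rep_unit G d \<beta> k' l') *
        (if arev \<alpha> = \<beta> \<and> k = l' \<and> k' = l then inverse (\<epsilon> \<alpha>) else 0))"

type_synonym 'e weyl = "((('e \<Rightarrow> complex mat) \<Rightarrow> complex) list \<Rightarrow>\<^sub>0 complex) set"

definition weyl_algebra ::
    "('v, 'e) pre_digraph \<Rightarrow> ('e \<Rightarrow> 'e) \<Rightarrow> ('v \<Rightarrow> nat) \<Rightarrow> ('e \<Rightarrow> complex) \<Rightarrow>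
     (complex, 'e weyl) module" where
  "weyl_algebra G arev d \<epsilon> =
     tensor_quotient (dual_space (rep_space G d)) (\<lambda>f h. scal (poisson G arev d \<epsilon> f h))"

definition hat ::
    "('v, 'e) pre_digraph \<Rightarrow> ('e \<Rightarrow> 'e) \<Rightarrow> ('v \<Rightarrow> nat) \<Rightarrow> ('e \<Rightarrow> complex) \<Rightarrow>
     (('e \<Rightarrow> complex mat) \<Rightarrow> complex) \<Rightarrow> 'e weyl" where
  "hat G arev d \<epsilon> =
     tensor_class (dual_space (rep_space G d)) (\<lambda>f h. scal (poisson G arev d \<epsilon> f h))"

definition B_hat ::
    "('v, 'e) pre_digraph \<Rightarrow> ('e \<Rightarrow> 'e) \<Rightarrow> ('v \<Rightarrow> nat) \<Rightarrow> ('e \<Rightarrow> complex) \<Rightarrow>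
     'e \<Rightarrow> nat \<Rightarrow> nat \<Rightarrow> 'e weyl" where
  "B_hat G arev d \<epsilon> \<alpha> k l =
     hat G arev d \<epsilon> (entry_functional (arcs G) (d \<circ> head G) (d \<circ> tail G) \<alpha> k l)"


section \<open>The Lie algebra \<open>\<hh>\<close>, its dual, and the quantum moment map\<close>

definition gl_sum ::
    "('v, 'e) pre_digraph \<Rightarrow> ('v \<Rightarrow> nat) \<Rightarrow> ('v \<Rightarrow> complex mat) lie_record" where
  "gl_sum G d = module.extend (mat_sum (verts G) d d)
     (lie_record.fields (\<lambda>X Y. \<lambda>i\<in>verts G. X i * Y i - Y i * X i))"

definition trace_duality ::
    "('v, 'e) pre_digraph \<Rightarrow> ('v \<Rightarrow> nat) \<Rightarrow>
     ('v \<Rightarrow> complex mat) \<Rightarrow> (('v \<Rightarrow> complex mat) \<Rightarrow> complex)" where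
  "trace_duality G d X =
     (\<lambda>Y\<in>carrier (gl_sum G d). \<Sum>i\<in>verts G. \<Sum>k<d i. (X i * Y i) $$ (k, k))"

definition inv_trace_duality ::
    "('v, 'e) pre_digraph \<Rightarrow> ('v \<Rightarrow> nat) \<Rightarrow>
     (('v \<Rightarrow> complex mat) \<Rightarrow> complex) \<Rightarrow> ('v \<Rightarrow> complex mat)" where
  "inv_trace_duality G d = inv_into (carrier (gl_sum G d)) (trace_duality G d)"

definition gl_sum_dual ::
    "('v, 'e) pre_digraph \<Rightarrow> ('v \<Rightarrow> nat) \<Rightarrow> (('v \<Rightarrow> complex mat) \<Rightarrow> complex) lie_record" where
  "gl_sum_dual G d = module.extend (dual_space (gl_sum G d))
     (lie_record.fields (\<lambda>\<Lambda> \<Lambda>'. trace_duality G d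
        (lie_bracket (gl_sum G d) (inv_trace_duality G d \<Lambda>) (inv_trace_duality G d \<Lambda>'))))"

text \<open>The prescribed value on the matrix entry \<open>\<Lambda>\<^sup>i\<^bsub>kl\<^esub>\<close>.\<close>

definition moment_entry ::
    "('v, 'e) pre_digraph \<Rightarrow> ('e \<Rightarrow> 'e) \<Rightarrow> ('v \<Rightarrow> nat) \<Rightarrow> ('e \<Rightarrow> complex) \<Rightarrow>
     'v \<Rightarrow> nat \<Rightarrow> nat \<Rightarrow> 'e weyl" where
  "moment_entry G arev d \<epsilon> i k l =
     (let A = weyl_algebra G arev d \<epsilon>; B = B_hat G arev d \<epsilon> in
      (1 / 2) \<odot>\<^bsub>A\<^esub> (\<Oplus>\<^bsub>A\<^esub>\<alpha>\<in>{\<alpha> \<in> arcs G. head G \<alpha> = i}. \<epsilon> \<alpha> \<odot>\<^bsub>A\<^esub> (\<Oplus>\<^bsub>A\<^esub>m\<in>{..<d (tail G \<alpha>)}.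
        (B \<alpha> k m \<otimes>\<^bsub>A\<^esub> B (arev \<alpha>) m l) \<oplus>\<^bsub>A\<^esub> (B (arev \<alpha>) m l \<otimes>\<^bsub>A\<^esub> B \<alpha> k m))))"

text \<open>
  Linear extension to \<open>\<hh>\<^sup>*\<close>, where the coefficient of \<open>\<Lambda>\<^sup>i\<^bsub>kl\<^esub>\<close> in \<open>\<Lambda>\<close> is the value of \<open>\<Lambda>\<close> on the
  elementary matrix, followed by multiplicative extension.
\<close>

definition quantum_moment ::
    "('v, 'e) pre_digraph \<Rightarrow> ('e \<Rightarrow> 'e) \<Rightarrow> ('v \<Rightarrow> nat) \<Rightarrow> ('e \<Rightarrow> complex) \<Rightarrow>
     ((('v \<Rightarrow> complex mat) \<Rightarrow> complex) list \<Rightarrow>\<^sub>0 complex) set \<Rightarrow> 'e weyl" where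
  "quantum_moment G arev d \<epsilon> =
     (let A = weyl_algebra G arev d \<epsilon> in
      induced_map A (\<lambda>\<Lambda>. \<Oplus>\<^bsub>A\<^esub>i\<in>verts G. \<Oplus>\<^bsub>A\<^esub>k\<in>{..<d i}. \<Oplus>\<^bsub>A\<^esub>l\<in>{..<d i}.
        \<Lambda> (unit_family (verts G) d d i k l) \<odot>\<^bsub>A\<^esub> moment_entry G arev d \<epsilon> i k l))"


section \<open>The quantum base-changing action and its derivative\<close>

definition base_group :: "('v, 'e) pre_digraph \<Rightarrow> ('v \<Rightarrow> nat) \<Rightarrow> ('v \<Rightarrow> complex mat) monoid" where
  "base_group G d = product_group (verts G) (\<lambda>i. units_of (ring_mat TYPE(complex) (d i) ()))"

text \<open>
  The automorphism of the Weyl algebra attached to \<open>g\<close> in \<open>base_group G d\<close>: on generators, the matrix \<open>B\<^sub>\<alpha>\<close> of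
  generators is sent to \<open>g\<^bsub>t \<alpha>\<^esub>\<^sup>-\<^sup>1 B\<^sub>\<alpha> g\<^bsub>s \<alpha>\<^esub>\<close>.
\<close>

definition base_change_entry ::
    "('v, 'e) pre_digraph \<Rightarrow> ('e \<Rightarrow> 'e) \<Rightarrow> ('v \<Rightarrow> nat) \<Rightarrow> ('e \<Rightarrow> complex) \<Rightarrow>
     ('v \<Rightarrow> complex mat) \<Rightarrow> 'e \<Rightarrow> nat \<Rightarrow> nat \<Rightarrow> 'e weyl" where
  "base_change_entry G arev d \<epsilon> g \<alpha> k l =
     (let A = weyl_algebra G arev d \<epsilon> in
      \<Oplus>\<^bsub>A\<^esub>m\<in>{..<d (head G \<alpha>)}. \<Oplus>\<^bsub>A\<^esub>n\<in>{..<d (tail G \<alpha>)}.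
        ((inv\<^bsub>base_group G d\<^esub> g) (head G \<alpha>) $$ (k, m) * g (tail G \<alpha>) $$ (n, l))
          \<odot>\<^bsub>A\<^esub> B_hat G arev d \<epsilon> \<alpha> m n)"

definition base_change ::
    "('v, 'e) pre_digraph \<Rightarrow> ('e \<Rightarrow> 'e) \<Rightarrow> ('v \<Rightarrow> nat) \<Rightarrow> ('e \<Rightarrow> complex) \<Rightarrow>
     ('v \<Rightarrow> complex mat) \<Rightarrow> 'e weyl \<Rightarrow> 'e weyl" where
  "base_change G arev d \<epsilon> g =
     (let A = weyl_algebra G arev d \<epsilon> in
      induced_map A (\<lambda>f. \<Oplus>\<^bsub>A\<^esub>\<alpha>\<in>arcs G. \<Oplus>\<^bsub>A\<^esub>k\<in>{..<d (head G \<alpha>)}. \<Oplus>\<^bsub>A\<^esub>l\<in>{..<d (tail G \<alpha>)}.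
        f (rep_unit G d \<alpha> k l) \<odot>\<^bsub>A\<^esub> base_change_entry G arev d \<epsilon> g \<alpha> k l))"

text \<open>
  The derivative at \<open>0\<close> of a curve which near \<open>0\<close> stays in a finite-dimensional subspace of a
  possibly infinite-dimensional space: the coefficients with respect to finitely many vectors are
  differentiated.  The spanning vectors need not be independent, and the result does not depend on
  their choice.
\<close>

definition has_derivative_at_0 ::
    "(complex, 'a, 'm) module_scheme \<Rightarrow> (complex \<Rightarrow> 'a) \<Rightarrow> 'a \<Rightarrow> bool" where
  "has_derivative_at_0 V \<gamma> D \<longleftrightarrow>
     (\<exists>(n :: nat) v c c'. (\<forall>j<n. v j \<in> carrier V) \<and>
        (\<forall>j<n. (c j has_field_derivative c' j) (at 0)) \<and>
        (\<forall>\<^sub>F t in nhds 0. \<gamma> t = (\<Oplus>\<^bsub>V\<^esub>j\<in>{..<n}. c j t \<odot>\<^bsub>V\<^esub> v j)) \<and>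
        D = (\<Oplus>\<^bsub>V\<^esub>j\<in>{..<n}. c' j \<odot>\<^bsub>V\<^esub> v j))"

text \<open>
  The group is open in \<open>\<hh>\<close>, so the derivative at the identity of \<open>g \<mapsto> g.b\<close> in the direction \<open>X\<close> is
  computed along the line \<open>t \<mapsto> 1 + t X\<close>, which lies in the group for small \<open>t\<close>.
\<close>

definition infinitesimal_base_change ::
    "('v, 'e) pre_digraph \<Rightarrow> ('e \<Rightarrow> 'e) \<Rightarrow> ('v \<Rightarrow> nat) \<Rightarrow> ('e \<Rightarrow> complex) \<Rightarrow>
     ('v \<Rightarrow> complex mat) \<Rightarrow> 'e weyl \<Rightarrow> 'e weyl" where
  "infinitesimal_base_change G arev d \<epsilon> X b =
     (THE D. has_derivative_at_0 (weyl_algebra G arev d \<epsilon>)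
        (\<lambda>t. base_change G arev d \<epsilon> (\<lambda>i\<in>verts G. 1\<^sub>m (d i) + t \<cdot>\<^sub>m X i) b) D)"

definition dual_base_change ::
    "('v, 'e) pre_digraph \<Rightarrow> ('e \<Rightarrow> 'e) \<Rightarrow> ('v \<Rightarrow> nat) \<Rightarrow> ('e \<Rightarrow> complex) \<Rightarrow>
     (('v \<Rightarrow> complex mat) \<Rightarrow> complex) \<Rightarrow> 'e weyl \<Rightarrow> 'e weyl" where
  "dual_base_change G arev d \<epsilon> \<Lambda> =
     infinitesimal_base_change G arev d \<epsilon> (inv_trace_duality G d \<Lambda>)"

end

theory Submission
  imports Defs
begin

text \<open>
  The theorem rests on one identity in the Weyl algebra.  Let \<open>\<mu>\<^sub>i\<close> be the matrix of the values
  prescribed at the vertex \<open>i\<close>.  The functional dual to a family \<open>x = (x\<^sub>i)\<close> of matrices under the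
  trace pairing has \<open>\<mu>(x) = \<Sum>\<^sub>i Tr (x\<^sub>i \<mu>\<^sub>i)\<close> as its image, a quadratic expression in the generators.
  Since generators have scalar commutators, the commutator of \<open>\<mu>(x)\<close> with a generator is again
  linear, and it is \<open>[\<mu>(x), B\<^sub>\<alpha>] = B\<^sub>\<alpha> x\<^bsub>s \<alpha>\<^esub> - x\<^bsub>t \<alpha>\<^esub> B\<^sub>\<alpha>\<close>
  (\<open>commutator_moment_poly_entry_letter\<close>); the signs come from \<open>\<epsilon>\<^sub>\<alpha> + \<epsilon>\<^sub>\<alpha>\<^sub>* = 0\<close>.

  This has two consequences.  On the one hand, \<open>[\<mu>(x), _]\<close> is a derivation, so it can be evaluated
  on the products \<open>B\<^sub>\<alpha> B\<^sub>\<alpha>\<^sub>*\<close>, where it gives \<open>[\<mu>\<^sub>i, x\<^sub>i]\<close>; cyclicity of the trace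
  turns this into \<open>[\<mu>(x), \<mu>(y)] = \<mu>([x, y])\<close> (\<open>commutator_moment_poly_moment_poly\<close>).  Hence the
  prescribed values respect the relations of the enveloping algebra and the moment map is a
  well-defined homomorphism (\<open>quantum_moment_hom\<close>).

  On the other hand, the right-hand side of the identity is the derivative at \<open>t = 0\<close> of
  \<open>g\<^sup>-\<^sup>1 B g\<close> with \<open>g = 1 + t x\<close>.  A substitution that depends differentiably on \<open>t\<close> and starts at the
  identity differentiates to a derivation (\<open>subst_letters_curve_deriv\<close>), so the infinitesimal
  base-changing action and \<open>[\<mu>(x), _]\<close> are derivations that agree on generators, hence everywhere
  (\<open>infinitesimal_base_change_cls\<close>).  For this the base change has to be well defined
  (\<open>commutator_base_change_letter\<close>), the inverse of \<open>1 + t x\<close> has to be differentiated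
  (\<open>inverse_near_identity\<close>), and derivatives of curves in the quotient algebra have to be unique
  (\<open>has_derivative_at_0_unique\<close>).  All remaining properties of the action follow from its being inner.
\<close>

section \<open>The free algebra and its substitution homomorphisms\<close>

abbreviation polys :: "'w set \<Rightarrow> ('w list \<Rightarrow>\<^sub>0 complex) set" where
  "polys S \<equiv> carrier (free_algebra S)"

lemma cring_complex: "cring (class_ring :: complex ring)"
  using class_field[where 'a = complex] unfolding field_def domain_def by blast

lemma single_conv_scal:
  "Poly_Mapping.single w c = scal c * prod_list (map letter w)"
proof -
  have "prod_list (map letter w) = Poly_Mapping.single w 1"
  proof (induction w)
    case Nil
    then show ?case by (metis list.map(1) prod_list.Nil single_one zero_list_def)
  next
    case (Cons x w)
    then show ?case by (simp add: letter_def mult_single plus_list_def)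
  qed
  then show ?thesis
    by (simp add: scal_def mult_single plus_list_def)
qed

lemma scal_0 [simp]: "scal 0 = 0"
  by (simp add: scal_def)

lemma scal_1 [simp]: "scal 1 = 1"
  by (simp add: scal_def flip: zero_list_def)

lemma scal_add: "scal (a + b) = scal a + scal b"
  by (simp add: scal_def single_add)

lemma scal_uminus: "scal (- a) = - scal a"
  by (simp add: scal_def single_uminus)

lemma scal_diff: "scal (a - b) = scal a - scal b"
  by (simp add: scal_def single_diff)

lemma scal_mult: "scal (a * b) = scal a * scal b"
  by (simp add: scal_def mult_single plus_list_def)

lemma scal_sum: "scal (sum f X) = (\<Sum>x\<in>X. scal (f x))"
  by (induction X rule: infinite_finite_induct) (simp_all add: scal_add)

lemma poly_sum_monomials:
  fixes p :: "'w \<Rightarrow>\<^sub>0 complex"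
  shows "p = (\<Sum>w\<in>Poly_Mapping.keys p. Poly_Mapping.single w (Poly_Mapping.lookup p w))"
proof (rule poly_mapping_eqI)
  fix k
  have "(\<Sum>w\<in>Poly_Mapping.keys p. Poly_Mapping.lookup p w when w = k) = Poly_Mapping.lookup p k"
    by (cases "k \<in> Poly_Mapping.keys p") (auto simp: when_def in_keys_iff)
  then show "Poly_Mapping.lookup p k = Poly_Mapping.lookup
      (\<Sum>w\<in>Poly_Mapping.keys p. Poly_Mapping.single w (Poly_Mapping.lookup p w)) k"
    by (simp add: lookup_sum lookup_single)
qed

lemma poly_additive_induct [case_names single add]:
  fixes p :: "'w \<Rightarrow>\<^sub>0 complex"
  assumes single: "\<And>w c. P (Poly_Mapping.single w c)"
    and add: "\<And>p q. P p \<Longrightarrow> P q \<Longrightarrow> P (p + q)"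
  shows "P p"
proof -
  have "P (\<Sum>w\<in>X. Poly_Mapping.single w (Poly_Mapping.lookup p w))" for X
    by (induction X rule: infinite_finite_induct)
      (use single[of undefined 0] in \<open>auto intro: single add\<close>)
  then show ?thesis
    by (metis poly_sum_monomials)
qed

lemma scal_central: "p * scal c = scal c * p"
proof (induction p rule: poly_additive_induct)
  case (single w a)
  then show ?case by (simp add: scal_def mult_single plus_list_def mult.commute)
next
  case (add p q)
  then show ?case by (simp add: algebra_simps)
qed

lemma scal_left_commute: "p * (scal c * q) = scal c * (p * q)"
  by (metis mult.assoc scal_central)

lemma scal_scal_times: "scal a * (scal b * p) = scal (a * b) * p"
  by (simp add: scal_mult mult.assoc)

lemma scal_times_scal: "(scal a * p) * (scal b * q) = scal (a * b) * (p * q)"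
  by (simp add: scal_mult mult.assoc) (metis scal_left_commute)

lemma polys_zero [simp, intro]: "0 \<in> polys S"
  by (simp add: free_algebra_def)

lemma polys_scal [simp, intro]: "scal c \<in> polys S"
  by (simp add: free_algebra_def scal_def)

lemma polys_one [simp, intro]: "1 \<in> polys S"
  using polys_scal[of 1] by simp

lemma polys_letter [simp, intro]: "x \<in> S \<Longrightarrow> letter x \<in> polys S"
  by (simp add: free_algebra_def letter_def)

lemma polys_add [simp, intro]: "p \<in> polys S \<Longrightarrow> q \<in> polys S \<Longrightarrow> p + q \<in> polys S"
  using keys_add[of p q] by (auto simp: free_algebra_def)

lemma polys_mult [simp, intro]: "p \<in> polys S \<Longrightarrow> q \<in> polys S \<Longrightarrow> p * q \<in> polys S"
  using keys_mult[of p q] by (fastforce simp: free_algebra_def plus_list_def)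

lemma polys_uminus [simp, intro]: "p \<in> polys S \<Longrightarrow> - p \<in> polys S"
  using polys_mult[OF polys_scal[of "- 1"], of p S] by (simp add: scal_uminus)

lemma polys_diff [simp, intro]: "p \<in> polys S \<Longrightarrow> q \<in> polys S \<Longrightarrow> p - q \<in> polys S"
  using polys_add[of p S "- q"] by simp

lemma polys_sum [simp, intro]: "(\<And>x. x \<in> X \<Longrightarrow> f x \<in> polys S) \<Longrightarrow> sum f X \<in> polys S"
  by (induction X rule: infinite_finite_induct) simp_all

lemma polys_induct [consumes 1, case_names scal letter add mult]:
  assumes "p \<in> polys S"
    and scal: "\<And>c. P (scal c)"
    and letter: "\<And>x. x \<in> S \<Longrightarrow> P (letter x)"
    and add: "\<And>p q. p \<in> polys S \<Longrightarrow> q \<in> polys S \<Longrightarrow> P p \<Longrightarrow> P q \<Longrightarrow> P (p + q)"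
    and mult: "\<And>p q. p \<in> polys S \<Longrightarrow> q \<in> polys S \<Longrightarrow> P p \<Longrightarrow> P q \<Longrightarrow> P (p * q)"
  shows "P p"
proof -
  have word: "prod_list (map letter w) \<in> polys S \<and> P (prod_list (map letter w))" if "w \<in> lists S" for w
    using that
  proof (induction w)
    case Nil
    then show ?case using scal[of 1] by simp
  next
    case (Cons x w)
    then show ?case by (simp add: mult letter)
  qed
  have mono: "Poly_Mapping.single w c \<in> polys S \<and> P (Poly_Mapping.single w c)" if "w \<in> lists S" for w c
    using word[OF that] by (simp add: single_conv_scal mult scal)
  have "P (\<Sum>w\<in>X. Poly_Mapping.single w (Poly_Mapping.lookup p w))"
    if "finite X" "X \<subseteq> lists S" for X
    using that
  proof (induction X)
    case empty
    then show ?case using scal[of 0] by simp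
  next
    case (insert w X)
    then have "(\<Sum>w\<in>X. Poly_Mapping.single w (Poly_Mapping.lookup p w)) \<in> polys S"
      using mono by (intro polys_sum) blast
    moreover have "w \<in> lists S"
      using insert.prems by simp
    ultimately show ?case
      using insert mono[of w] add by simp
  qed
  moreover have "Poly_Mapping.keys p \<subseteq> lists S"
    using assms(1) by (simp add: free_algebra_def)
  ultimately show ?thesis
    using poly_sum_monomials[of p] by (metis finite_keys)
qed

text \<open>
  The algebra homomorphism out of the free algebra that is prescribed by \<open>\<psi>\<close> on the letters.
\<close>

definition subst_letters ::
    "('w \<Rightarrow> ('v list \<Rightarrow>\<^sub>0 complex)) \<Rightarrow> ('w list \<Rightarrow>\<^sub>0 complex) \<Rightarrow> ('v list \<Rightarrow>\<^sub>0 complex)" where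
  "subst_letters \<psi> p =
     (\<Sum>w\<in>Poly_Mapping.keys p. scal (Poly_Mapping.lookup p w) * prod_list (map \<psi> w))"

lemma subst_letters_add: "subst_letters \<psi> (p + q) = subst_letters \<psi> p + subst_letters \<psi> q"
  unfolding subst_letters_def
  by (rule setsum_keys_plus_distrib) (simp_all add: scal_add distrib_right)

lemma subst_letters_single: "subst_letters \<psi> (Poly_Mapping.single w c) = scal c * prod_list (map \<psi> w)"
  by (simp add: subst_letters_def)

lemma subst_letters_0 [simp]: "subst_letters \<psi> 0 = 0"
  by (simp add: subst_letters_def)

lemma subst_letters_mult: "subst_letters \<psi> (p * q) = subst_letters \<psi> p * subst_letters \<psi> q"
proof (induction p rule: poly_additive_induct)
  case (single v a)
  show ?case
  proof (induction q rule: poly_additive_induct)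
    case (single w b)
    show ?case
      by (simp add: mult_single subst_letters_single plus_list_def scal_times_scal)
  qed (simp add: distrib_left subst_letters_add)
qed (simp add: distrib_right subst_letters_add)

lemma subst_letters_scal [simp]: "subst_letters \<psi> (scal c) = scal c"
  by (simp add: scal_def subst_letters_single[of _ "[]"])

lemma subst_letters_letter [simp]: "subst_letters \<psi> (letter x) = \<psi> x"
  by (simp add: letter_def subst_letters_single[of _ "[x]"])

lemma subst_letters_one [simp]: "subst_letters \<psi> 1 = 1"
  using subst_letters_scal[of \<psi> 1] by simp

lemma subst_letters_diff: "subst_letters \<psi> (p - q) = subst_letters \<psi> p - subst_letters \<psi> q"
  by (metis add_diff_cancel diff_add_cancel subst_letters_add)

lemma subst_letters_polys:
  assumes "\<And>x. x \<in> S \<Longrightarrow> \<psi> x \<in> polys T" and "p \<in> polys S"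
  shows "subst_letters \<psi> p \<in> polys T"
  using assms(2)
  by (induction rule: polys_induct) (simp_all add: assms subst_letters_add subst_letters_mult)

lemma free_algebra_simps [simp]:
  "\<zero>\<^bsub>free_algebra S\<^esub> = 0" "\<one>\<^bsub>free_algebra S\<^esub> = 1"
  "p \<oplus>\<^bsub>free_algebra S\<^esub> q = p + q" "p \<otimes>\<^bsub>free_algebra S\<^esub> q = p * q"
  "c \<odot>\<^bsub>free_algebra S\<^esub> p = scal c * p"
  by (simp_all add: free_algebra_def)

lemma ring_free_algebra: "ring (free_algebra S)"
proof (rule ringI)
  show "abelian_group (free_algebra S)"
  proof (rule abelian_groupI)
    fix p assume "p \<in> polys S"
    then show "\<exists>q\<in>polys S. q \<oplus>\<^bsub>free_algebra S\<^esub> p = \<zero>\<^bsub>free_algebra S\<^esub>"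
      by (intro bexI[of _ "- p"]) simp_all
  qed (simp_all add: add.assoc add.commute)
  show "Group.monoid (free_algebra S)"
    by (rule Group.monoidI) (simp_all add: mult.assoc)
qed (simp_all add: distrib_left distrib_right)


section \<open>Quotients of free algebras\<close>

text \<open>
  Elements of a quotient are handled through representatives: \<open>cls\<close> is the projection and
  \<open>\<doteq>\<close> is equality of classes.  Identities in the quotient can then be derived in the ring type
  of polynomials, where sums and products are the ordinary ones, and pushed down by the
  \<open>cls\<close>-rules at the end.
\<close>

locale quotient_of_free =
  fixes S :: "'w set" and J :: "('w list \<Rightarrow>\<^sub>0 complex) set"
  assumes ideal_J: "ideal J (free_algebra S)"
begin

sublocale I: ideal J "free_algebra S"
  by (rule ideal_J)

abbreviation Q where "Q \<equiv> quotient_algebra (free_algebra S) J"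

definition cls :: "('w list \<Rightarrow>\<^sub>0 complex) \<Rightarrow> ('w list \<Rightarrow>\<^sub>0 complex) set" where
  "cls p = J +>\<^bsub>free_algebra S\<^esub> p"

definition eqmod :: "('w list \<Rightarrow>\<^sub>0 complex) \<Rightarrow> ('w list \<Rightarrow>\<^sub>0 complex) \<Rightarrow> bool" (infix \<open>\<doteq>\<close> 50) where
  "p \<doteq> q \<longleftrightarrow> p - q \<in> J"

lemma J_polys: "p \<in> J \<Longrightarrow> p \<in> polys S"
  by (rule I.a_Hcarr)

lemma J_0 [simp]: "0 \<in> J"
  using additive_subgroup.zero_closed[OF I.is_additive_subgroup] by simp

lemma J_add: "p \<in> J \<Longrightarrow> q \<in> J \<Longrightarrow> p + q \<in> J"
  using additive_subgroup.a_closed[OF I.is_additive_subgroup] by simp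

lemma J_left: "p \<in> polys S \<Longrightarrow> q \<in> J \<Longrightarrow> p * q \<in> J"
  using I.I_l_closed[of q p] by simp

lemma J_right: "p \<in> polys S \<Longrightarrow> q \<in> J \<Longrightarrow> q * p \<in> J"
  using I.I_r_closed[of q p] by simp

lemma J_uminus: "p \<in> J \<Longrightarrow> - p \<in> J"
  using J_left[of "scal (- 1)" p] by (simp add: scal_uminus)

lemma J_diff: "p \<in> J \<Longrightarrow> q \<in> J \<Longrightarrow> p - q \<in> J"
  using J_add[of p "- q"] J_uminus[of q] by simp

lemma J_sum: "(\<And>x. x \<in> X \<Longrightarrow> f x \<in> J) \<Longrightarrow> sum f X \<in> J"
  by (induction X rule: infinite_finite_induct) (simp_all add: J_add)

lemma eqmod_refl [simp]: "p \<doteq> p"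
  by (simp add: eqmod_def)

lemma eqmod_sym: "p \<doteq> q \<Longrightarrow> q \<doteq> p"
  using J_uminus[of "p - q"] by (simp add: eqmod_def)

lemma eqmod_trans [trans]: "p \<doteq> q \<Longrightarrow> q \<doteq> r \<Longrightarrow> p \<doteq> r"
  using J_add[of "p - q" "q - r"] by (simp add: eqmod_def)

lemma eqmod_add: "p \<doteq> p' \<Longrightarrow> q \<doteq> q' \<Longrightarrow> p + q \<doteq> p' + q'"
  using J_add[of "p - p'" "q - q'"] by (simp add: eqmod_def algebra_simps)

lemma eqmod_diff: "p \<doteq> p' \<Longrightarrow> q \<doteq> q' \<Longrightarrow> p - q \<doteq> p' - q'"
  using J_diff[of "p - p'" "q - q'"] by (simp add: eqmod_def algebra_simps)

lemma eqmod_sum: "(\<And>x. x \<in> X \<Longrightarrow> f x \<doteq> g x) \<Longrightarrow> sum f X \<doteq> sum g X"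
  using J_sum[of X "\<lambda>x. f x - g x"] by (simp add: eqmod_def sum_subtractf)

lemma eqmod_left: "r \<in> polys S \<Longrightarrow> p \<doteq> q \<Longrightarrow> r * p \<doteq> r * q"
  using J_left[of r "p - q"] by (simp add: eqmod_def algebra_simps)

lemma eqmod_right: "r \<in> polys S \<Longrightarrow> p \<doteq> q \<Longrightarrow> p * r \<doteq> q * r"
  using J_right[of r "p - q"] by (simp add: eqmod_def algebra_simps)

lemma eqmod_scal: "p \<doteq> q \<Longrightarrow> scal c * p \<doteq> scal c * q"
  by (simp add: eqmod_left)

lemma eqmod_mult:
  assumes "p \<doteq> p'" "q \<doteq> q'" "p' \<in> polys S" "q \<in> polys S"
  shows "p * q \<doteq> p' * q'"
  using eqmod_right[OF assms(4,1)] eqmod_left[OF assms(3,2)] by (rule eqmod_trans)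

lemma carrier_Q: "carrier Q = cls ` polys S"
  by (auto simp: quotient_algebra_def ring.defs module.defs FactRing_def A_RCOSETS_def'
      a_r_coset_def' cls_def)

lemma cls_closed [simp, intro]: "p \<in> polys S \<Longrightarrow> cls p \<in> carrier Q"
  by (simp add: carrier_Q)

lemma mem_cls: "r \<in> cls p \<longleftrightarrow> r \<doteq> p"
proof -
  have "r \<in> cls p \<longleftrightarrow> (\<exists>j\<in>J. r = j + p)"
    by (auto simp: cls_def a_r_coset_def')
  also have "\<dots> \<longleftrightarrow> r \<doteq> p"
    unfolding eqmod_def by (metis add_diff_cancel diff_add_cancel)
  finally show ?thesis .
qed

lemma cls_eq_iff: "cls p = cls q \<longleftrightarrow> p \<doteq> q"
  using mem_cls eqmod_trans eqmod_sym eqmod_refl by blast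

lemma cls_zero: "\<zero>\<^bsub>Q\<^esub> = cls 0"
  using I.a_coset_add_zero[of J] I.a_subset
  by (simp add: quotient_algebra_def ring.defs module.defs FactRing_def cls_def)

lemma cls_one: "\<one>\<^bsub>Q\<^esub> = cls 1"
  by (simp add: quotient_algebra_def ring.defs module.defs FactRing_def cls_def)

lemma cls_add: "p \<in> polys S \<Longrightarrow> q \<in> polys S \<Longrightarrow> cls p \<oplus>\<^bsub>Q\<^esub> cls q = cls (p + q)"
  using I.a_rcos_sum[of p q]
  by (simp add: quotient_algebra_def ring.defs module.defs FactRing_def cls_def)

lemma cls_mult: "p \<in> polys S \<Longrightarrow> q \<in> polys S \<Longrightarrow> cls p \<otimes>\<^bsub>Q\<^esub> cls q = cls (p * q)"
  using I.rcoset_mult_add[of p q]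
  by (simp add: quotient_algebra_def ring.defs module.defs FactRing_def cls_def)

lemma cls_smult:
  assumes "p \<in> polys S"
  shows "c \<odot>\<^bsub>Q\<^esub> cls p = cls (scal c * p)"
proof -
  have "c \<odot>\<^bsub>Q\<^esub> cls p = (\<Union>x\<in>cls p. cls (scal c * x))"
    by (simp add: quotient_algebra_def ring.defs module.defs cls_def)
  also have "\<dots> = cls (scal c * p)"
  proof -
    have "cls (scal c * x) = cls (scal c * p)" if "x \<in> cls p" for x
      using that by (simp add: cls_eq_iff mem_cls eqmod_scal)
    moreover have "p \<in> cls p"
      by (simp add: mem_cls)
    ultimately show ?thesis by blast
  qed
  finally show ?thesis .
qed

lemma ring_Q: "ring Q"
proof -
  interpret R: ring "free_algebra S Quot J"
    by (rule I.quotient_is_ring)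
  show ?thesis
    by (intro ringI abelian_groupI Group.monoidI)
      (simp_all add: quotient_algebra_def ring.defs module.defs R.add.m_assoc R.m_assoc R.l_distr
        R.r_distr R.a_comm R.a_lcomm R.add.l_inv_ex)
qed

lemma complex_algebra_Q: "complex_algebra Q"
proof -
  interpret R: ring Q by (rule ring_Q)
  have "module class_ring Q"
  proof (rule moduleI[OF cring_complex])
    show "abelian_group Q" ..
  qed (auto simp: carrier_Q cls_smult cls_add scal_add scal_mult algebra_simps)
  then show ?thesis
    by (intro complex_algebra.intro ring_Q complex_algebra_axioms.intro)
      (auto simp: carrier_Q cls_smult cls_mult scal_left_commute mult.assoc)
qed

sublocale Q: complex_algebra Q
  by (rule complex_algebra_Q)

lemma cls_uminus: "p \<in> polys S \<Longrightarrow> \<ominus>\<^bsub>Q\<^esub> cls p = cls (- p)"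
  by (rule Q.minus_equality) (simp_all add: cls_add cls_zero)

lemma cls_diff: "p \<in> polys S \<Longrightarrow> q \<in> polys S \<Longrightarrow> cls p \<ominus>\<^bsub>Q\<^esub> cls q = cls (p - q)"
  by (simp add: a_minus_def cls_uminus cls_add)

lemma cls_sum:
  assumes "finite X" and "\<And>x. x \<in> X \<Longrightarrow> f x \<in> polys S"
  shows "(\<Oplus>\<^bsub>Q\<^esub>x\<in>X. cls (f x)) = cls (sum f X)"
  using assms
proof (induction X)
  case empty
  then show ?case by (simp add: cls_zero)
next
  case (insert x X)
  then show ?case
    by (subst Q.finsum_insert) (auto simp: cls_add)
qed

lemma finsum_cls:
  assumes "finite X" and "\<And>x. x \<in> X \<Longrightarrow> g x = cls (f x)" and "\<And>x. x \<in> X \<Longrightarrow> f x \<in> polys S"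
  shows "(\<Oplus>\<^bsub>Q\<^esub>x\<in>X. g x) = cls (sum f X)"
proof -
  have "(\<Oplus>\<^bsub>Q\<^esub>x\<in>X. g x) = (\<Oplus>\<^bsub>Q\<^esub>x\<in>X. cls (f x))"
    using assms by (intro Q.finsum_cong') auto
  then show ?thesis
    using cls_sum[of X f] assms by simp
qed

text \<open>The free extension of a map into the quotient is computed on representatives.\<close>

lemma free_extension_cls:
  assumes \<phi>: "\<And>x. x \<in> T \<Longrightarrow> \<phi> x = cls (\<psi> x)" and \<psi>: "\<And>x. x \<in> T \<Longrightarrow> \<psi> x \<in> polys S"
    and p: "p \<in> polys T"
  shows "free_extension Q \<phi> p = cls (subst_letters \<psi> p)"
proof -
  have word: "foldr (\<otimes>\<^bsub>Q\<^esub>) (map \<phi> w) \<one>\<^bsub>Q\<^esub> = cls (prod_list (map \<psi> w)) \<and>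
      prod_list (map \<psi> w) \<in> polys S" if "w \<in> lists T" for w
    using that by (induction w) (auto simp: cls_one cls_mult \<phi> \<psi>)
  have keys: "w \<in> lists T" if "w \<in> Poly_Mapping.keys p" for w
    using p that by (auto simp: free_algebra_def)
  show ?thesis
    unfolding free_extension_def subst_letters_def
  proof (rule finsum_cls)
    fix w assume "w \<in> Poly_Mapping.keys p"
    from word[OF keys[OF this]]
    show "Poly_Mapping.lookup p w \<odot>\<^bsub>Q\<^esub> foldr (\<otimes>\<^bsub>Q\<^esub>) (map \<phi> w) \<one>\<^bsub>Q\<^esub> =
        cls (scal (Poly_Mapping.lookup p w) * prod_list (map \<psi> w))"
      and "scal (Poly_Mapping.lookup p w) * prod_list (map \<psi> w) \<in> polys S"
      by (simp_all add: cls_smult)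
  qed simp
qed

end

lemma quotient_of_free_genideal:
  "R \<subseteq> polys S \<Longrightarrow> quotient_of_free S (genideal (free_algebra S) R)"
  by (simp add: quotient_of_free_def ring.genideal_ideal ring_free_algebra)

text \<open>
  Universal property: a substitution descends to the quotients as soon as it maps the generators of
  the ideal to zero, because the polynomials whose image vanishes form a two-sided ideal.
\<close>

lemma (in quotient_of_free) induced_map_cls:
  assumes R: "R \<subseteq> polys T"
    and \<phi>: "\<And>x. x \<in> T \<Longrightarrow> \<phi> x = cls (\<psi> x)" and \<psi>: "\<And>x. x \<in> T \<Longrightarrow> \<psi> x \<in> polys S"
    and rel: "\<And>r. r \<in> R \<Longrightarrow> subst_letters \<psi> r \<doteq> 0"
    and p: "p \<in> polys T"
  shows "induced_map Q \<phi> (quotient_of_free.cls T (genideal (free_algebra T) R) p) =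
    cls (subst_letters \<psi> p)"
proof -
  interpret T: quotient_of_free T "genideal (free_algebra T) R"
    by (rule quotient_of_free_genideal[OF R])
  define K where "K = {r \<in> polys T. subst_letters \<psi> r \<in> J}"
  have "ideal K (free_algebra T)"
  proof (rule idealI)
    show "ring (free_algebra T)" by (rule ring_free_algebra)
    have neg: "\<ominus>\<^bsub>free_algebra T\<^esub> r = - r" if "r \<in> polys T" for r
      using that by (intro T.I.minus_equality) simp_all
    show "subgroup K (add_monoid (free_algebra T))"
    proof (rule T.I.add.subgroupI)
      show "K \<noteq> {}" by (auto simp: K_def intro!: exI[of _ 0])
    next
      fix a assume "a \<in> K"
      then show "\<ominus>\<^bsub>free_algebra T\<^esub> a \<in> K"
        using J_uminus[of "subst_letters \<psi> a"] subst_letters_diff[of \<psi> 0 a]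
        by (simp add: K_def neg)
    qed (auto simp: K_def subst_letters_add J_add)
  qed (simp_all add: K_def subst_letters_mult J_left J_right subst_letters_polys[OF \<psi>])
  moreover have "R \<subseteq> K"
    using R rel by (auto simp: K_def eqmod_def)
  ultimately have K: "genideal (free_algebra T) R \<subseteq> K"
    by (rule T.I.genideal_minimal)
  have "free_extension Q \<phi> q = cls (subst_letters \<psi> p)" if "q \<in> T.cls p" for q
  proof -
    have d: "q - p \<in> genideal (free_algebra T) R"
      using that by (simp add: T.mem_cls T.eqmod_def)
    then have "q - p \<in> polys T"
      by (rule T.J_polys)
    then have "q \<in> polys T"
      using polys_add[OF _ p, of "q - p"] by simp
    then have "free_extension Q \<phi> q = cls (subst_letters \<psi> q)"
      using \<phi> \<psi> by (intro free_extension_cls)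
    also have "\<dots> = cls (subst_letters \<psi> p)"
      using d K by (auto simp: cls_eq_iff eqmod_def K_def subst_letters_diff)
    finally show ?thesis .
  qed
  moreover have "p \<in> T.cls p"
    by (simp add: T.mem_cls)
  ultimately have "free_extension Q \<phi> ` T.cls p = {cls (subst_letters \<psi> p)}"
    by (intro antisym image_subsetI) (auto intro: rev_image_eqI)
  then show ?thesis
    by (simp add: induced_map_def)
qed


section \<open>Derivatives of curves\<close>

text \<open>
  Differentiability at \<open>0\<close> as in \<^const>\<open>has_derivative_at_0\<close>, but for curves of representatives.
\<close>

definition poly_curve_deriv ::
    "'w set \<Rightarrow> (complex \<Rightarrow> ('w list \<Rightarrow>\<^sub>0 complex)) \<Rightarrow> ('w list \<Rightarrow>\<^sub>0 complex) \<Rightarrow> bool" where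
  "poly_curve_deriv S \<gamma> D \<longleftrightarrow>
     (\<exists>(n :: nat) v c c'. (\<forall>j<n. v j \<in> polys S) \<and>
        (\<forall>j<n. (c j has_field_derivative c' j) (at 0)) \<and>
        (\<forall>\<^sub>F t in nhds 0. \<gamma> t = (\<Sum>j<n. scal (c j t) * v j)) \<and>
        D = (\<Sum>j<n. scal (c' j) * v j))"

lemma poly_curve_derivI:
  fixes S :: "'w set"
  assumes "finite K"
    and v: "\<And>j. j \<in> K \<Longrightarrow> v j \<in> polys S"
    and c: "\<And>j. j \<in> K \<Longrightarrow> (c j has_field_derivative c' j) (at 0)"
    and \<gamma>: "\<forall>\<^sub>F t in nhds 0. \<gamma> t = (\<Sum>j\<in>K. scal (c j t) * v j)"
    and D: "D = (\<Sum>j\<in>K. scal (c' j) * v j)"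
  shows "poly_curve_deriv S \<gamma> D"
proof -
  obtain h where h: "bij_betw h {..<card K} K"
    using ex_bij_betw_nat_finite[OF \<open>finite K\<close>] by (auto simp: lessThan_atLeast0)
  then have hK: "h j \<in> K" if "j < card K" for j
    using that by (auto simp: bij_betw_def)
  have "(\<Sum>j\<in>K. f j) = (\<Sum>j<card K. f (h j))" for f :: "_ \<Rightarrow> ('w list \<Rightarrow>\<^sub>0 complex)"
    using sum.reindex_bij_betw[OF h] by metis
  with \<gamma> D hK v c show ?thesis
    unfolding poly_curve_deriv_def
    by (intro exI[of _ "card K"] exI[of _ "v \<circ> h"] exI[of _ "c \<circ> h"] exI[of _ "c' \<circ> h"]) simp
qed

lemma poly_curve_deriv_polys: "poly_curve_deriv S \<gamma> D \<Longrightarrow> D \<in> polys S"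
  by (auto simp: poly_curve_deriv_def)

lemma poly_curve_deriv_const: "p \<in> polys S \<Longrightarrow> poly_curve_deriv S (\<lambda>t. p) 0"
  by (rule poly_curve_derivI[of "{()}" "\<lambda>_. p" S "\<lambda>_ _. 1" "\<lambda>_. 0"]) auto

lemma poly_curve_deriv_add:
  assumes "poly_curve_deriv S \<gamma> D" "poly_curve_deriv S \<delta> E"
  shows "poly_curve_deriv S (\<lambda>t. \<gamma> t + \<delta> t) (D + E)"
proof -
  obtain n v c c' where 1: "\<forall>j<(n::nat). v j \<in> polys S" "\<forall>j<n. (c j has_field_derivative c' j) (at 0)"
      "\<forall>\<^sub>F t in nhds 0. \<gamma> t = (\<Sum>j<n. scal (c j t) * v j)" "D = (\<Sum>j<n. scal (c' j) * v j)"
    using assms(1) by (auto simp: poly_curve_deriv_def)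
  obtain m w e e' where 2: "\<forall>j<(m::nat). w j \<in> polys S" "\<forall>j<m. (e j has_field_derivative e' j) (at 0)"
      "\<forall>\<^sub>F t in nhds 0. \<delta> t = (\<Sum>j<m. scal (e j t) * w j)" "E = (\<Sum>j<m. scal (e' j) * w j)"
    using assms(2) by (auto simp: poly_curve_deriv_def)
  show ?thesis
  proof (rule poly_curve_derivI[of "{..<n} <+> {..<m}" "case_sum v w" S "case_sum c e" "case_sum c' e'"])
    show "\<forall>\<^sub>F t in nhds 0. \<gamma> t + \<delta> t =
        (\<Sum>j\<in>{..<n} <+> {..<m}. scal (case_sum c e j t) * case_sum v w j)"
      using 1(3) 2(3) by eventually_elim (simp add: sum.Plus)
  qed (use 1 2 in \<open>auto simp: sum.Plus\<close>)
qed

lemma poly_curve_deriv_mult: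
  assumes "poly_curve_deriv S \<gamma> D" "poly_curve_deriv S \<delta> E"
  shows "poly_curve_deriv S (\<lambda>t. \<gamma> t * \<delta> t) (D * \<delta> 0 + \<gamma> 0 * E)"
proof -
  obtain n v c c' where 1: "\<forall>j<(n::nat). v j \<in> polys S" "\<forall>j<n. (c j has_field_derivative c' j) (at 0)"
      "\<forall>\<^sub>F t in nhds 0. \<gamma> t = (\<Sum>j<n. scal (c j t) * v j)" "D = (\<Sum>j<n. scal (c' j) * v j)"
    using assms(1) by (auto simp: poly_curve_deriv_def)
  obtain m w e e' where 2: "\<forall>j<(m::nat). w j \<in> polys S" "\<forall>j<m. (e j has_field_derivative e' j) (at 0)"
      "\<forall>\<^sub>F t in nhds 0. \<delta> t = (\<Sum>j<m. scal (e j t) * w j)" "E = (\<Sum>j<m. scal (e' j) * w j)"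
    using assms(2) by (auto simp: poly_curve_deriv_def)
  have prod: "(\<Sum>i<n. scal (a i) * v i) * (\<Sum>j<m. scal (b j) * w j) =
      (\<Sum>(i, j)\<in>{..<n} \<times> {..<m}. scal (a i * b j) * (v i * w j))" for a b
    unfolding sum_product
    by (simp add: sum.cartesian_product scal_times_scal)
  have \<gamma>0: "\<gamma> 0 = (\<Sum>j<n. scal (c j 0) * v j)" and \<delta>0: "\<delta> 0 = (\<Sum>j<m. scal (e j 0) * w j)"
    using 1(3) 2(3) by (auto dest: eventually_nhds_x_imp_x)
  show ?thesis
  proof (rule poly_curve_derivI[of "{..<n} \<times> {..<m}" "\<lambda>(i, j). v i * w j" S
        "\<lambda>(i, j) t. c i t * e j t" "\<lambda>(i, j). c' i * e j 0 + c i 0 * e' j"])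
    show "\<forall>\<^sub>F t in nhds 0. \<gamma> t * \<delta> t = (\<Sum>x\<in>{..<n} \<times> {..<m}.
        scal ((case x of (i, j) \<Rightarrow> \<lambda>t. c i t * e j t) t) * (case x of (i, j) \<Rightarrow> v i * w j))"
      using 1(3) 2(3) by eventually_elim (simp add: prod case_prod_unfold)
    show "D * \<delta> 0 + \<gamma> 0 * E = (\<Sum>x\<in>{..<n} \<times> {..<m}.
        scal (case x of (i, j) \<Rightarrow> c' i * e j 0 + c i 0 * e' j) * (case x of (i, j) \<Rightarrow> v i * w j))"
      by (simp add: 1(4) 2(4) \<gamma>0 \<delta>0 prod case_prod_unfold scal_add distrib_right sum.distrib)
    show "((case x of (i, j) \<Rightarrow> \<lambda>t. c i t * e j t) has_field_derivative
        (case x of (i, j) \<Rightarrow> c' i * e j 0 + c i 0 * e' j)) (at 0)" if "x \<in> {..<n} \<times> {..<m}" for x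
      using that 1(2) 2(2) by (auto intro!: derivative_eq_intros simp: mult.commute)
  qed (use 1(1) 2(1) in auto)
qed

lemma poly_curve_deriv_scal:
  assumes "(c has_field_derivative c') (at 0)" "p \<in> polys S"
  shows "poly_curve_deriv S (\<lambda>t. scal (c t) * p) (scal c' * p)"
  by (rule poly_curve_derivI[of "{()}" "\<lambda>_. p" S "\<lambda>_. c" "\<lambda>_. c'"]) (use assms in auto)

lemma poly_curve_deriv_sum:
  "finite X \<Longrightarrow> (\<And>x. x \<in> X \<Longrightarrow> poly_curve_deriv S (\<gamma> x) (D x)) \<Longrightarrow>
    poly_curve_deriv S (\<lambda>t. \<Sum>x\<in>X. \<gamma> x t) (\<Sum>x\<in>X. D x)"
  by (induction X rule: finite_induct)
    (simp_all add: poly_curve_deriv_add poly_curve_deriv_const)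

lemma poly_curve_deriv_scal_left:
  "poly_curve_deriv S \<gamma> D \<Longrightarrow> poly_curve_deriv S (\<lambda>t. scal a * \<gamma> t) (scal a * D)"
  using poly_curve_deriv_mult[OF poly_curve_deriv_const[OF polys_scal[of a S]]] by fastforce

context quotient_of_free
begin

text \<open>
  Leibniz rule: if a family of substitutions starts at the identity and differentiates to an inner
  derivation on letters, then it does so on all polynomials.
\<close>

lemma subst_letters_curve_deriv:
  assumes M: "M \<in> polys S"
    and deriv: "\<And>x. x \<in> S \<Longrightarrow> \<exists>D. poly_curve_deriv S (\<lambda>t. \<psi> t x) D \<and> D \<doteq> M * letter x - letter x * M"
    and start: "\<And>x. x \<in> S \<Longrightarrow> \<psi> 0 x \<doteq> letter x"
    and closed: "\<And>t x. x \<in> S \<Longrightarrow> \<psi> t x \<in> polys S"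
    and "p \<in> polys S"
  shows "\<exists>D. poly_curve_deriv S (\<lambda>t. subst_letters (\<psi> t) p) D \<and> D \<doteq> M * p - p * M"
proof -
  have "subst_letters (\<psi> 0) p \<doteq> p \<and>
      (\<exists>D. poly_curve_deriv S (\<lambda>t. subst_letters (\<psi> t) p) D \<and> D \<doteq> M * p - p * M)"
    using \<open>p \<in> polys S\<close>
  proof (induction rule: polys_induct)
    case (scal c)
    have "poly_curve_deriv S (\<lambda>t. subst_letters (\<psi> t) (scal c)) 0"
      by (simp add: poly_curve_deriv_const)
    then show ?case
      by (auto simp: scal_central intro!: exI[of _ 0])
  next
    case (letter x)
    then show ?case by (simp add: deriv start)
  next
    case (add p q)
    then obtain D E where D: "poly_curve_deriv S (\<lambda>t. subst_letters (\<psi> t) p) D" "D \<doteq> M * p - p * M"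
      and E: "poly_curve_deriv S (\<lambda>t. subst_letters (\<psi> t) q) E" "E \<doteq> M * q - q * M"
      by blast
    have "D + E \<doteq> M * (p + q) - (p + q) * M"
      using eqmod_add[OF D(2) E(2)] by (simp add: algebra_simps)
    then show ?case
      using poly_curve_deriv_add[OF D(1) E(1)] add.IH
      by (auto simp: subst_letters_add intro: eqmod_add)
  next
    case (mult p q)
    then obtain D E where D: "poly_curve_deriv S (\<lambda>t. subst_letters (\<psi> t) p) D" "D \<doteq> M * p - p * M"
      and E: "poly_curve_deriv S (\<lambda>t. subst_letters (\<psi> t) q) E" "E \<doteq> M * q - q * M"
      by blast
    note sq = subst_letters_polys[of S "\<psi> 0" S q, OF closed \<open>q \<in> polys S\<close>]
    have "D * subst_letters (\<psi> 0) q + subst_letters (\<psi> 0) p * E \<doteq> (M * p - p * M) * q + p * (M * q - q * M)"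
      using mult M by (intro eqmod_add eqmod_mult D E sq poly_curve_deriv_polys[OF E(1)]) auto
    also have "\<dots> = M * (p * q) - (p * q) * M"
      by (simp add: algebra_simps)
    finally show ?case
      using poly_curve_deriv_mult[OF D(1) E(1)] mult sq
      by (auto simp: subst_letters_mult intro: eqmod_mult)
  qed
  then show ?thesis ..
qed

text \<open>
  If a combination of fixed vectors with varying coefficients vanishes near \<open>0\<close>, so does the
  combination with the derivatives of the coefficients, even if the vectors are dependent.  The
  induction removes one vector \<open>v j\<close>: either it is a combination of the others and its coefficient can
  be distributed over theirs, or its coefficient is identically \<open>0\<close> near \<open>0\<close>.  This is what makes
  the derivative of a curve in the quotient unique, without knowing a basis of the quotient.
\<close>

lemma vanishing_curve_deriv:
  assumes "finite K"
    and "\<And>j. j \<in> K \<Longrightarrow> (c j has_field_derivative c' j) (at 0)"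
    and "\<forall>\<^sub>F t in nhds 0. (\<Sum>j\<in>K. scal (c j t) * v j) \<in> J"
  shows "(\<Sum>j\<in>K. scal (c' j) * v j) \<in> J"
  using assms
proof (induction K arbitrary: c c')
  case empty
  then show ?case by simp
next
  case (insert j K)
  have ev: "\<forall>\<^sub>F t in nhds 0. scal (c j t) * v j + (\<Sum>i\<in>K. scal (c i t) * v i) \<in> J"
    using insert by simp
  show ?case
  proof (cases "\<exists>a. v j - (\<Sum>i\<in>K. scal (a i) * v i) \<in> J")
    case True
    then obtain a where a: "v j - (\<Sum>i\<in>K. scal (a i) * v i) \<in> J" by blast
    have split: "s * v j + (\<Sum>i\<in>K. r i * v i) = (\<Sum>i\<in>K. (r i + s * scal (a i)) * v i) +
        s * (v j - (\<Sum>i\<in>K. scal (a i) * v i))" for s r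
      by (simp add: algebra_simps sum.distrib sum_distrib_left)
    have "\<forall>\<^sub>F t in nhds 0. (\<Sum>i\<in>K. scal (c i t + c j t * a i) * v i) \<in> J"
      using ev
    proof eventually_elim
      case (elim t)
      then show ?case
        using J_diff[OF elim J_left[OF polys_scal a, of "c j t"]]
        by (simp add: split scal_add scal_mult)
    qed
    then have "(\<Sum>i\<in>K. scal (c' i + c' j * a i) * v i) \<in> J"
      using insert.prems by (intro insert.IH) (auto intro!: derivative_eq_intros)
    then have "(\<Sum>i\<in>K. (scal (c' i) + scal (c' j) * scal (a i)) * v i) +
        scal (c' j) * (v j - (\<Sum>i\<in>K. scal (a i) * v i)) \<in> J"
      using J_left[OF polys_scal a, of "c' j"] by (simp add: J_add scal_add scal_mult)
    then show ?thesis
      using insert by (simp flip: split)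
  next
    case False
    have zero: "c j t = 0" if "scal (c j t) * v j + (\<Sum>i\<in>K. scal (c i t) * v i) \<in> J" for t
    proof (rule ccontr)
      assume "c j t \<noteq> 0"
      have "scal (inverse (c j t)) * (scal (c j t) * v j + (\<Sum>i\<in>K. scal (c i t) * v i)) \<in> J"
        by (rule J_left[OF polys_scal that])
      also have "scal (inverse (c j t)) * (scal (c j t) * v j + (\<Sum>i\<in>K. scal (c i t) * v i)) =
          v j - (\<Sum>i\<in>K. scal (- inverse (c j t) * c i t) * v i)"
        using \<open>c j t \<noteq> 0\<close>
        by (simp add: distrib_left sum_distrib_left sum_negf scal_uminus scal_scal_times)
      finally have "\<exists>a. v j - (\<Sum>i\<in>K. scal (a i) * v i) \<in> J"
        by (rule exI[of _ "\<lambda>i. - inverse (c j t) * c i t"])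
      with False show False
        by contradiction
    qed
    have ev0: "\<forall>\<^sub>F t in nhds 0. c j t = 0"
      using ev by eventually_elim (rule zero)
    then have "((\<lambda>_. 0) has_field_derivative c' j) (at 0)"
      using insert.prems(1)[of j] DERIV_cong_ev[OF refl ev0 refl] by simp
    then have "c' j = 0"
      by (metis DERIV_const DERIV_unique)
    moreover have "(\<Sum>i\<in>K. scal (c' i) * v i) \<in> J"
    proof (rule insert.IH)
      show "\<forall>\<^sub>F t in nhds 0. (\<Sum>i\<in>K. scal (c i t) * v i) \<in> J"
        using ev ev0 by eventually_elim simp
    qed (use insert.prems in auto)
    ultimately show ?thesis
      using insert by simp
  qed
qed

lemma has_derivative_at_0_lift:
  assumes "has_derivative_at_0 Q \<Gamma> D"
  obtains n v c c' where "\<And>j. j < (n :: nat) \<Longrightarrow> (c j has_field_derivative c' j) (at 0)"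
    and "\<forall>\<^sub>F t in nhds 0. \<Gamma> t = cls (\<Sum>j<n. scal (c j t) * v j)"
    and "D = cls (\<Sum>j<n. scal (c' j) * v j)"
proof -
  obtain n u c c' where 1: "\<forall>j<(n::nat). u j \<in> carrier Q" "\<forall>j<n. (c j has_field_derivative c' j) (at 0)"
      "\<forall>\<^sub>F t in nhds 0. \<Gamma> t = (\<Oplus>\<^bsub>Q\<^esub>j\<in>{..<n}. c j t \<odot>\<^bsub>Q\<^esub> u j)" "D = (\<Oplus>\<^bsub>Q\<^esub>j\<in>{..<n}. c' j \<odot>\<^bsub>Q\<^esub> u j)"
    using assms by (auto simp: has_derivative_at_0_def)
  then have "\<forall>j. \<exists>v. j < n \<longrightarrow> v \<in> polys S \<and> u j = cls v"
    by (auto simp: carrier_Q)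
  then obtain v where v: "\<And>j. j < n \<Longrightarrow> v j \<in> polys S \<and> u j = cls (v j)"
    by metis
  have "(\<Oplus>\<^bsub>Q\<^esub>j\<in>{..<n}. a j \<odot>\<^bsub>Q\<^esub> u j) = cls (\<Sum>j<n. scal (a j) * v j)" for a
    by (rule finsum_cls) (auto simp: v cls_smult)
  with 1 show ?thesis
    by (intro that[of n c c' v]) auto
qed

text \<open>
  The difference of two representations of the same curve is a representation of the zero curve.
\<close>

lemma has_derivative_at_0_unique:
  assumes "has_derivative_at_0 Q \<Gamma> D" "has_derivative_at_0 Q \<Gamma> E"
  shows "D = E"
proof -
  obtain n v c c' where 1: "\<And>j. j < (n::nat) \<Longrightarrow> (c j has_field_derivative c' j) (at 0)"
      "\<forall>\<^sub>F t in nhds 0. \<Gamma> t = cls (\<Sum>j<n. scal (c j t) * v j)" "D = cls (\<Sum>j<n. scal (c' j) * v j)"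
    by (rule has_derivative_at_0_lift[OF assms(1)], rule that, assumption+)
  obtain m w e e' where 2: "\<And>j. j < (m::nat) \<Longrightarrow> (e j has_field_derivative e' j) (at 0)"
      "\<forall>\<^sub>F t in nhds 0. \<Gamma> t = cls (\<Sum>j<m. scal (e j t) * w j)" "E = cls (\<Sum>j<m. scal (e' j) * w j)"
    by (rule has_derivative_at_0_lift[OF assms(2)], rule that, assumption+)
  have diff: "(\<Sum>j\<in>{..<n} <+> {..<m}. scal (case_sum a (\<lambda>j. - b j) j) * case_sum v w j) =
      (\<Sum>j<n. scal (a j) * v j) - (\<Sum>j<m. scal (b j) * w j)" for a b
    by (simp add: sum.Plus scal_uminus sum_negf)
  have cs: "case_sum c (\<lambda>j t. - e j t) j t = case_sum (\<lambda>j. c j t) (\<lambda>j. - e j t) j" for j t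
    by (cases j) simp_all
  have "(\<Sum>j\<in>{..<n} <+> {..<m}. scal (case_sum c' (\<lambda>j. - e' j) j) * case_sum v w j) \<in> J"
  proof (rule vanishing_curve_deriv)
    show "\<forall>\<^sub>F t in nhds 0.
        (\<Sum>j\<in>{..<n} <+> {..<m}. scal (case_sum c (\<lambda>j t. - e j t) j t) * case_sum v w j) \<in> J"
      using 1(2) 2(2)
    proof eventually_elim
      case (elim t)
      then have "(\<Sum>j<n. scal (c j t) * v j) \<doteq> (\<Sum>j<m. scal (e j t) * w j)"
        by (simp flip: cls_eq_iff)
      then show ?case
        by (simp only: cs diff eqmod_def)
    qed
  qed (auto intro!: derivative_eq_intros 1(1) 2(1))
  then show ?thesis
    by (simp only: diff 1(3) 2(3) cls_eq_iff eqmod_def)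
qed

lemma has_derivative_at_0_cls:
  assumes "poly_curve_deriv S \<gamma> D" and "\<forall>\<^sub>F t in nhds 0. \<Gamma> t = cls (\<gamma> t)"
  shows "has_derivative_at_0 Q \<Gamma> (cls D)"
proof -
  obtain n v c c' where 1: "\<forall>j<(n::nat). v j \<in> polys S" "\<forall>j<n. (c j has_field_derivative c' j) (at 0)"
      "\<forall>\<^sub>F t in nhds 0. \<gamma> t = (\<Sum>j<n. scal (c j t) * v j)" "D = (\<Sum>j<n. scal (c' j) * v j)"
    using assms(1) by (auto simp: poly_curve_deriv_def)
  have "(\<Oplus>\<^bsub>Q\<^esub>j\<in>{..<n}. a j \<odot>\<^bsub>Q\<^esub> cls (v j)) = cls (\<Sum>j<n. scal (a j) * v j)" for a
    by (rule finsum_cls) (auto simp: 1 cls_smult)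
  moreover have "\<forall>\<^sub>F t in nhds 0. \<Gamma> t = cls (\<Sum>j<n. scal (c j t) * v j)"
    using assms(2) 1(3) by eventually_elim simp
  ultimately show ?thesis
    unfolding has_derivative_at_0_def using 1
    by (intro exI[of _ n] exI[of _ "\<lambda>j. cls (v j)"] exI[of _ c] exI[of _ c']) auto
qed

end


section \<open>Duals of matrix spaces and the Lie algebra of trace functionals\<close>

lemma if_conj_zero: "(if P \<and> R then a else 0) = (if P then if R then a else 0 else 0)"
  by simp

lemma sum_if_const: "(\<Sum>x\<in>X. if P then f x else 0) = (if P then \<Sum>x\<in>X. f x else 0)"
  by simp

lemmas delta_simps = if_conj_zero sum_if_const mult_delta_left mult_delta_right

lemma mat_sum_simps:
  "carrier (mat_sum X r c) = (\<Pi>\<^sub>E x\<in>X. carrier_mat (r x) (c x))"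
  "B \<oplus>\<^bsub>mat_sum X r c\<^esub> C = (\<lambda>x\<in>X. B x + C x)"
  "a \<odot>\<^bsub>mat_sum X r c\<^esub> B = (\<lambda>x\<in>X. a \<cdot>\<^sub>m B x)"
  by (simp_all add: mat_sum_def)

lemma mat_sum_closed:
  "B \<in> carrier (mat_sum X r c) \<Longrightarrow> C \<in> carrier (mat_sum X r c) \<Longrightarrow> B \<oplus>\<^bsub>mat_sum X r c\<^esub> C \<in> carrier (mat_sum X r c)"
  "B \<in> carrier (mat_sum X r c) \<Longrightarrow> a \<odot>\<^bsub>mat_sum X r c\<^esub> B \<in> carrier (mat_sum X r c)"
  by (auto simp: mat_sum_simps PiE_iff)

lemma unit_family_closed [simp]: "unit_family X r c x k l \<in> carrier (mat_sum X r c)"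
  by (auto simp: mat_sum_simps unit_family_def)

lemma unit_family_entry:
  "y \<in> X \<Longrightarrow> p < r y \<Longrightarrow> q < c y \<Longrightarrow>
    unit_family X r c x k l y $$ (p, q) = (if y = x \<and> p = k \<and> q = l then 1 else 0)"
  by (simp add: unit_family_def)

lemma dual_space_simps:
  "f \<in> carrier (dual_space V) \<longleftrightarrow> f \<in> extensional (carrier V) \<and>
     (\<forall>x\<in>carrier V. \<forall>y\<in>carrier V. f (x \<oplus>\<^bsub>V\<^esub> y) = f x + f y) \<and>
     (\<forall>a. \<forall>x\<in>carrier V. f (a \<odot>\<^bsub>V\<^esub> x) = a * f x)"
  "\<zero>\<^bsub>dual_space V\<^esub> = (\<lambda>x\<in>carrier V. 0)"
  "f \<oplus>\<^bsub>dual_space V\<^esub> h = (\<lambda>x\<in>carrier V. f x + h x)"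
  "a \<odot>\<^bsub>dual_space V\<^esub> f = (\<lambda>x\<in>carrier V. a * f x)"
  by (simp_all add: dual_space_def)

lemma dual_spaceD:
  assumes "f \<in> carrier (dual_space V)"
  shows "x \<in> carrier V \<Longrightarrow> y \<in> carrier V \<Longrightarrow> f (x \<oplus>\<^bsub>V\<^esub> y) = f x + f y"
    and "x \<in> carrier V \<Longrightarrow> f (a \<odot>\<^bsub>V\<^esub> x) = a * f x"
  using assms by (auto simp: dual_space_simps)

lemma module_dual_space:
  assumes add: "\<And>x y. x \<in> carrier V \<Longrightarrow> y \<in> carrier V \<Longrightarrow> x \<oplus>\<^bsub>V\<^esub> y \<in> carrier V"
    and smult: "\<And>a x. x \<in> carrier V \<Longrightarrow> a \<odot>\<^bsub>V\<^esub> x \<in> carrier V"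
  shows "module (class_ring :: complex ring) (dual_space V)"
proof (rule moduleI[OF cring_complex])
  show "abelian_group (dual_space V)"
  proof (rule abelian_groupI)
    fix f assume "f \<in> carrier (dual_space V)"
    then show "\<exists>h\<in>carrier (dual_space V). h \<oplus>\<^bsub>dual_space V\<^esub> f = \<zero>\<^bsub>dual_space V\<^esub>"
      by (intro bexI[of _ "\<lambda>x\<in>carrier V. - f x"])
        (auto simp: dual_space_simps add smult cong: restrict_cong)
  qed (auto simp: dual_space_simps add smult algebra_simps extensional_def fun_eq_iff)
qed (auto simp: dual_space_simps add smult algebra_simps extensional_def fun_eq_iff)

text \<open>
  The functional is evaluated on the restrictions \<open>R Y\<close> of \<open>B\<close> to finite sets \<open>Y\<close> of matrix
  positions, where enlarging \<open>Y\<close> by one position adds a multiple of an elementary matrix.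
\<close>

lemma dual_space_expand:
  assumes "finite X" and f: "f \<in> carrier (dual_space (mat_sum X r c))"
    and B: "B \<in> carrier (mat_sum X r c)"
  shows "f B = (\<Sum>x\<in>X. \<Sum>k<r x. \<Sum>l<c x. f (unit_family X r c x k l) * B x $$ (k, l))"
proof -
  define T where "T = (SIGMA x:X. {..<r x} \<times> {..<c x})"
  define R where "R Y = (\<lambda>x\<in>X. mat (r x) (c x) (\<lambda>(p, q). if (x, p, q) \<in> Y then B x $$ (p, q) else 0))" for Y
  have R: "R Y \<in> carrier (mat_sum X r c)" for Y
    by (auto simp: R_def mat_sum_simps)
  have "finite T"
    using \<open>finite X\<close> by (simp add: T_def)
  have "f (R Y) = (\<Sum>(x, k, l)\<in>Y. f (unit_family X r c x k l) * B x $$ (k, l))" if "finite Y" "Y \<subseteq> T" for Y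
    using that
  proof (induction Y)
    case empty
    have "R {} = 0 \<odot>\<^bsub>mat_sum X r c\<^esub> R {}"
      by (auto simp: R_def mat_sum_simps fun_eq_iff intro!: eq_matI)
    then have "f (R {}) = 0 * f (R {})"
      using dual_spaceD(2)[OF f R] by metis
    then show ?case by simp
  next
    case (insert y Y)
    obtain x k l where y: "y = (x, k, l)"
      by (cases y) auto
    have "x \<in> X" "k < r x" "l < c x"
      using insert.prems by (auto simp: T_def y)
    have "R (insert y Y) = R Y \<oplus>\<^bsub>mat_sum X r c\<^esub> (B x $$ (k, l) \<odot>\<^bsub>mat_sum X r c\<^esub> unit_family X r c x k l)"
      using insert.hyps
      by (auto simp: R_def mat_sum_simps fun_eq_iff unit_family_def y intro!: eq_matI)
    then show ?case
      using insert by (simp add: dual_spaceD[OF f] R mat_sum_closed y)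
  qed
  moreover have "R T = B"
    using B by (auto simp: R_def T_def mat_sum_simps fun_eq_iff PiE_iff extensional_def intro!: eq_matI)
  ultimately have "f B = (\<Sum>(x, k, l)\<in>T. f (unit_family X r c x k l) * B x $$ (k, l))"
    using \<open>finite T\<close> by force
  also have "\<dots> = (\<Sum>x\<in>X. \<Sum>k<r x. \<Sum>l<c x. f (unit_family X r c x k l) * B x $$ (k, l))"
    using \<open>finite X\<close> unfolding T_def by (simp add: sum.Sigma sum.cartesian_product)
  finally show ?thesis .
qed

lemma dual_space_eqI:
  assumes "finite X" and "f \<in> carrier (dual_space (mat_sum X r c))" "h \<in> carrier (dual_space (mat_sum X r c))"
    and "\<And>x k l. x \<in> X \<Longrightarrow> k < r x \<Longrightarrow> l < c x \<Longrightarrow> f (unit_family X r c x k l) = h (unit_family X r c x k l)"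
  shows "f = h"
proof (rule extensionalityI)
  show "f \<in> extensional (carrier (mat_sum X r c))" "h \<in> extensional (carrier (mat_sum X r c))"
    using assms by (simp_all add: dual_space_simps)
  fix B assume B: "B \<in> carrier (mat_sum X r c)"
  show "f B = h B"
    using assms(4) by (simp add: dual_space_expand[OF assms(1,2) B] dual_space_expand[OF assms(1,3) B])
qed

lemma dual_space_gl_sum: "dual_space (gl_sum G d) = dual_space (mat_sum (verts G) d d)"
  by (simp add: dual_space_def gl_sum_def module.defs lie_record.defs mat_sum_def)

lemma carrier_gl_sum: "carrier (gl_sum G d) = carrier (mat_sum (verts G) d d)"
  by (simp add: gl_sum_def module.defs lie_record.defs mat_sum_def)

lemma gl_sum_dual_simps:
  "carrier (gl_sum_dual G d) = carrier (dual_space (mat_sum (verts G) d d))"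
  "\<zero>\<^bsub>gl_sum_dual G d\<^esub> = \<zero>\<^bsub>dual_space (mat_sum (verts G) d d)\<^esub>"
  "f \<oplus>\<^bsub>gl_sum_dual G d\<^esub> h = f \<oplus>\<^bsub>dual_space (mat_sum (verts G) d d)\<^esub> h"
  "a \<odot>\<^bsub>gl_sum_dual G d\<^esub> f = a \<odot>\<^bsub>dual_space (mat_sum (verts G) d d)\<^esub> f"
  by (simp_all add: gl_sum_dual_def module.defs lie_record.defs dual_space_gl_sum)

text \<open>
  Since \<open>Tr (E\<^bsub>lk\<^esub> Y) = Y\<^bsub>kl\<^esub>\<close>, the matrix dual to \<open>\<Lambda>\<close> has the value of \<open>\<Lambda>\<close> on the
  elementary matrix \<open>E\<^bsub>kl\<^esub>\<close> at the transposed position \<open>(l, k)\<close>.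
\<close>

definition dual_entry ::
    "('v, 'e) pre_digraph \<Rightarrow> ('v \<Rightarrow> nat) \<Rightarrow> (('v \<Rightarrow> complex mat) \<Rightarrow> complex) \<Rightarrow> 'v \<Rightarrow> nat \<Rightarrow> nat \<Rightarrow> complex" where
  "dual_entry G d \<Lambda> i l k = \<Lambda> (unit_family (verts G) d d i k l)"

definition mult_entries :: "nat \<Rightarrow> (nat \<Rightarrow> nat \<Rightarrow> complex) \<Rightarrow> (nat \<Rightarrow> nat \<Rightarrow> complex) \<Rightarrow> nat \<Rightarrow> nat \<Rightarrow> complex" where
  "mult_entries n x y l k = (\<Sum>m<n. x l m * y m k)"

lemma mult_entries_assoc:
  "mult_entries n (mult_entries n x y) z = mult_entries n x (mult_entries n y z)"
proof (intro ext)
  fix l k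
  show "mult_entries n (mult_entries n x y) z l k = mult_entries n x (mult_entries n y z) l k"
    unfolding mult_entries_def sum_distrib_left sum_distrib_right
    by (subst sum.swap) (simp add: mult.assoc)
qed

lemma mult_entries_cong:
  "(\<And>m. m < n \<Longrightarrow> x l m = x' l m) \<Longrightarrow> (\<And>m. m < n \<Longrightarrow> y m k = y' m k) \<Longrightarrow>
    mult_entries n x y l k = mult_entries n x' y' l k"
  by (simp add: mult_entries_def)

locale finite_gl_sum =
  fixes G :: "('v, 'e) pre_digraph" and d :: "'v \<Rightarrow> nat"
  assumes finite_verts: "finite (verts G)"
begin

lemma trace_duality_apply:
  assumes "X \<in> carrier (gl_sum G d)" "Y \<in> carrier (gl_sum G d)"
  shows "trace_duality G d X Y = (\<Sum>i\<in>verts G. \<Sum>k<d i. \<Sum>l<d i. X i $$ (l, k) * Y i $$ (k, l))"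
proof -
  have c: "X i \<in> carrier_mat (d i) (d i)" "Y i \<in> carrier_mat (d i) (d i)" if "i \<in> verts G" for i
    using assms that by (auto simp: carrier_gl_sum mat_sum_simps)
  have "(X i * Y i) $$ (k, k) = (\<Sum>l<d i. X i $$ (k, l) * Y i $$ (l, k))" if "i \<in> verts G" "k < d i" for i k
    using c[OF that(1)] that(2) by (simp add: scalar_prod_def lessThan_atLeast0)
  then have "trace_duality G d X Y = (\<Sum>i\<in>verts G. \<Sum>k<d i. \<Sum>l<d i. X i $$ (k, l) * Y i $$ (l, k))"
    using assms by (simp add: trace_duality_def)
  also have "\<dots> = (\<Sum>i\<in>verts G. \<Sum>k<d i. \<Sum>l<d i. X i $$ (l, k) * Y i $$ (k, l))"
    by (intro sum.cong refl sum.swap)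
  finally show ?thesis .
qed

lemma trace_duality_dual:
  assumes "X \<in> carrier (gl_sum G d)"
  shows "trace_duality G d X \<in> carrier (gl_sum_dual G d)"
proof -
  have "trace_duality G d X (B \<oplus>\<^bsub>mat_sum (verts G) d d\<^esub> C) = trace_duality G d X B + trace_duality G d X C"
    if "B \<in> carrier (mat_sum (verts G) d d)" "C \<in> carrier (mat_sum (verts G) d d)" for B C
  proof -
    have "B i \<in> carrier_mat (d i) (d i)" "C i \<in> carrier_mat (d i) (d i)" if "i \<in> verts G" for i
      using \<open>B \<in> _\<close> \<open>C \<in> _\<close> that by (auto simp: mat_sum_simps)
    then have "(B i + C i) $$ (k, l) = B i $$ (k, l) + C i $$ (k, l)" if "i \<in> verts G" "k < d i" "l < d i" for i k l
      using that by (metis carrier_matD index_add_mat(1))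
    then show ?thesis
      using assms that mat_sum_closed(1)[OF that]
      by (simp add: trace_duality_apply carrier_gl_sum mat_sum_simps(2) distrib_left sum.distrib)
  qed
  moreover have "trace_duality G d X (a \<odot>\<^bsub>mat_sum (verts G) d d\<^esub> B) = a * trace_duality G d X B"
    if "B \<in> carrier (mat_sum (verts G) d d)" for a B
  proof -
    have "B i \<in> carrier_mat (d i) (d i)" if "i \<in> verts G" for i
      using \<open>B \<in> _\<close> that by (auto simp: mat_sum_simps)
    then have "(a \<cdot>\<^sub>m B i) $$ (k, l) = a * B i $$ (k, l)" if "i \<in> verts G" "k < d i" "l < d i" for i k l
      using that by (metis carrier_matD index_smult_mat(1))
    then show ?thesis
      using assms that mat_sum_closed(2)[OF that]
      by (simp add: trace_duality_apply carrier_gl_sum mat_sum_simps(3) sum_distrib_left mult.left_commute)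
  qed
  moreover have "trace_duality G d X \<in> extensional (carrier (mat_sum (verts G) d d))"
    by (simp add: trace_duality_def carrier_gl_sum)
  ultimately show ?thesis
    by (simp add: gl_sum_dual_simps dual_space_simps)
qed

lemma dual_entry_trace_duality:
  assumes "X \<in> carrier (gl_sum G d)" and i: "i \<in> verts G" and "l < d i" "k < d i"
  shows "dual_entry G d (trace_duality G d X) i l k = X i $$ (l, k)"
proof -
  have "dual_entry G d (trace_duality G d X) i l k =
      (\<Sum>j\<in>verts G. \<Sum>p<d j. \<Sum>q<d j. X j $$ (q, p) * (if j = i \<and> p = k \<and> q = l then 1 else 0))"
    unfolding dual_entry_def
    using assms by (simp add: trace_duality_apply carrier_gl_sum unit_family_entry)
  also have "\<dots> = X i $$ (l, k)"
    using assms finite_verts by (simp add: delta_simps)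
  finally show ?thesis .
qed

lemma gl_sum_dual_eqI:
  assumes "f \<in> carrier (gl_sum_dual G d)" "h \<in> carrier (gl_sum_dual G d)"
    and "\<And>i l k. i \<in> verts G \<Longrightarrow> l < d i \<Longrightarrow> k < d i \<Longrightarrow> dual_entry G d f i l k = dual_entry G d h i l k"
  shows "f = h"
  using assms finite_verts
  by (intro dual_space_eqI[of "verts G" f d d h]) (auto simp: gl_sum_dual_simps dual_entry_def)

definition dual_mat :: "(('v \<Rightarrow> complex mat) \<Rightarrow> complex) \<Rightarrow> ('v \<Rightarrow> complex mat)" where
  "dual_mat \<Lambda> = (\<lambda>i\<in>verts G. mat (d i) (d i) (\<lambda>(l, k). dual_entry G d \<Lambda> i l k))"

lemma dual_mat_closed: "dual_mat \<Lambda> \<in> carrier (gl_sum G d)"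
  by (auto simp: dual_mat_def carrier_gl_sum mat_sum_simps)

lemma trace_duality_dual_mat:
  "\<Lambda> \<in> carrier (gl_sum_dual G d) \<Longrightarrow> trace_duality G d (dual_mat \<Lambda>) = \<Lambda>"
  by (rule gl_sum_dual_eqI)
    (simp_all add: trace_duality_dual dual_mat_closed dual_entry_trace_duality, simp add: dual_mat_def)

lemma inj_on_trace_duality: "inj_on (trace_duality G d) (carrier (gl_sum G d))"
proof (rule inj_onI)
  fix X Y assume X: "X \<in> carrier (gl_sum G d)" and Y: "Y \<in> carrier (gl_sum G d)"
    and eq: "trace_duality G d X = trace_duality G d Y"
  show "X = Y"
  proof (rule extensionalityI)
    show "X \<in> extensional (verts G)" "Y \<in> extensional (verts G)"
      using X Y by (auto simp: carrier_gl_sum mat_sum_simps PiE_iff)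
    fix i assume i: "i \<in> verts G"
    then have "X i \<in> carrier_mat (d i) (d i)" "Y i \<in> carrier_mat (d i) (d i)"
      using X Y by (auto simp: carrier_gl_sum mat_sum_simps)
    then show "X i = Y i"
      using dual_entry_trace_duality[OF X i] dual_entry_trace_duality[OF Y i] eq
      by (intro eq_matI) auto
  qed
qed

lemma inv_trace_duality: "\<Lambda> \<in> carrier (gl_sum_dual G d) \<Longrightarrow> inv_trace_duality G d \<Lambda> = dual_mat \<Lambda>"
  unfolding inv_trace_duality_def
  by (rule inv_into_f_eq[OF inj_on_trace_duality dual_mat_closed]) (rule trace_duality_dual_mat)

lemma gl_bracket_closed:
  assumes "X \<in> carrier (gl_sum G d)" "Y \<in> carrier (gl_sum G d)"
  shows "lie_bracket (gl_sum G d) X Y \<in> carrier (gl_sum G d)"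
proof -
  have "X i \<in> carrier_mat (d i) (d i)" "Y i \<in> carrier_mat (d i) (d i)" if "i \<in> verts G" for i
    using assms that by (auto simp: carrier_gl_sum mat_sum_simps)
  then have "X i * Y i - Y i * X i \<in> carrier_mat (d i) (d i)" if "i \<in> verts G" for i
    using that by (metis minus_carrier_mat mult_carrier_mat)
  moreover have "lie_bracket (gl_sum G d) X Y = (\<lambda>i\<in>verts G. X i * Y i - Y i * X i)"
    by (simp add: gl_sum_def module.defs lie_record.defs mat_sum_def)
  ultimately show ?thesis
    by (simp add: carrier_gl_sum mat_sum_simps)
qed

lemma dual_bracket:
  assumes "f \<in> carrier (gl_sum_dual G d)" "h \<in> carrier (gl_sum_dual G d)"
  shows "lie_bracket (gl_sum_dual G d) f h =
    trace_duality G d (lie_bracket (gl_sum G d) (dual_mat f) (dual_mat h))"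
proof -
  have "lie_bracket (gl_sum_dual G d) f h =
    trace_duality G d (lie_bracket (gl_sum G d) (inv_trace_duality G d f) (inv_trace_duality G d h))"
    by (simp add: gl_sum_dual_def module.defs lie_record.defs)
  then show ?thesis
    using assms by (simp add: inv_trace_duality)
qed

lemma dual_bracket_closed:
  assumes "f \<in> carrier (gl_sum_dual G d)" "h \<in> carrier (gl_sum_dual G d)"
  shows "lie_bracket (gl_sum_dual G d) f h \<in> carrier (gl_sum_dual G d)"
  using assms by (simp add: dual_bracket trace_duality_dual gl_bracket_closed dual_mat_closed)

lemma dual_entry_bracket:
  assumes "f \<in> carrier (gl_sum_dual G d)" "h \<in> carrier (gl_sum_dual G d)"
    and i: "i \<in> verts G" and lk: "l < d i" "k < d i"
  shows "dual_entry G d (lie_bracket (gl_sum_dual G d) f h) i l k =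
    mult_entries (d i) (dual_entry G d f i) (dual_entry G d h i) l k -
    mult_entries (d i) (dual_entry G d h i) (dual_entry G d f i) l k"
proof -
  have m: "dual_mat g i = mat (d i) (d i) (\<lambda>(l, k). dual_entry G d g i l k)" for g
    using i by (simp add: dual_mat_def)
  have "lie_bracket (gl_sum G d) (dual_mat f) (dual_mat h) i =
      dual_mat f i * dual_mat h i - dual_mat h i * dual_mat f i"
    using i by (simp add: gl_sum_def module.defs lie_record.defs mat_sum_def)
  then have "dual_entry G d (lie_bracket (gl_sum_dual G d) f h) i l k =
      (dual_mat f i * dual_mat h i - dual_mat h i * dual_mat f i) $$ (l, k)"
    using assms by (simp add: dual_bracket dual_entry_trace_duality gl_bracket_closed dual_mat_closed)
  then show ?thesis
    using lk by (simp add: m mult_entries_def scalar_prod_def lessThan_atLeast0)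
qed

lemma dual_entry_add:
  "dual_entry G d (f \<oplus>\<^bsub>gl_sum_dual G d\<^esub> h) i l k = dual_entry G d f i l k + dual_entry G d h i l k"
  by (simp add: dual_entry_def gl_sum_dual_simps dual_space_simps)

lemma dual_entry_smult:
  "dual_entry G d (a \<odot>\<^bsub>gl_sum_dual G d\<^esub> f) i l k = a * dual_entry G d f i l k"
  by (simp add: dual_entry_def gl_sum_dual_simps dual_space_simps)

lemma dual_entry_zero: "dual_entry G d \<zero>\<^bsub>gl_sum_dual G d\<^esub> i l k = 0"
  by (simp add: dual_entry_def gl_sum_dual_simps dual_space_simps)

lemma module_gl_sum_dual: "module (class_ring :: complex ring) (gl_sum_dual G d)"
proof -
  interpret V: module "class_ring :: complex ring" "dual_space (mat_sum (verts G) d d)"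
    by (intro module_dual_space mat_sum_closed)
  show ?thesis
    by (intro moduleI abelian_groupI cring_complex)
      (simp_all add: gl_sum_dual_simps V.smult_l_distr[simplified] V.smult_r_distr V.smult_assoc1[simplified] V.M.a_assoc
        V.M.a_comm V.M.a_lcomm V.M.add.l_inv_ex V.smult_closed[simplified] V.smult_one[simplified])
qed

text \<open>
  A functional is determined by its dual matrix, so the axioms need to be checked on matrix entries
  only, where the Jacobi identity reduces to the associativity of matrix multiplication.
\<close>

lemma complex_lie_algebra_gl_sum_dual: "complex_lie_algebra (gl_sum_dual G d)"
proof -
  interpret V: module "class_ring :: complex ring" "gl_sum_dual G d"
    by (rule module_gl_sum_dual)
  have sm: "a \<odot>\<^bsub>gl_sum_dual G d\<^esub> f \<in> carrier (gl_sum_dual G d)" if "f \<in> carrier (gl_sum_dual G d)" for a f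
    using V.smult_closed[of a f] that by simp
  note closed = dual_bracket_closed sm V.M.a_closed
  note entries = dual_entry_add dual_entry_smult dual_entry_zero dual_entry_bracket closed
  have jac: "dual_entry G d (lie_bracket (gl_sum_dual G d) f (lie_bracket (gl_sum_dual G d) g h)) i l k =
      mult_entries (d i) x (mult_entries (d i) y z) l k - mult_entries (d i) x (mult_entries (d i) z y) l k
      - mult_entries (d i) y (mult_entries (d i) z x) l k + mult_entries (d i) z (mult_entries (d i) y x) l k"
    if "f \<in> carrier (gl_sum_dual G d)" "g \<in> carrier (gl_sum_dual G d)" "h \<in> carrier (gl_sum_dual G d)"
      "i \<in> verts G" "l < d i" "k < d i"
      "x = dual_entry G d f i" "y = dual_entry G d g i" "z = dual_entry G d h i" for f g h i l k x y z
  proof -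
    let ?M = "mult_entries (d i)"
    let ?w = "\<lambda>p q. ?M y z p q - ?M z y p q"
    have w: "dual_entry G d (lie_bracket (gl_sum_dual G d) g h) i p q = ?w p q" if "p < d i" "q < d i" for p q
      using that \<open>g \<in> _\<close> \<open>h \<in> _\<close> \<open>i \<in> _\<close> by (simp add: dual_entry_bracket \<open>y = _\<close> \<open>z = _\<close>)
    have "dual_entry G d (lie_bracket (gl_sum_dual G d) f (lie_bracket (gl_sum_dual G d) g h)) i l k =
        ?M x ?w l k - ?M ?w x l k"
      using that by (simp add: dual_entry_bracket closed w cong: mult_entries_cong)
    also have "?M x ?w l k = ?M x (?M y z) l k - ?M x (?M z y) l k"
      by (simp add: mult_entries_def[of _ x] right_diff_distrib sum_subtractf)
    also have "?M ?w x l k = ?M (?M y z) x l k - ?M (?M z y) x l k"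
      by (simp add: mult_entries_def[of _ _ x] left_diff_distrib sum_subtractf)
    finally show ?thesis
      by (simp add: mult_entries_assoc)
  qed
  show ?thesis
  proof (intro complex_lie_algebra.intro complex_lie_algebra_axioms.intro module_gl_sum_dual)
    fix f g h assume "f \<in> carrier (gl_sum_dual G d)" "g \<in> carrier (gl_sum_dual G d)" "h \<in> carrier (gl_sum_dual G d)"
    then show "lie_bracket (gl_sum_dual G d) f (lie_bracket (gl_sum_dual G d) g h) \<oplus>\<^bsub>gl_sum_dual G d\<^esub>
        lie_bracket (gl_sum_dual G d) g (lie_bracket (gl_sum_dual G d) h f) \<oplus>\<^bsub>gl_sum_dual G d\<^esub>
        lie_bracket (gl_sum_dual G d) h (lie_bracket (gl_sum_dual G d) f g) = \<zero>\<^bsub>gl_sum_dual G d\<^esub>"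
      by (intro gl_sum_dual_eqI)
        (simp_all add: closed dual_entry_add dual_entry_zero jac[OF _ _ _ _ _ _ refl refl refl])
  qed (simp_all add: closed, (rule gl_sum_dual_eqI; simp add: entries mult_entries_def algebra_simps sum.distrib sum_distrib_left)+)
qed

end


section \<open>Commutators of polynomials\<close>

definition commutator :: "'a :: ring \<Rightarrow> 'a \<Rightarrow> 'a" where
  "commutator p q = p * q - q * p"

lemma commutator_add_left: "commutator (p + p') q = commutator p q + commutator p' q"
  by (simp add: commutator_def algebra_simps)

lemma commutator_add_right: "commutator q (p + p') = commutator q p + commutator q p'"
  by (simp add: commutator_def algebra_simps)

lemma commutator_sum_left: "commutator (sum f X) q = (\<Sum>x\<in>X. commutator (f x) q)"
  by (simp add: commutator_def sum_distrib_left sum_distrib_right sum_subtractf)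

lemma commutator_sum_right: "commutator q (sum f X) = (\<Sum>x\<in>X. commutator q (f x))"
  by (simp add: commutator_def sum_distrib_left sum_distrib_right sum_subtractf)

lemma commutator_scal_left: "commutator (scal a * p) q = scal a * commutator p q"
  by (simp add: commutator_def right_diff_distrib mult.assoc scal_left_commute)

lemma commutator_scal_right: "commutator p (scal a * q) = scal a * commutator p q"
  by (simp add: commutator_def right_diff_distrib mult.assoc scal_left_commute)

lemma commutator_mult_left: "commutator (p * q) r = p * commutator q r + commutator p r * q"
  by (simp add: commutator_def algebra_simps)

lemma commutator_mult_right: "commutator r (p * q) = commutator r p * q + p * commutator r q"
  by (simp add: commutator_def algebra_simps)

lemma commutator_jacobi:
  "commutator (commutator a b) p = commutator a (commutator b p) - commutator b (commutator a p)"
  by (simp add: commutator_def algebra_simps)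

lemma commutator_scal [simp]: "commutator p (scal c) = 0"
  by (simp add: commutator_def scal_central)

context quotient_of_free
begin

lemma commutator_closed [simp, intro]: "p \<in> polys S \<Longrightarrow> q \<in> polys S \<Longrightarrow> commutator p q \<in> polys S"
  by (simp add: commutator_def)

lemma eqmod_commutator_right: "r \<in> polys S \<Longrightarrow> p \<doteq> q \<Longrightarrow> commutator r p \<doteq> commutator r q"
  unfolding commutator_def by (intro eqmod_diff eqmod_left eqmod_right)

lemma commutator_sum_left_scal:
  "(\<And>x. x \<in> X \<Longrightarrow> commutator (f x) q \<doteq> scal (c x)) \<Longrightarrow> commutator (sum f X) q \<doteq> scal (\<Sum>x\<in>X. c x)"
  unfolding commutator_sum_left scal_sum by (rule eqmod_sum)

lemma commutator_sum_right_scal: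
  "(\<And>x. x \<in> X \<Longrightarrow> commutator q (f x) \<doteq> scal (c x)) \<Longrightarrow> commutator q (sum f X) \<doteq> scal (\<Sum>x\<in>X. c x)"
  unfolding commutator_sum_right scal_sum by (rule eqmod_sum)

lemma commutator_scal_left_scal:
  "commutator p q \<doteq> scal c \<Longrightarrow> commutator (scal a * p) q \<doteq> scal (a * c)"
  unfolding commutator_scal_left scal_mult by (rule eqmod_scal)

lemma commutator_scal_right_scal:
  "commutator p q \<doteq> scal c \<Longrightarrow> commutator p (scal a * q) \<doteq> scal (a * c)"
  unfolding commutator_scal_right scal_mult by (rule eqmod_scal)

text \<open>
  If both factors have scalar commutators with \<open>w\<close>, the two orderings \<open>u v\<close> and \<open>v u\<close> contribute
  equally; this factor \<open>2\<close> cancels the \<open>1/2\<close> in front of the moment map.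
\<close>

lemma commutator_symmetrised:
  assumes "u \<in> polys S" "v \<in> polys S" and u: "commutator u w \<doteq> scal a" and v: "commutator v w \<doteq> scal b"
  shows "commutator (u * v + v * u) w \<doteq> scal (2 * b) * u + scal (2 * a) * v"
proof -
  have "commutator (u * v + v * u) w =
      (u * commutator v w + commutator u w * v) + (v * commutator u w + commutator v w * u)"
    by (simp add: commutator_add_left commutator_mult_left)
  also have "\<dots> \<doteq> (u * scal b + scal a * v) + (v * scal a + scal b * u)"
    using assms by (intro eqmod_add eqmod_left eqmod_right)
  also have "\<dots> = scal (2 * b) * u + scal (2 * a) * v"
    by (simp only: scal_central[of u] scal_central[of v] mult_2 scal_add distrib_right add_ac)
  finally show ?thesis .
qed

end

text \<open>
  The entry \<open>(k, l)\<close> of \<open>(a s - h a) b + a (b h - s b) = a b h - h a b\<close>: the action \<open>s\<close> at the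
  intermediate vertex cancels in the product.  The entries of \<open>a\<close> and \<open>b\<close> do not commute, hence the
  second version with all products reversed, in which \<open>s\<close> cancels as well.
\<close>

lemma matrix_commutator_sum:
  fixes a b :: "nat \<Rightarrow> nat \<Rightarrow> ('w list \<Rightarrow>\<^sub>0 complex)"
  shows "(\<Sum>m<N. ((\<Sum>n<N. scal (s n m) * a k n) - (\<Sum>n<H. scal (h k n) * a n m)) * b m l +
      a k m * ((\<Sum>n<H. scal (h n l) * b m n) - (\<Sum>n<N. scal (s m n) * b n l))) =
    (\<Sum>n<H. scal (h n l) * (\<Sum>m<N. a k m * b m n)) - (\<Sum>n<H. scal (h k n) * (\<Sum>m<N. a n m * b m l))"
proof -
  have "(\<Sum>m<N. \<Sum>n<N. scal (s n m) * (a k n * b m l)) = (\<Sum>m<N. \<Sum>n<N. scal (s m n) * (a k m * b n l))"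
    by (rule sum.swap)
  moreover have "(\<Sum>m<N. \<Sum>n<H. scal (h n l) * (a k m * b m n)) = (\<Sum>n<H. \<Sum>m<N. scal (h n l) * (a k m * b m n))"
    "(\<Sum>m<N. \<Sum>n<H. scal (h k n) * (a n m * b m l)) = (\<Sum>n<H. \<Sum>m<N. scal (h k n) * (a n m * b m l))"
    by (rule sum.swap)+
  ultimately show ?thesis
    by (simp add: left_diff_distrib right_diff_distrib sum_distrib_left sum_distrib_right sum_subtractf
        sum.distrib mult.assoc scal_left_commute)
qed

lemma matrix_commutator_sum_opposite:
  fixes a b :: "nat \<Rightarrow> nat \<Rightarrow> ('w list \<Rightarrow>\<^sub>0 complex)"
  shows "(\<Sum>m<N. ((\<Sum>n<H. scal (h n l) * b m n) - (\<Sum>n<N. scal (s m n) * b n l)) * a k m +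
      b m l * ((\<Sum>n<N. scal (s n m) * a k n) - (\<Sum>n<H. scal (h k n) * a n m))) =
    (\<Sum>n<H. scal (h n l) * (\<Sum>m<N. b m n * a k m)) - (\<Sum>n<H. scal (h k n) * (\<Sum>m<N. b m l * a n m))"
proof -
  have "(\<Sum>m<N. \<Sum>n<N. scal (s m n) * (b n l * a k m)) = (\<Sum>m<N. \<Sum>n<N. scal (s n m) * (b m l * a k n))"
    by (rule sum.swap)
  moreover have "(\<Sum>m<N. \<Sum>n<H. scal (h n l) * (b m n * a k m)) = (\<Sum>n<H. \<Sum>m<N. scal (h n l) * (b m n * a k m))"
    "(\<Sum>m<N. \<Sum>n<H. scal (h k n) * (b m l * a n m)) = (\<Sum>n<H. \<Sum>m<N. scal (h k n) * (b m l * a n m))"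
    by (rule sum.swap)+
  ultimately show ?thesis
    by (simp add: left_diff_distrib right_diff_distrib sum_distrib_left sum_distrib_right sum_subtractf
        sum.distrib mult.assoc scal_left_commute)
qed


section \<open>The Weyl algebra of a quiver and its quadratic elements\<close>

locale weyl_quiver = graph G + bidirected_digraph G arev
  for G :: "('v, 'e) pre_digraph" and arev :: "'e \<Rightarrow> 'e" +
  fixes d :: "'v \<Rightarrow> nat" and \<epsilon> :: "'e \<Rightarrow> complex"
  assumes eps_nonzero: "\<And>\<alpha>. \<alpha> \<in> arcs G \<Longrightarrow> \<epsilon> \<alpha> \<noteq> 0"
    and eps_antisym: "\<And>\<alpha>. \<alpha> \<in> arcs G \<Longrightarrow> \<epsilon> \<alpha> + \<epsilon> (arev \<alpha>) = 0"
begin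

sublocale finite_gl_sum G d
  by unfold_locales simp

abbreviation W where "W \<equiv> dual_space (rep_space G d)"
abbreviation pb where "pb \<equiv> poisson G arev d \<epsilon>"
abbreviation relations where "relations \<equiv> tensor_relations W (\<lambda>f h. scal (pb f h))"

lemma rep_space_add [simp]:
  "B \<in> carrier (rep_space G d) \<Longrightarrow> C \<in> carrier (rep_space G d) \<Longrightarrow> B \<oplus>\<^bsub>rep_space G d\<^esub> C \<in> carrier (rep_space G d)"
  by (simp add: rep_space_def mat_sum_closed)

lemma rep_space_smult [simp]:
  "B \<in> carrier (rep_space G d) \<Longrightarrow> a \<odot>\<^bsub>rep_space G d\<^esub> B \<in> carrier (rep_space G d)"
  by (simp add: rep_space_def mat_sum_closed)

lemma rep_unit_closed [simp]: "rep_unit G d \<alpha> k l \<in> carrier (rep_space G d)"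
  by (simp add: rep_unit_def rep_space_def)

sublocale W: module "class_ring :: complex ring" W
  by (intro module_dual_space) simp_all

lemma W_smult_closed [simp]: "f \<in> carrier W \<Longrightarrow> a \<odot>\<^bsub>W\<^esub> f \<in> carrier W"
  using W.smult_closed[of a f] by simp

lemma relations_polys: "relations \<subseteq> polys (carrier W)"
  by (auto simp: tensor_relations_def)

sublocale quotient_of_free "carrier W" "tensor_ideal W (\<lambda>f h. scal (pb f h))"
  unfolding tensor_ideal_def by (rule quotient_of_free_genideal[OF relations_polys])

abbreviation weyl_eqmod (infix \<open>\<doteq>\<close> 50) where "p \<doteq> q \<equiv> eqmod p q"

lemma weyl_algebra_eq: "weyl_algebra G arev d \<epsilon> = Q"
  by (simp add: weyl_algebra_def tensor_quotient_def)

lemma hat_eq: "hat G arev d \<epsilon> f = cls (letter f)"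
  by (simp add: hat_def tensor_class_def cls_def)

lemma relations_eqmod:
  assumes "r \<in> relations"
  shows "r \<doteq> 0"
proof -
  have "r \<in> tensor_ideal W (\<lambda>f h. scal (pb f h))"
    using ring.genideal_self[OF ring_free_algebra relations_polys] assms
    unfolding tensor_ideal_def by blast
  then show ?thesis
    by (simp add: eqmod_def)
qed

lemma letter_add:
  assumes "f \<in> carrier W" "h \<in> carrier W"
  shows "letter (f \<oplus>\<^bsub>W\<^esub> h) \<doteq> letter f + letter h"
proof -
  have "letter (f \<oplus>\<^bsub>W\<^esub> h) - letter f - letter h \<in> relations"
    using assms unfolding tensor_relations_def by blast
  from relations_eqmod[OF this] show ?thesis
    by (simp add: eqmod_def diff_diff_eq)
qed

lemma letter_smult:
  assumes "f \<in> carrier W"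
  shows "letter (a \<odot>\<^bsub>W\<^esub> f) \<doteq> scal a * letter f"
proof -
  have "letter (a \<odot>\<^bsub>W\<^esub> f) - scal a * letter f \<in> relations"
    using assms unfolding tensor_relations_def by blast
  from relations_eqmod[OF this] show ?thesis
    by (simp add: eqmod_def)
qed

lemma letter_commutator:
  assumes "f \<in> carrier W" "h \<in> carrier W"
  shows "commutator (letter f) (letter h) \<doteq> scal (pb f h)"
proof -
  have "letter f * letter h - letter h * letter f - scal (pb f h) \<in> relations"
    using assms unfolding tensor_relations_def by blast
  from relations_eqmod[OF this] show ?thesis
    by (simp add: eqmod_def commutator_def)
qed

lemma letter_sum:
  assumes "finite Y" and "\<And>y. y \<in> Y \<Longrightarrow> g y \<in> carrier W"
  shows "(\<lambda>B\<in>carrier (rep_space G d). \<Sum>y\<in>Y. a y * g y B) \<in> carrier W \<and>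
    letter (\<lambda>B\<in>carrier (rep_space G d). \<Sum>y\<in>Y. a y * g y B) \<doteq> (\<Sum>y\<in>Y. scal (a y) * letter (g y))"
  using assms
proof (induction Y)
  case empty
  have z: "(\<lambda>B\<in>carrier (rep_space G d). 0) \<in> carrier W"
    by (simp add: dual_space_simps)
  have "0 \<odot>\<^bsub>W\<^esub> (\<lambda>B\<in>carrier (rep_space G d). 0) = (\<lambda>B\<in>carrier (rep_space G d). 0)"
    by (auto simp: dual_space_simps)
  then show ?case
    using z letter_smult[OF z, of 0] by (simp only: sum.empty scal_0 mult_zero_left simp_thms)
next
  case (insert y Y)
  let ?F = "\<lambda>B\<in>carrier (rep_space G d). \<Sum>y\<in>Y. a y * g y B"
  have "?F \<in> carrier W \<and> letter ?F \<doteq> (\<Sum>y\<in>Y. scal (a y) * letter (g y))"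
    using insert.IH insert.prems by blast
  then have F: "?F \<in> carrier W" "letter ?F \<doteq> (\<Sum>y\<in>Y. scal (a y) * letter (g y))"
    by (rule conjunct1, rule conjunct2)
  have y: "g y \<in> carrier W"
    using insert.prems by blast
  have eq: "(\<lambda>B\<in>carrier (rep_space G d). \<Sum>y\<in>insert y Y. a y * g y B) = (a y \<odot>\<^bsub>W\<^esub> g y) \<oplus>\<^bsub>W\<^esub> ?F"
    using insert.hyps by (auto simp: dual_space_simps)
  have "letter ((a y \<odot>\<^bsub>W\<^esub> g y) \<oplus>\<^bsub>W\<^esub> ?F) \<doteq> letter (a y \<odot>\<^bsub>W\<^esub> g y) + letter ?F"
    using F y by (intro letter_add) simp_all
  also have "\<dots> \<doteq> scal (a y) * letter (g y) + (\<Sum>y\<in>Y. scal (a y) * letter (g y))"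
    using F y by (intro eqmod_add letter_smult)
  finally show ?case
    unfolding eq using insert.hyps F(1) y by (simp only: sum.insert W.M.a_closed W_smult_closed simp_thms)
qed

definition entry_letter :: "'e \<Rightarrow> nat \<Rightarrow> nat \<Rightarrow> ((('e \<Rightarrow> complex mat) \<Rightarrow> complex) list \<Rightarrow>\<^sub>0 complex)" where
  "entry_letter \<alpha> k l = letter (entry_functional (arcs G) (d \<circ> head G) (d \<circ> tail G) \<alpha> k l)"

lemma B_hat_eq: "B_hat G arev d \<epsilon> \<alpha> k l = cls (entry_letter \<alpha> k l)"
  by (simp add: B_hat_def entry_letter_def hat_eq)

lemma entry_closed:
  assumes "\<alpha> \<in> arcs G" "k < d (head G \<alpha>)" "l < d (tail G \<alpha>)"
  shows "entry_functional (arcs G) (d \<circ> head G) (d \<circ> tail G) \<alpha> k l \<in> carrier W"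
proof -
  have c: "B \<alpha> \<in> carrier_mat (d (head G \<alpha>)) (d (tail G \<alpha>))" if "B \<in> carrier (rep_space G d)" for B
    using that assms by (auto simp: rep_space_def mat_sum_simps)
  have "(B \<alpha> + C \<alpha>) $$ (k, l) = B \<alpha> $$ (k, l) + C \<alpha> $$ (k, l)"
    if "C \<in> carrier (rep_space G d)" for B C
    using c[OF that] assms by (metis carrier_matD index_add_mat(1))
  moreover have "(a \<cdot>\<^sub>m B \<alpha>) $$ (k, l) = a * B \<alpha> $$ (k, l)"
    if "B \<in> carrier (rep_space G d)" for a B
    using c[OF that] assms by (metis carrier_matD index_smult_mat(1))
  ultimately show ?thesis
    using assms rep_space_add rep_space_smult
    by (simp add: dual_space_simps entry_functional_def rep_space_def mat_sum_closed mat_sum_simps(2,3))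
qed

lemma entry_unit:
  assumes "\<alpha> \<in> arcs G" "k < d (head G \<alpha>)" "l < d (tail G \<alpha>)"
  shows "entry_functional (arcs G) (d \<circ> head G) (d \<circ> tail G) \<alpha> k l (rep_unit G d \<beta> p q) =
    (if \<beta> = \<alpha> \<and> p = k \<and> q = l then 1 else 0)"
  using assms by (auto simp: entry_functional_def rep_unit_def unit_family_entry)

lemma entry_letter_closed [simp]:
  "\<alpha> \<in> arcs G \<Longrightarrow> k < d (head G \<alpha>) \<Longrightarrow> l < d (tail G \<alpha>) \<Longrightarrow> entry_letter \<alpha> k l \<in> polys (carrier W)"
  by (simp add: entry_letter_def entry_closed)

text \<open>
  A functional is the combination of the matrix entries with its values on elementary matrices as
  coefficients; modulo the linearity relations the same holds for the corresponding letters.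
\<close>

lemma letter_expand:
  assumes f: "f \<in> carrier W"
  shows "letter f \<doteq> (\<Sum>\<alpha>\<in>arcs G. \<Sum>k<d (head G \<alpha>). \<Sum>l<d (tail G \<alpha>).
    scal (f (rep_unit G d \<alpha> k l)) * entry_letter \<alpha> k l)"
proof -
  define T where "T = (SIGMA \<alpha>:arcs G. {..<d (head G \<alpha>)} \<times> {..<d (tail G \<alpha>)})"
  define a where "a = (\<lambda>(\<alpha>, k, l). f (rep_unit G d \<alpha> k l))"
  define g where "g = (\<lambda>(\<alpha>, k, l). entry_functional (arcs G) (d \<circ> head G) (d \<circ> tail G) \<alpha> k l)"
  have nested: "(\<Sum>\<alpha>\<in>arcs G. \<Sum>k<d (head G \<alpha>). \<Sum>l<d (tail G \<alpha>). F (\<alpha>, k, l)) = sum F T"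
    for F :: "_ \<Rightarrow> 'c :: comm_monoid_add"
    unfolding T_def by (simp add: sum.Sigma sum.cartesian_product)
  have "f = (\<lambda>B\<in>carrier (rep_space G d). \<Sum>y\<in>T. a y * g y B)"
  proof (rule extensionalityI)
    show "f \<in> extensional (carrier (rep_space G d))"
      using f by (simp add: dual_space_simps)
    fix B assume B: "B \<in> carrier (rep_space G d)"
    have "f B = (\<Sum>\<alpha>\<in>arcs G. \<Sum>k<d (head G \<alpha>). \<Sum>l<d (tail G \<alpha>). f (rep_unit G d \<alpha> k l) * B \<alpha> $$ (k, l))"
      using dual_space_expand[of "arcs G" f "d \<circ> head G" "d \<circ> tail G" B] f B
      by (simp add: rep_space_def rep_unit_def)
    also have "\<dots> = (\<Sum>\<alpha>\<in>arcs G. \<Sum>k<d (head G \<alpha>). \<Sum>l<d (tail G \<alpha>). a (\<alpha>, k, l) * g (\<alpha>, k, l) B)"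
      using B by (simp add: a_def g_def entry_functional_def rep_space_def)
    also have "\<dots> = (\<Sum>y\<in>T. a y * g y B)"
      by (rule nested)
    finally show "f B = (\<lambda>B\<in>carrier (rep_space G d). \<Sum>y\<in>T. a y * g y B) B"
      using B by simp
  qed simp
  moreover have "letter (\<lambda>B\<in>carrier (rep_space G d). \<Sum>y\<in>T. a y * g y B) \<doteq> (\<Sum>y\<in>T. scal (a y) * letter (g y))"
    using letter_sum[of T g a] by (auto simp: T_def g_def entry_closed)
  ultimately have "letter f \<doteq> (\<Sum>y\<in>T. scal (a y) * letter (g y))"
    by simp
  then show ?thesis
    by (simp add: a_def g_def entry_letter_def flip: nested)
qed

lemma sum_delta_arrow:
  assumes "\<alpha> \<in> arcs G" "k < d (head G \<alpha>)" "l < d (tail G \<alpha>)"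
  shows "(\<Sum>\<beta>\<in>arcs G. \<Sum>p<d (head G \<beta>). \<Sum>q<d (tail G \<beta>).
    (if \<beta> = \<alpha> \<and> p = k \<and> q = l then 1 else 0) * F \<beta> p q) = (F \<alpha> k l :: complex)"
  using assms by (simp add: delta_simps)

lemma poisson_nested:
  "pb f h = (\<Sum>\<alpha>\<in>arcs G. \<Sum>k<d (head G \<alpha>). \<Sum>l<d (tail G \<alpha>). f (rep_unit G d \<alpha> k l) *
    (\<Sum>\<beta>\<in>arcs G. \<Sum>k'<d (head G \<beta>). \<Sum>l'<d (tail G \<beta>). h (rep_unit G d \<beta> k' l') *
      (if arev \<alpha> = \<beta> \<and> k = l' \<and> k' = l then inverse (\<epsilon> \<alpha>) else 0)))"
  unfolding poisson_def sum_distrib_left mult.assoc ..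

lemma commutator_entry_letter:
  assumes "\<alpha> \<in> arcs G" "k < d (head G \<alpha>)" "l < d (tail G \<alpha>)"
    and "\<beta> \<in> arcs G" "k' < d (head G \<beta>)" "l' < d (tail G \<beta>)"
  shows "commutator (entry_letter \<alpha> k l) (entry_letter \<beta> k' l') \<doteq>
    scal (if arev \<alpha> = \<beta> \<and> k = l' \<and> k' = l then inverse (\<epsilon> \<alpha>) else 0)"
  using letter_commutator[OF entry_closed[OF assms(1-3)] entry_closed[OF assms(4-6)]]
  unfolding poisson_nested entry_unit[OF assms(1-3)] entry_unit[OF assms(4-6)] entry_letter_def
    sum_delta_arrow[OF assms(1-3)] sum_delta_arrow[OF assms(4-6)] .


text \<open>
  The symmetrised entry \<open>(k, l)\<close> of the matrix \<open>B\<^sub>\<alpha> B\<^sub>\<alpha>\<^sub>*\<close>.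
\<close>

definition sym_product where
  "sym_product \<alpha> k l = (\<Sum>m<d (tail G \<alpha>). entry_letter \<alpha> k m * entry_letter (arev \<alpha>) m l + entry_letter (arev \<alpha>) m l * entry_letter \<alpha> k m)"

text \<open>
  With \<open>\<mu>\<^sub>i\<close> the matrix of the prescribed values at the vertex \<open>i\<close>, this represents
  \<open>\<Sum>\<^sub>i Tr (x\<^sub>i \<mu>\<^sub>i)\<close>.
\<close>

definition moment_poly where
  "moment_poly x = (\<Sum>\<alpha>\<in>arcs G. \<Sum>k<d (head G \<alpha>). \<Sum>l<d (head G \<alpha>).
    scal (\<epsilon> \<alpha> / 2 * x (head G \<alpha>) l k) * sym_product \<alpha> k l)"

text \<open>
  The entry \<open>(k, l)\<close> of \<open>B\<^sub>\<alpha> x\<^bsub>s \<alpha>\<^esub> - x\<^bsub>t \<alpha>\<^esub> B\<^sub>\<alpha>\<close>, the infinitesimal base change of a generator.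
\<close>

definition action_entry where
  "action_entry x \<alpha> k l = (\<Sum>n<d (tail G \<alpha>). scal (x (tail G \<alpha>) n l) * entry_letter \<alpha> k n) -
    (\<Sum>n<d (head G \<alpha>). scal (x (head G \<alpha>) k n) * entry_letter \<alpha> n l)"

lemma sym_product_closed [simp]:
  "\<alpha> \<in> arcs G \<Longrightarrow> k < d (head G \<alpha>) \<Longrightarrow> l < d (head G \<alpha>) \<Longrightarrow> sym_product \<alpha> k l \<in> polys (carrier W)"
  unfolding sym_product_def by (intro polys_sum polys_add polys_mult entry_letter_closed) auto

lemma moment_poly_closed [simp]: "moment_poly x \<in> polys (carrier W)"
  unfolding moment_poly_def by (intro polys_sum polys_mult polys_scal sym_product_closed) auto

lemma scal_if_zero: "scal (if P then a else 0) * p = (if P then scal a * p else 0)"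
  by simp

text \<open>
  In the sum over all arrows only two see the arrow \<open>\<beta>\<close>.  The arrow \<open>\<beta>\<close> itself pairs \<open>B\<^sub>\<beta>\<close> with
  its second factor \<open>B\<^sub>\<beta>\<^sub>*\<close>, which gives \<open>\<epsilon>\<^sub>\<beta> / \<epsilon>\<^sub>\<beta>\<^sub>* = - 1\<close> times \<open>x\<^bsub>t \<beta>\<^esub> B\<^sub>\<beta>\<close>.  The opposite arrow
  \<open>\<beta>\<^sup>*\<close>, which ends at \<open>s \<beta>\<close>, pairs it with its first factor and gives \<open>+ 1\<close> times \<open>B\<^sub>\<beta> x\<^bsub>s \<beta>\<^esub>\<close>.
\<close>

lemma commutator_moment_poly_entry_letter:
  assumes \<beta>: "\<beta> \<in> arcs G" "p < d (head G \<beta>)" "q < d (tail G \<beta>)"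
  shows "commutator (moment_poly x) (entry_letter \<beta> p q) \<doteq> action_entry x \<beta> p q"
proof -
  let ?r = "\<lambda>\<alpha> l m. if \<alpha> = \<beta> \<and> m = q \<and> p = l then inverse (\<epsilon> (arev \<alpha>)) else 0"
  let ?s = "\<lambda>\<alpha> k m. if arev \<alpha> = \<beta> \<and> k = q \<and> p = m then inverse (\<epsilon> \<alpha>) else 0"
  have "commutator (sym_product \<alpha> k l) (entry_letter \<beta> p q) \<doteq>
      (\<Sum>m<d (tail G \<alpha>). scal (2 * ?r \<alpha> l m) * entry_letter \<alpha> k m + scal (2 * ?s \<alpha> k m) * entry_letter (arev \<alpha>) m l)"
    if "\<alpha> \<in> arcs G" "k < d (head G \<alpha>)" "l < d (head G \<alpha>)" for \<alpha> k l
    unfolding sym_product_def commutator_sum_left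
  proof (intro eqmod_sum commutator_symmetrised)
    fix m assume "m \<in> {..<d (tail G \<alpha>)}"
    then show "commutator (entry_letter (arev \<alpha>) m l) (entry_letter \<beta> p q) \<doteq> scal (?r \<alpha> l m)"
      and "commutator (entry_letter \<alpha> k m) (entry_letter \<beta> p q) \<doteq> scal (?s \<alpha> k m)"
      using commutator_entry_letter[of "arev \<alpha>" m l \<beta> p q] commutator_entry_letter[of \<alpha> k m \<beta> p q] that \<beta> by simp_all
  qed (use that in auto)
  then have "commutator (moment_poly x) (entry_letter \<beta> p q) \<doteq>
      (\<Sum>\<alpha>\<in>arcs G. \<Sum>k<d (head G \<alpha>). \<Sum>l<d (head G \<alpha>). scal (\<epsilon> \<alpha> / 2 * x (head G \<alpha>) l k) *
        (\<Sum>m<d (tail G \<alpha>). scal (2 * ?r \<alpha> l m) * entry_letter \<alpha> k m + scal (2 * ?s \<alpha> k m) * entry_letter (arev \<alpha>) m l))"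
    unfolding moment_poly_def commutator_sum_left commutator_scal_left by (intro eqmod_sum eqmod_scal) auto
  also have "\<dots> =
      (\<Sum>\<alpha>\<in>arcs G. \<Sum>k<d (head G \<alpha>). \<Sum>l<d (head G \<alpha>). \<Sum>m<d (tail G \<alpha>).
        scal (if \<alpha> = \<beta> \<and> m = q \<and> p = l then \<epsilon> \<alpha> * x (head G \<alpha>) l k * inverse (\<epsilon> (arev \<alpha>)) else 0) * entry_letter \<alpha> k m) +
      (\<Sum>\<alpha>\<in>arcs G. \<Sum>k<d (head G \<alpha>). \<Sum>l<d (head G \<alpha>). \<Sum>m<d (tail G \<alpha>).
        scal (if arev \<alpha> = \<beta> \<and> k = q \<and> p = m then \<epsilon> \<alpha> * x (head G \<alpha>) l k * inverse (\<epsilon> \<alpha>) else 0) * entry_letter (arev \<alpha>) m l)"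
    by (simp only: sum_distrib_left distrib_left scal_scal_times flip: sum.distrib)
      (intro sum.cong refl arg_cong2[where f = "(+)"] arg_cong2[where f = "(*)"] arg_cong[where f = scal]; simp)
  also have "(\<Sum>\<alpha>\<in>arcs G. \<Sum>k<d (head G \<alpha>). \<Sum>l<d (head G \<alpha>). \<Sum>m<d (tail G \<alpha>).
        scal (if \<alpha> = \<beta> \<and> m = q \<and> p = l then \<epsilon> \<alpha> * x (head G \<alpha>) l k * inverse (\<epsilon> (arev \<alpha>)) else 0) * entry_letter \<alpha> k m) =
      (\<Sum>k<d (head G \<beta>). scal (\<epsilon> \<beta> * x (head G \<beta>) p k * inverse (\<epsilon> (arev \<beta>))) * entry_letter \<beta> k q)"
    using \<beta> by (simp add: scal_if_zero delta_simps)
  also have "\<dots> = - (\<Sum>n<d (head G \<beta>). scal (x (head G \<beta>) p n) * entry_letter \<beta> n q)"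
  proof -
    have "\<epsilon> (arev \<beta>) = - \<epsilon> \<beta>"
      using eps_antisym[OF \<beta>(1)] by (simp add: eq_neg_iff_add_eq_0 add.commute)
    then have "\<epsilon> \<beta> * x (head G \<beta>) p k * inverse (\<epsilon> (arev \<beta>)) = - x (head G \<beta>) p k" for k
      using eps_nonzero[OF \<beta>(1)] by (simp add: field_simps)
    then show ?thesis
      by (simp add: scal_uminus sum_negf)
  qed
  also have "(\<Sum>\<alpha>\<in>arcs G. \<Sum>k<d (head G \<alpha>). \<Sum>l<d (head G \<alpha>). \<Sum>m<d (tail G \<alpha>).
        scal (if arev \<alpha> = \<beta> \<and> k = q \<and> p = m then \<epsilon> \<alpha> * x (head G \<alpha>) l k * inverse (\<epsilon> \<alpha>) else 0) * entry_letter (arev \<alpha>) m l) =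
      (\<Sum>\<alpha>\<in>arcs G. if \<alpha> = arev \<beta> then \<Sum>n<d (head G \<alpha>). scal (\<epsilon> \<alpha> * x (head G \<alpha>) n q * inverse (\<epsilon> \<alpha>)) * entry_letter (arev \<alpha>) p n else 0)"
  proof (rule sum.cong[OF refl])
    fix \<alpha> assume \<alpha>: "\<alpha> \<in> arcs G"
    have "arev \<alpha> = \<beta> \<longleftrightarrow> \<alpha> = arev \<beta>"
      by auto
    then show "(\<Sum>k<d (head G \<alpha>). \<Sum>l<d (head G \<alpha>). \<Sum>m<d (tail G \<alpha>).
        scal (if arev \<alpha> = \<beta> \<and> k = q \<and> p = m then \<epsilon> \<alpha> * x (head G \<alpha>) l k * inverse (\<epsilon> \<alpha>) else 0) * entry_letter (arev \<alpha>) m l) =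
      (if \<alpha> = arev \<beta> then \<Sum>n<d (head G \<alpha>). scal (\<epsilon> \<alpha> * x (head G \<alpha>) n q * inverse (\<epsilon> \<alpha>)) * entry_letter (arev \<alpha>) p n else 0)"
      using \<beta> by (cases "\<alpha> = arev \<beta>") (simp_all add: scal_if_zero delta_simps)
  qed
  also have "\<dots> = (\<Sum>n<d (tail G \<beta>). scal (x (tail G \<beta>) n q) * entry_letter \<beta> p n)"
    using \<beta> eps_nonzero[of "arev \<beta>"] by (simp add: field_simps)
  finally show ?thesis
    by (simp add: action_entry_def)
qed

text \<open>
  The inner derivation sends \<open>B\<^sub>\<alpha> B\<^sub>\<alpha>\<^sub>*\<close> to its matrix commutator with \<open>x\<^bsub>t \<alpha>\<^esub>\<close>: the Leibniz rule
  and the previous lemma reduce this to the two versions of the cancellation above.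
\<close>

lemma commutator_moment_poly_sym_product:
  assumes \<alpha>: "\<alpha> \<in> arcs G" "k < d (head G \<alpha>)" "l < d (head G \<alpha>)"
  shows "commutator (moment_poly x) (sym_product \<alpha> k l) \<doteq>
    (\<Sum>n<d (head G \<alpha>). scal (x (head G \<alpha>) n l) * sym_product \<alpha> k n) -
    (\<Sum>n<d (head G \<alpha>). scal (x (head G \<alpha>) k n) * sym_product \<alpha> n l)"
proof -
  let ?a = "entry_letter \<alpha>" and ?b = "entry_letter (arev \<alpha>)"
  have expand: "commutator (moment_poly x) (sym_product \<alpha> k l) = (\<Sum>m<d (tail G \<alpha>).
      (commutator (moment_poly x) (?a k m) * ?b m l + ?a k m * commutator (moment_poly x) (?b m l)) +
      (commutator (moment_poly x) (?b m l) * ?a k m + ?b m l * commutator (moment_poly x) (?a k m)))"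
    by (simp add: sym_product_def commutator_sum_right commutator_add_right commutator_mult_right)
  have collect: "(\<Sum>m<d (tail G \<alpha>). (action_entry x \<alpha> k m * ?b m l + ?a k m * action_entry x (arev \<alpha>) m l) +
      (action_entry x (arev \<alpha>) m l * ?a k m + ?b m l * action_entry x \<alpha> k m)) =
    (\<Sum>n<d (head G \<alpha>). scal (x (head G \<alpha>) n l) * sym_product \<alpha> k n) -
    (\<Sum>n<d (head G \<alpha>). scal (x (head G \<alpha>) k n) * sym_product \<alpha> n l)"
    unfolding sum.distrib[of "\<lambda>m. action_entry x \<alpha> k m * ?b m l + ?a k m * action_entry x (arev \<alpha>) m l"]
    by (simp only: action_entry_def head_arev[OF \<alpha>(1)] tail_arev[OF \<alpha>(1)] matrix_commutator_sum
        matrix_commutator_sum_opposite, simp only: sym_product_def sum.distrib distrib_left add_diff_add)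
  show ?thesis
    unfolding expand collect[symmetric]
    using \<alpha> by (intro eqmod_sum eqmod_add eqmod_left eqmod_right commutator_moment_poly_entry_letter) auto
qed

text \<open>
  By the previous lemma the left-hand side is \<open>\<Sum>\<^sub>i Tr (y\<^sub>i (\<mu>\<^sub>i x\<^sub>i - x\<^sub>i \<mu>\<^sub>i))\<close>, which equals
  \<open>\<Sum>\<^sub>i Tr ((x\<^sub>i y\<^sub>i - y\<^sub>i x\<^sub>i) \<mu>\<^sub>i)\<close> by cyclicity of the trace.
\<close>

lemma commutator_moment_poly_moment_poly:
  "commutator (moment_poly x) (moment_poly y) \<doteq>
    moment_poly (\<lambda>i l k. mult_entries (d i) (x i) (y i) l k - mult_entries (d i) (y i) (x i) l k)"
proof -
  have "commutator (moment_poly x) (moment_poly y) \<doteq> (\<Sum>\<alpha>\<in>arcs G. \<Sum>k<d (head G \<alpha>). \<Sum>l<d (head G \<alpha>).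
      scal (\<epsilon> \<alpha> / 2 * y (head G \<alpha>) l k) * ((\<Sum>n<d (head G \<alpha>). scal (x (head G \<alpha>) n l) * sym_product \<alpha> k n) -
        (\<Sum>n<d (head G \<alpha>). scal (x (head G \<alpha>) k n) * sym_product \<alpha> n l)))"
    unfolding moment_poly_def[of y] commutator_sum_right commutator_scal_right
    by (intro eqmod_sum eqmod_scal commutator_moment_poly_sym_product) auto
  also have "\<dots> = moment_poly (\<lambda>i l k. mult_entries (d i) (x i) (y i) l k - mult_entries (d i) (y i) (x i) l k)"
    unfolding moment_poly_def
  proof (rule sum.cong[OF refl])
    fix \<alpha> assume "\<alpha> \<in> arcs G"
    let ?x = "x (head G \<alpha>)" and ?y = "y (head G \<alpha>)" and ?N = "d (head G \<alpha>)" and ?e = "\<epsilon> \<alpha> / 2"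
    have "(\<Sum>k<?N. \<Sum>l<?N. scal (?e * ?y l k) * ((\<Sum>n<?N. scal (?x n l) * sym_product \<alpha> k n) - (\<Sum>n<?N. scal (?x k n) * sym_product \<alpha> n l))) =
      (\<Sum>k<?N. \<Sum>l<?N. \<Sum>n<?N. scal (?e * ?y l k * ?x n l) * sym_product \<alpha> k n) -
      (\<Sum>k<?N. \<Sum>l<?N. \<Sum>n<?N. scal (?e * ?y l k * ?x k n) * sym_product \<alpha> n l)"
      by (simp add: right_diff_distrib sum_distrib_left sum_subtractf scal_scal_times)
    also have "(\<Sum>k<?N. \<Sum>l<?N. \<Sum>n<?N. scal (?e * ?y l k * ?x n l) * sym_product \<alpha> k n) =
        (\<Sum>k<?N. \<Sum>n<?N. \<Sum>l<?N. scal (?e * ?y l k * ?x n l) * sym_product \<alpha> k n)"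
      by (rule sum.cong[OF refl]) (rule sum.swap)
    also have "(\<Sum>k<?N. \<Sum>l<?N. \<Sum>n<?N. scal (?e * ?y l k * ?x k n) * sym_product \<alpha> n l) =
        (\<Sum>k<?N. \<Sum>n<?N. \<Sum>l<?N. scal (?e * ?y l k * ?x k n) * sym_product \<alpha> n l)"
      by (rule sum.cong[OF refl]) (rule sum.swap)
    also have "\<dots> = (\<Sum>n<?N. \<Sum>k<?N. \<Sum>l<?N. scal (?e * ?y l k * ?x k n) * sym_product \<alpha> n l)"
      by (rule sum.swap)
    also have "\<dots> = (\<Sum>n<?N. \<Sum>l<?N. \<Sum>k<?N. scal (?e * ?y l k * ?x k n) * sym_product \<alpha> n l)"
      by (rule sum.cong[OF refl]) (rule sum.swap)
    finally show "(\<Sum>k<?N. \<Sum>l<?N. scal (?e * ?y l k) * ((\<Sum>n<?N. scal (?x n l) * sym_product \<alpha> k n) - (\<Sum>n<?N. scal (?x k n) * sym_product \<alpha> n l))) =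
      (\<Sum>k<?N. \<Sum>l<?N. scal (?e * (mult_entries ?N ?x ?y l k - mult_entries ?N ?y ?x l k)) * sym_product \<alpha> k l)"
      by (simp add: mult_entries_def right_diff_distrib sum_distrib_left sum_distrib_right scal_diff scal_sum
          left_diff_distrib sum_subtractf mult_ac)
  qed
  finally show ?thesis .
qed

end


section \<open>The inverse of a matrix near the identity\<close>

lemma isCont_det:
  fixes A :: "complex \<Rightarrow> complex mat"
  assumes A: "\<And>t. A t \<in> carrier_mat n n"
    and cont: "\<And>k l. k < n \<Longrightarrow> l < n \<Longrightarrow> isCont (\<lambda>t. A t $$ (k, l)) 0"
  shows "isCont (\<lambda>t. Determinant.det (A t)) 0"
proof -
  have "(\<lambda>t. Determinant.det (A t)) =
      (\<lambda>t. \<Sum>p | p permutes {0..<n}. signof p * (\<Prod>i = 0..<n. A t $$ (i, p i)))"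
    using det_def'[OF A] by auto
  moreover have "isCont (\<lambda>t. \<Sum>p | p permutes {0..<n}. signof p * (\<Prod>i = 0..<n. A t $$ (i, p i))) 0"
    by (intro continuous_intros cont) (auto simp: permutes_in_image)
  ultimately show ?thesis by simp
qed

text \<open>
  Near \<open>0\<close> the inverse \<open>N t\<close> of \<open>1 + t X\<close> is the adjugate divided by the determinant, so it is
  continuous at \<open>0\<close>.  The equation \<open>N t = 1 - t (N t X)\<close> then yields its derivative \<open>- N 0 X = - X\<close>.
\<close>

lemma inverse_near_identity:
  fixes X :: "complex mat"
  assumes X: "X \<in> carrier_mat n n"
  shows "\<exists>N. (\<forall>t. N t \<in> carrier_mat n n) \<and>
    (\<forall>\<^sub>F t in nhds 0. N t * (1\<^sub>m n + t \<cdot>\<^sub>m X) = 1\<^sub>m n \<and> (1\<^sub>m n + t \<cdot>\<^sub>m X) * N t = 1\<^sub>m n) \<and>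
    (\<forall>k<n. \<forall>l<n. ((\<lambda>t. N t $$ (k, l)) has_field_derivative - X $$ (k, l)) (at 0))"
proof -
  define P where "P t = 1\<^sub>m n + t \<cdot>\<^sub>m X" for t
  define N where "N t = inverse (Determinant.det (P t)) \<cdot>\<^sub>m adj_mat (P t)" for t
  have P: "P t \<in> carrier_mat n n" for t
    using X by (simp add: P_def)
  have N: "N t \<in> carrier_mat n n" for t
    using adj_mat(1)[OF P] by (simp add: N_def)
  have P_entry: "P t $$ (k, l) = (if k = l then 1 else 0) + t * X $$ (k, l)" if "k < n" "l < n" for t k l
    using X that by (simp add: P_def)
  have contP: "isCont (\<lambda>t. P t $$ (k, l)) 0" if "k < n" "l < n" for k l
    unfolding P_entry[OF that] by (intro continuous_intros)
  have contdet: "isCont (\<lambda>t. Determinant.det (P t)) 0"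
    by (rule isCont_det[OF P contP])
  have P0: "P 0 = 1\<^sub>m n"
    using X by (auto simp: P_def intro!: eq_matI)
  have det0: "Determinant.det (P 0) \<noteq> 0"
    by (simp add: P0)
  have ev: "\<forall>\<^sub>F t in nhds 0. Determinant.det (P t) \<noteq> 0"
    using contdet det0 by (simp add: isCont_def tendsto_imp_eventually_ne eventually_nhds_conv_at)
  have inv: "N t * P t = 1\<^sub>m n \<and> P t * N t = 1\<^sub>m n" if "Determinant.det (P t) \<noteq> 0" for t
  proof -
    have "c \<cdot>\<^sub>m (e \<cdot>\<^sub>m 1\<^sub>m n) = (c * e) \<cdot>\<^sub>m (1\<^sub>m n :: complex mat)" for c e
      by (auto intro!: eq_matI)
    moreover have "(1 :: complex) \<cdot>\<^sub>m 1\<^sub>m n = 1\<^sub>m n"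
      by (auto intro!: eq_matI)
    ultimately show ?thesis
      using that P[of t] adj_mat[OF P[of t]]
      by (simp add: N_def mult_smult_assoc_mat[of _ n n _ n] mult_smult_distrib[of _ n n _ n])
  qed
  have evinv: "\<forall>\<^sub>F t in nhds 0. N t * P t = 1\<^sub>m n \<and> P t * N t = 1\<^sub>m n"
    using ev by eventually_elim (rule inv)
  have contN: "isCont (\<lambda>t. N t $$ (k, l)) 0" if "k < n" "l < n" for k l
  proof -
    have "isCont (\<lambda>t. Determinant.det (mat_delete (P t) l k)) 0"
    proof (rule isCont_det)
      show "mat_delete (P t) l k \<in> carrier_mat (n - 1) (n - 1)" for t
        using P by (rule mat_delete_carrier)
      fix i j assume ij: "i < n - 1" "j < n - 1"
      have "mat_delete (P t) l k $$ (i, j) = P t $$ (if i < l then i else Suc i, if j < k then j else Suc j)" for t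
        using ij carrier_matD[OF P[of t]] by (simp add: mat_delete_def)
      moreover have "isCont (\<lambda>t. P t $$ (if i < l then i else Suc i, if j < k then j else Suc j)) 0"
        using ij by (intro contP) auto
      ultimately show "isCont (\<lambda>t. mat_delete (P t) l k $$ (i, j)) 0"
        by simp
    qed
    then have "isCont (\<lambda>t. inverse (Determinant.det (P t)) *
        ((- 1) ^ (l + k) * Determinant.det (mat_delete (P t) l k))) 0"
      using contdet det0 by (intro continuous_intros) auto
    moreover have "N t $$ (k, l) = inverse (Determinant.det (P t)) *
        ((- 1) ^ (l + k) * Determinant.det (mat_delete (P t) l k))" for t
      using that carrier_matD[OF P[of t]] by (simp add: N_def adj_mat_def cofactor_def)
    ultimately show ?thesis by simp
  qed
  have N0: "N 0 = 1\<^sub>m n"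
    using inv[OF det0] P0 N[of 0] by simp
  have "((\<lambda>t. N t $$ (k, l)) has_field_derivative - X $$ (k, l)) (at 0)" if kl: "k < n" "l < n" for k l
  proof -
    define h where "h t = - (\<Sum>m<n. N t $$ (k, m) * X $$ (m, l))" for t
    have "\<forall>\<^sub>F t in nhds 0. N t $$ (k, l) = (if k = l then 1 else 0) + t * h t"
      using evinv
    proof eventually_elim
      case (elim t)
      have "(if k = l then 1 else 0) = (N t * P t) $$ (k, l)"
        using elim kl by simp
      also have "\<dots> = (\<Sum>m<n. N t $$ (k, m) * P t $$ (m, l))"
        using kl carrier_matD[OF N[of t]] carrier_matD[OF P[of t]]
        by (simp add: scalar_prod_def lessThan_atLeast0)
      also have "\<dots> = (\<Sum>m<n. (if m = l then N t $$ (k, m) else 0) + t * (N t $$ (k, m) * X $$ (m, l)))"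
        using kl by (intro sum.cong refl) (simp add: P_entry algebra_simps)
      also have "\<dots> = N t $$ (k, l) - t * h t"
        using kl by (simp add: sum.distrib h_def sum_distrib_left)
      finally show ?case
        by (simp add: algebra_simps)
    qed
    moreover have "((\<lambda>t. (if k = l then 1 else 0) + t * h t) has_field_derivative h 0) (at 0)"
      unfolding CARAT_DERIV
    proof (intro exI[of _ h] conjI allI)
      show "isCont h 0"
        unfolding h_def using contN kl by (intro continuous_intros) auto
    qed (simp_all add: mult.commute)
    moreover have "h 0 = - X $$ (k, l)"
    proof -
      have "(\<Sum>m<n. N 0 $$ (k, m) * X $$ (m, l)) = (\<Sum>m<n. if k = m then X $$ (m, l) else 0)"
        using kl by (intro sum.cong refl) (simp add: N0)
      then show ?thesis
        using kl by (simp add: h_def)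
    qed
    ultimately show ?thesis
      using DERIV_cong_ev[OF refl, of "\<lambda>t. N t $$ (k, l)" _ 0] by metis
  qed
  with N evinv show ?thesis
    by (intro exI[of _ N]) (simp add: P_def)
qed

lemma base_group_inv:
  assumes g: "\<And>i. i \<in> verts G \<Longrightarrow> g i \<in> carrier_mat (d i) (d i)" "g \<in> extensional (verts G)"
    and N: "\<And>i. i \<in> verts G \<Longrightarrow> N i \<in> carrier_mat (d i) (d i)"
    and inv: "\<And>i. i \<in> verts G \<Longrightarrow> N i * g i = 1\<^sub>m (d i) \<and> g i * N i = 1\<^sub>m (d i)"
    and i: "i \<in> verts G"
  shows "(inv\<^bsub>base_group G d\<^esub> g) i = N i"
proof -
  let ?R = "\<lambda>i. ring_mat TYPE(complex) (d i) ()"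
  have R: "Group.monoid (?R i)" for i
    using ring_mat[of "d i" "()"] by (rule ring.is_monoid)
  then have grp: "group (units_of (?R i))" for i
    by (rule monoid.units_group)
  have units: "g i \<in> carrier (units_of (?R i))" "N i \<in> carrier (units_of (?R i))" if "i \<in> verts G" for i
    using g(1)[OF that] N[OF that] inv[OF that]
    by (auto simp: units_of_carrier Units_def ring_mat_simps)
  have "inv\<^bsub>base_group G d\<^esub> g = (\<lambda>i\<in>verts G. inv\<^bsub>units_of (?R i)\<^esub> g i)"
    unfolding base_group_def
    by (rule inv_product_group) (use units g(2) grp in \<open>auto simp: PiE_iff\<close>)
  moreover have "inv\<^bsub>units_of (?R i)\<^esub> g i = N i"
    using units[OF i] inv[OF i]
    by (intro group.inv_equality grp) (simp_all add: units_of_mult units_of_one ring_mat_simps)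
  ultimately show ?thesis
    using i by simp
qed


section \<open>The quantum base change\<close>

context weyl_quiver
begin

text \<open>
  The entry \<open>(k, l)\<close> of \<open>u\<^bsub>t \<alpha>\<^esub> B\<^sub>\<alpha> w\<^bsub>s \<alpha>\<^esub>\<close>, where \<open>u\<close> will be the inverse of \<open>w\<close>.
\<close>

definition base_change_poly where
  "base_change_poly u w \<alpha> k l = (\<Sum>m<d (head G \<alpha>). \<Sum>n<d (tail G \<alpha>).
    scal (u (head G \<alpha>) k m * w (tail G \<alpha>) n l) * entry_letter \<alpha> m n)"

definition base_change_letter where
  "base_change_letter u w f = (\<Sum>\<alpha>\<in>arcs G. \<Sum>k<d (head G \<alpha>). \<Sum>l<d (tail G \<alpha>).
    scal (f (rep_unit G d \<alpha> k l)) * base_change_poly u w \<alpha> k l)"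

lemma base_change_poly_closed [simp]: "\<alpha> \<in> arcs G \<Longrightarrow> base_change_poly u w \<alpha> k l \<in> polys (carrier W)"
  unfolding base_change_poly_def by (intro polys_sum polys_mult polys_scal entry_letter_closed) auto

lemma base_change_letter_closed [simp]: "base_change_letter u w f \<in> polys (carrier W)"
  unfolding base_change_letter_def by (intro polys_sum polys_mult polys_scal base_change_poly_closed) auto

text \<open>
  Base change preserves the defining commutators: \<open>B\<^sub>\<alpha>\<close> is paired with \<open>B\<^sub>\<alpha>\<^sub>*\<close> only, and contracting
  their indices multiplies \<open>u\<close> with \<open>w\<close> at both ends of \<open>\<alpha>\<close>.
\<close>

lemma commutator_base_change_poly:
  assumes inv: "\<And>i k l. i \<in> verts G \<Longrightarrow> k < d i \<Longrightarrow> l < d i \<Longrightarrow>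
      mult_entries (d i) (u i) (w i) k l = (if k = l then 1 else 0)"
    and \<alpha>: "\<alpha> \<in> arcs G" "k < d (head G \<alpha>)" "l < d (tail G \<alpha>)"
    and \<beta>: "\<beta> \<in> arcs G" "k' < d (head G \<beta>)" "l' < d (tail G \<beta>)"
  shows "commutator (base_change_poly u w \<alpha> k l) (base_change_poly u w \<beta> k' l') \<doteq>
    scal (if arev \<alpha> = \<beta> \<and> k = l' \<and> k' = l then inverse (\<epsilon> \<alpha>) else 0)"
proof -
  let ?P = "\<lambda>m n m' n'. if arev \<alpha> = \<beta> \<and> m = n' \<and> m' = n then inverse (\<epsilon> \<alpha>) else 0"
  let ?c = "\<Sum>m<d (head G \<alpha>). \<Sum>n<d (tail G \<alpha>). u (head G \<alpha>) k m * w (tail G \<alpha>) n l *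
      (\<Sum>m'<d (head G \<beta>). \<Sum>n'<d (tail G \<beta>). u (head G \<beta>) k' m' * w (tail G \<beta>) n' l' * ?P m n m' n')"
  have "commutator (base_change_poly u w \<alpha> k l) (base_change_poly u w \<beta> k' l') \<doteq> scal ?c"
    unfolding base_change_poly_def
    by (rule commutator_sum_left_scal commutator_scal_left_scal)+
      ((rule commutator_sum_right_scal commutator_scal_right_scal)+, rule commutator_entry_letter, use \<alpha> \<beta> in auto)
  moreover have "?c = (if arev \<alpha> = \<beta> \<and> k = l' \<and> k' = l then inverse (\<epsilon> \<alpha>) else 0)"
  proof (cases "arev \<alpha> = \<beta>")
    case True
    then have ends: "head G \<beta> = tail G \<alpha>" "tail G \<beta> = head G \<alpha>"
      using \<alpha> by auto
    have "?c = (\<Sum>m<d (head G \<alpha>). \<Sum>n<d (tail G \<alpha>). inverse (\<epsilon> \<alpha>) *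
        (u (head G \<alpha>) k m * w (head G \<alpha>) m l') * (u (tail G \<alpha>) k' n * w (tail G \<alpha>) n l))"
      using True by (simp add: ends delta_simps mult_ac)
    also have "\<dots> = inverse (\<epsilon> \<alpha>) * mult_entries (d (head G \<alpha>)) (u (head G \<alpha>)) (w (head G \<alpha>)) k l' *
        mult_entries (d (tail G \<alpha>)) (u (tail G \<alpha>)) (w (tail G \<alpha>)) k' l"
      by (simp add: mult_entries_def sum_distrib_left sum_distrib_right mult_ac)
    also have "\<dots> = (if arev \<alpha> = \<beta> \<and> k = l' \<and> k' = l then inverse (\<epsilon> \<alpha>) else 0)"
      using \<alpha> \<beta> True ends by (simp add: inv)
    finally show ?thesis .
  qed simp
  ultimately show ?thesis by simp
qed

lemma commutator_base_change_letter:
  assumes inv: "\<And>i k l. i \<in> verts G \<Longrightarrow> k < d i \<Longrightarrow> l < d i \<Longrightarrow>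
      mult_entries (d i) (u i) (w i) k l = (if k = l then 1 else 0)"
  shows "commutator (base_change_letter u w f) (base_change_letter u w h) \<doteq> scal (pb f h)"
  unfolding base_change_letter_def poisson_nested[of f h]
  by (rule commutator_sum_left_scal commutator_scal_left_scal)+
    ((rule commutator_sum_right_scal commutator_scal_right_scal)+, rule commutator_base_change_poly[OF inv], auto)

lemma base_change_letter_add: "base_change_letter u w (f \<oplus>\<^bsub>W\<^esub> h) = base_change_letter u w f + base_change_letter u w h"
  by (simp add: base_change_letter_def dual_space_simps scal_add distrib_right sum.distrib)

lemma base_change_letter_smult: "base_change_letter u w (a \<odot>\<^bsub>W\<^esub> f) = scal a * base_change_letter u w f"
  by (simp add: base_change_letter_def dual_space_simps scal_mult mult.assoc sum_distrib_left)

lemma base_change_entry_eq: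
  assumes "\<alpha> \<in> arcs G"
  shows "base_change_entry G arev d \<epsilon> g \<alpha> k l =
    cls (base_change_poly (\<lambda>i k m. (inv\<^bsub>base_group G d\<^esub> g) i $$ (k, m)) (\<lambda>i n l. g i $$ (n, l)) \<alpha> k l)"
proof -
  let ?c = "\<lambda>m n. (inv\<^bsub>base_group G d\<^esub> g) (head G \<alpha>) $$ (k, m) * g (tail G \<alpha>) $$ (n, l)"
  have 1: "?c m n \<odot>\<^bsub>Q\<^esub> cls (entry_letter \<alpha> m n) = cls (scal (?c m n) * entry_letter \<alpha> m n)" "scal (?c m n) * entry_letter \<alpha> m n \<in> polys (carrier W)"
    if "m < d (head G \<alpha>)" "n < d (tail G \<alpha>)" for m n
    using assms that by (simp_all add: cls_smult)
  then have 2: "(\<Oplus>\<^bsub>Q\<^esub>n\<in>{..<d (tail G \<alpha>)}. ?c m n \<odot>\<^bsub>Q\<^esub> cls (entry_letter \<alpha> m n)) = cls (\<Sum>n<d (tail G \<alpha>). scal (?c m n) * entry_letter \<alpha> m n)"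
    if "m < d (head G \<alpha>)" for m
    using that by (intro finsum_cls) auto
  show ?thesis
    unfolding base_change_entry_def weyl_algebra_eq B_hat_eq Let_def base_change_poly_def
    by (rule finsum_cls) (use 1(2) 2 in \<open>auto intro!: polys_sum\<close>)
qed

lemma base_change_cls:
  fixes g
  defines "u \<equiv> \<lambda>i k m. (inv\<^bsub>base_group G d\<^esub> g) i $$ (k, m)" and "w \<equiv> \<lambda>i n l. g i $$ (n, l)"
  assumes inv: "\<And>i k l. i \<in> verts G \<Longrightarrow> k < d i \<Longrightarrow> l < d i \<Longrightarrow>
      mult_entries (d i) (u i) (w i) k l = (if k = l then 1 else 0)"
    and p: "p \<in> polys (carrier W)"
  shows "base_change G arev d \<epsilon> g (cls p) = cls (subst_letters (base_change_letter u w) p)"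
proof -
  have 1: "f (rep_unit G d \<alpha> k l) \<odot>\<^bsub>Q\<^esub> base_change_entry G arev d \<epsilon> g \<alpha> k l =
      cls (scal (f (rep_unit G d \<alpha> k l)) * base_change_poly u w \<alpha> k l)"
    "scal (f (rep_unit G d \<alpha> k l)) * base_change_poly u w \<alpha> k l \<in> polys (carrier W)" if "\<alpha> \<in> arcs G" for f \<alpha> k l
    using that by (simp_all add: base_change_entry_eq cls_smult u_def w_def)
  then have 2: "(\<Oplus>\<^bsub>Q\<^esub>l\<in>{..<d (tail G \<alpha>)}. f (rep_unit G d \<alpha> k l) \<odot>\<^bsub>Q\<^esub> base_change_entry G arev d \<epsilon> g \<alpha> k l) =
      cls (\<Sum>l<d (tail G \<alpha>). scal (f (rep_unit G d \<alpha> k l)) * base_change_poly u w \<alpha> k l)" if "\<alpha> \<in> arcs G" for f \<alpha> k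
    using that by (intro finsum_cls) auto
  have 3: "(\<Oplus>\<^bsub>Q\<^esub>k\<in>{..<d (head G \<alpha>)}. \<Oplus>\<^bsub>Q\<^esub>l\<in>{..<d (tail G \<alpha>)}. f (rep_unit G d \<alpha> k l) \<odot>\<^bsub>Q\<^esub> base_change_entry G arev d \<epsilon> g \<alpha> k l) =
      cls (\<Sum>k<d (head G \<alpha>). \<Sum>l<d (tail G \<alpha>). scal (f (rep_unit G d \<alpha> k l)) * base_change_poly u w \<alpha> k l)" if "\<alpha> \<in> arcs G" for f \<alpha>
    by (rule finsum_cls) (use that 1(2) 2 in \<open>auto intro!: polys_sum\<close>)
  have base_change_letter: "(\<Oplus>\<^bsub>Q\<^esub>\<alpha>\<in>arcs G. \<Oplus>\<^bsub>Q\<^esub>k\<in>{..<d (head G \<alpha>)}. \<Oplus>\<^bsub>Q\<^esub>l\<in>{..<d (tail G \<alpha>)}.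
      f (rep_unit G d \<alpha> k l) \<odot>\<^bsub>Q\<^esub> base_change_entry G arev d \<epsilon> g \<alpha> k l) = cls (base_change_letter u w f)" for f
    unfolding base_change_letter_def by (rule finsum_cls) (use 1(2) 3 in \<open>auto intro!: polys_sum\<close>)
  have rel: "subst_letters (base_change_letter u w) r \<doteq> 0" if r: "r \<in> relations" for r
  proof -
    consider f h where "r = letter (f \<oplus>\<^bsub>W\<^esub> h) - letter f - letter h"
      | a f where "r = letter (a \<odot>\<^bsub>W\<^esub> f) - scal a * letter f"
      | f h where "r = letter f * letter h - letter h * letter f - scal (pb f h)"
      using r unfolding tensor_relations_def by blast
    then show ?thesis
    proof cases
      case 3
      then show ?thesis
        using commutator_base_change_letter[OF inv]
        by (simp add: subst_letters_diff subst_letters_mult eqmod_def commutator_def)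
    qed (simp_all add: subst_letters_diff subst_letters_mult base_change_letter_add base_change_letter_smult)
  qed
  show ?thesis
    using induced_map_cls[OF relations_polys, of _ "base_change_letter u w" p] rel p
    unfolding base_change_def weyl_algebra_eq Let_def base_change_letter
    by (simp add: tensor_ideal_def)
qed


section \<open>The quantum moment map\<close>

lemma moment_poly_cong:
  assumes "\<And>i l k. i \<in> verts G \<Longrightarrow> l < d i \<Longrightarrow> k < d i \<Longrightarrow> x i l k = y i l k"
  shows "moment_poly x = moment_poly y"
  unfolding moment_poly_def using assms by (intro sum.cong refl) simp

lemma moment_poly_add: "moment_poly (\<lambda>i l k. x i l k + y i l k) = moment_poly x + moment_poly y"
  by (simp add: moment_poly_def distrib_left scal_add distrib_right sum.distrib)

lemma moment_poly_smult: "moment_poly (\<lambda>i l k. a * x i l k) = scal a * moment_poly x"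
  by (simp add: moment_poly_def sum_distrib_left scal_scal_times mult_ac)

text \<open>
  The moment map is defined as a sum over vertices and the arrows ending there, which counts each
  arrow exactly once.
\<close>

lemma moment_poly_by_vertices:
  "moment_poly x = (\<Sum>i\<in>verts G. \<Sum>k<d i. \<Sum>l<d i. scal (x i l k) *
    (scal (1 / 2) * (\<Sum>\<alpha>\<in>{\<alpha> \<in> arcs G. head G \<alpha> = i}. scal (\<epsilon> \<alpha>) * sym_product \<alpha> k l)))"
proof -
  have "moment_poly x = (\<Sum>i\<in>verts G. \<Sum>\<alpha>\<in>{\<alpha> \<in> arcs G. head G \<alpha> = i}. \<Sum>k<d (head G \<alpha>). \<Sum>l<d (head G \<alpha>).
      scal (\<epsilon> \<alpha> / 2 * x (head G \<alpha>) l k) * sym_product \<alpha> k l)"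
    unfolding moment_poly_def by (rule sum.group[symmetric]) auto
  also have "\<dots> = (\<Sum>i\<in>verts G. \<Sum>\<alpha>\<in>{\<alpha> \<in> arcs G. head G \<alpha> = i}. \<Sum>k<d i. \<Sum>l<d i.
      scal (\<epsilon> \<alpha> / 2 * x i l k) * sym_product \<alpha> k l)"
    by (intro sum.cong refl) auto
  also have "\<dots> = (\<Sum>i\<in>verts G. \<Sum>k<d i. \<Sum>l<d i. \<Sum>\<alpha>\<in>{\<alpha> \<in> arcs G. head G \<alpha> = i}.
      scal (\<epsilon> \<alpha> / 2 * x i l k) * sym_product \<alpha> k l)"
  proof (rule sum.cong[OF refl])
    fix i
    have "(\<Sum>\<alpha>\<in>Y. \<Sum>k<d i. \<Sum>l<d i. F \<alpha> k l) = (\<Sum>k<d i. \<Sum>l<d i. \<Sum>\<alpha>\<in>Y. F \<alpha> k l)"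
      for Y :: "'e set" and F :: "'e \<Rightarrow> nat \<Rightarrow> nat \<Rightarrow> ((('e \<Rightarrow> complex mat) \<Rightarrow> complex) list \<Rightarrow>\<^sub>0 complex)"
    proof -
      have "(\<Sum>\<alpha>\<in>Y. \<Sum>k<d i. \<Sum>l<d i. F \<alpha> k l) = (\<Sum>k<d i. \<Sum>\<alpha>\<in>Y. \<Sum>l<d i. F \<alpha> k l)"
        by (rule sum.swap)
      also have "\<dots> = (\<Sum>k<d i. \<Sum>l<d i. \<Sum>\<alpha>\<in>Y. F \<alpha> k l)"
        by (rule sum.cong[OF refl]) (rule sum.swap)
      finally show ?thesis .
    qed
    then show "(\<Sum>\<alpha>\<in>{\<alpha> \<in> arcs G. head G \<alpha> = i}. \<Sum>k<d i. \<Sum>l<d i. scal (\<epsilon> \<alpha> / 2 * x i l k) * sym_product \<alpha> k l) =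
        (\<Sum>k<d i. \<Sum>l<d i. \<Sum>\<alpha>\<in>{\<alpha> \<in> arcs G. head G \<alpha> = i}. scal (\<epsilon> \<alpha> / 2 * x i l k) * sym_product \<alpha> k l)" .
  qed
  finally show ?thesis
    by (simp add: sum_distrib_left scal_scal_times mult_ac)
qed

lemma moment_entry_eq:
  assumes "i \<in> verts G" "k < d i" "l < d i"
  shows "moment_entry G arev d \<epsilon> i k l =
    cls (scal (1 / 2) * (\<Sum>\<alpha>\<in>{\<alpha> \<in> arcs G. head G \<alpha> = i}. scal (\<epsilon> \<alpha>) * sym_product \<alpha> k l))"
proof -
  have sym_product: "(\<Oplus>\<^bsub>Q\<^esub>m\<in>{..<d (tail G \<alpha>)}. (cls (entry_letter \<alpha> k m) \<otimes>\<^bsub>Q\<^esub> cls (entry_letter (arev \<alpha>) m l)) \<oplus>\<^bsub>Q\<^esub>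
      (cls (entry_letter (arev \<alpha>) m l) \<otimes>\<^bsub>Q\<^esub> cls (entry_letter \<alpha> k m))) = cls (sym_product \<alpha> k l)"
    if "\<alpha> \<in> arcs G" "head G \<alpha> = i" for \<alpha>
    unfolding sym_product_def
  proof (rule finsum_cls)
    fix m assume "m \<in> {..<d (tail G \<alpha>)}"
    then have "entry_letter \<alpha> k m \<in> polys (carrier W)" "entry_letter (arev \<alpha>) m l \<in> polys (carrier W)"
      using that assms by auto
    then show "(cls (entry_letter \<alpha> k m) \<otimes>\<^bsub>Q\<^esub> cls (entry_letter (arev \<alpha>) m l)) \<oplus>\<^bsub>Q\<^esub> (cls (entry_letter (arev \<alpha>) m l) \<otimes>\<^bsub>Q\<^esub> cls (entry_letter \<alpha> k m)) =
        cls (entry_letter \<alpha> k m * entry_letter (arev \<alpha>) m l + entry_letter (arev \<alpha>) m l * entry_letter \<alpha> k m)"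
      and "entry_letter \<alpha> k m * entry_letter (arev \<alpha>) m l + entry_letter (arev \<alpha>) m l * entry_letter \<alpha> k m \<in> polys (carrier W)"
      by (simp_all add: cls_mult cls_add)
  qed simp
  have closed: "scal (\<epsilon> \<alpha>) * sym_product \<alpha> k l \<in> polys (carrier W)" if "\<alpha> \<in> arcs G" "head G \<alpha> = i" for \<alpha>
    using that assms by auto
  have smult: "\<epsilon> \<alpha> \<odot>\<^bsub>Q\<^esub> cls (sym_product \<alpha> k l) = cls (scal (\<epsilon> \<alpha>) * sym_product \<alpha> k l)" if "\<alpha> \<in> arcs G" "head G \<alpha> = i" for \<alpha>
    using that assms by (intro cls_smult) auto
  have "(\<Oplus>\<^bsub>Q\<^esub>\<alpha>\<in>{\<alpha> \<in> arcs G. head G \<alpha> = i}. \<epsilon> \<alpha> \<odot>\<^bsub>Q\<^esub>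
      (\<Oplus>\<^bsub>Q\<^esub>m\<in>{..<d (tail G \<alpha>)}. (cls (entry_letter \<alpha> k m) \<otimes>\<^bsub>Q\<^esub> cls (entry_letter (arev \<alpha>) m l)) \<oplus>\<^bsub>Q\<^esub>
        (cls (entry_letter (arev \<alpha>) m l) \<otimes>\<^bsub>Q\<^esub> cls (entry_letter \<alpha> k m)))) =
      cls (\<Sum>\<alpha>\<in>{\<alpha> \<in> arcs G. head G \<alpha> = i}. scal (\<epsilon> \<alpha>) * sym_product \<alpha> k l)"
    by (rule finsum_cls) (simp_all add: sym_product closed smult)
  moreover have "(\<Sum>\<alpha>\<in>{\<alpha> \<in> arcs G. head G \<alpha> = i}. scal (\<epsilon> \<alpha>) * sym_product \<alpha> k l) \<in> polys (carrier W)"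
    by (rule polys_sum) (simp add: closed)
  ultimately show ?thesis
    unfolding moment_entry_def weyl_algebra_eq B_hat_eq Let_def by (simp add: cls_smult)
qed

lemma moment_linear_extension:
  "(\<Oplus>\<^bsub>Q\<^esub>i\<in>verts G. \<Oplus>\<^bsub>Q\<^esub>k\<in>{..<d i}. \<Oplus>\<^bsub>Q\<^esub>l\<in>{..<d i}.
    \<Lambda> (unit_family (verts G) d d i k l) \<odot>\<^bsub>Q\<^esub> moment_entry G arev d \<epsilon> i k l) = cls (moment_poly (dual_entry G d \<Lambda>))"
proof -
  let ?p = "\<lambda>i k l. scal (\<Lambda> (unit_family (verts G) d d i k l)) *
    (scal (1 / 2) * (\<Sum>\<alpha>\<in>{\<alpha> \<in> arcs G. head G \<alpha> = i}. scal (\<epsilon> \<alpha>) * sym_product \<alpha> k l))"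
  let ?a = "\<lambda>i k l. \<Lambda> (unit_family (verts G) d d i k l) \<odot>\<^bsub>Q\<^esub> moment_entry G arev d \<epsilon> i k l"
  have q: "scal (1 / 2) * (\<Sum>\<alpha>\<in>{\<alpha> \<in> arcs G. head G \<alpha> = i}. scal (\<epsilon> \<alpha>) * sym_product \<alpha> k l) \<in> polys (carrier W)"
    if "i \<in> verts G" "k < d i" "l < d i" for i k l
    by (intro polys_mult polys_scal polys_sum sym_product_closed) (use that in auto)
  then have 1: "?a i k l = cls (?p i k l)" "?p i k l \<in> polys (carrier W)"
    if "i \<in> verts G" "k < d i" "l < d i" for i k l
    using that by (simp_all add: moment_entry_eq cls_smult)
  have 2: "(\<Sum>l<d i. ?p i k l) \<in> polys (carrier W)" if "i \<in> verts G" "k < d i" for i k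
    by (rule polys_sum) (use that 1(2) in simp)
  have 3: "(\<Oplus>\<^bsub>Q\<^esub>l\<in>{..<d i}. ?a i k l) = cls (\<Sum>l<d i. ?p i k l)" if "i \<in> verts G" "k < d i" for i k
    by (rule finsum_cls) (use that 1 in simp_all)
  have 4: "(\<Sum>k<d i. \<Sum>l<d i. ?p i k l) \<in> polys (carrier W)" if "i \<in> verts G" for i
    by (rule polys_sum) (use that 2 in simp)
  have 5: "(\<Oplus>\<^bsub>Q\<^esub>k\<in>{..<d i}. \<Oplus>\<^bsub>Q\<^esub>l\<in>{..<d i}. ?a i k l) = cls (\<Sum>k<d i. \<Sum>l<d i. ?p i k l)"
    if "i \<in> verts G" for i
    by (rule finsum_cls) (use that 2 3 in simp_all)
  show ?thesis
    unfolding moment_poly_by_vertices dual_entry_def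
    by (rule finsum_cls) (simp_all add: 4 5)
qed

abbreviation h_dual where "h_dual \<equiv> gl_sum_dual G d"
abbreviation U_relations where
  "U_relations \<equiv> tensor_relations h_dual (\<lambda>x y. letter (lie_bracket h_dual x y))"

lemma U_relations_polys: "U_relations \<subseteq> polys (carrier h_dual)"
proof -
  interpret L: complex_lie_algebra h_dual
    by (rule complex_lie_algebra_gl_sum_dual)
  have "a \<odot>\<^bsub>h_dual\<^esub> f \<in> carrier h_dual" if "f \<in> carrier h_dual" for a f
    using L.smult_closed[of a f] that by simp
  then show ?thesis
    by (auto simp: tensor_relations_def L.bracket_closed)
qed

sublocale U: quotient_of_free "carrier h_dual" "tensor_ideal h_dual (\<lambda>x y. letter (lie_bracket h_dual x y))"
  unfolding tensor_ideal_def by (rule quotient_of_free_genideal[OF U_relations_polys])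

lemma enveloping_algebra_eq: "enveloping_algebra h_dual = U.Q"
  by (simp add: enveloping_algebra_def tensor_quotient_def)

lemma enveloping_incl_eq: "enveloping_incl h_dual x = U.cls (letter x)"
  by (simp add: enveloping_incl_def tensor_class_def U.cls_def)

definition moment where "moment \<Lambda> = moment_poly (dual_entry G d \<Lambda>)"

lemma moment_closed [simp]: "moment \<Lambda> \<in> polys (carrier W)"
  by (simp add: moment_def)

lemma moment_add: "moment (f \<oplus>\<^bsub>h_dual\<^esub> h) = moment f + moment h"
  unfolding moment_def moment_poly_add[symmetric] by (rule moment_poly_cong) (simp add: dual_entry_add)

lemma moment_smult: "moment (a \<odot>\<^bsub>h_dual\<^esub> f) = scal a * moment f"
  unfolding moment_def moment_poly_smult[symmetric] by (rule moment_poly_cong) (simp add: dual_entry_smult)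

lemma moment_bracket:
  assumes "f \<in> carrier h_dual" "h \<in> carrier h_dual"
  shows "commutator (moment f) (moment h) \<doteq> moment (lie_bracket h_dual f h)"
proof -
  have bracket: "moment (lie_bracket h_dual f h) = moment_poly (\<lambda>i l k.
      mult_entries (d i) (dual_entry G d f i) (dual_entry G d h i) l k -
      mult_entries (d i) (dual_entry G d h i) (dual_entry G d f i) l k)"
    unfolding moment_def by (rule moment_poly_cong) (simp add: dual_entry_bracket assms)
  show ?thesis
    unfolding bracket unfolding moment_def by (rule commutator_moment_poly_moment_poly)
qed

lemma quantum_moment_cls:
  assumes "p \<in> polys (carrier h_dual)"
  shows "quantum_moment G arev d \<epsilon> (U.cls p) = cls (subst_letters moment p)"
proof -
  have rel: "subst_letters moment r \<doteq> 0" if r: "r \<in> U_relations" for r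
  proof -
    consider f h where "r = letter (f \<oplus>\<^bsub>h_dual\<^esub> h) - letter f - letter h"
      | a f where "r = letter (a \<odot>\<^bsub>h_dual\<^esub> f) - scal a * letter f"
      | f h where "r = letter f * letter h - letter h * letter f - letter (lie_bracket h_dual f h)"
          "f \<in> carrier h_dual" "h \<in> carrier h_dual"
      using r unfolding tensor_relations_def by blast
    then show ?thesis
    proof cases
      case 3
      then show ?thesis
        using moment_bracket[of f h]
        by (simp add: subst_letters_diff subst_letters_mult eqmod_def commutator_def)
    qed (simp_all add: subst_letters_diff subst_letters_mult moment_add moment_smult)
  qed
  show ?thesis
    using induced_map_cls[OF U_relations_polys, of _ moment p] rel assms
    unfolding quantum_moment_def weyl_algebra_eq Let_def moment_linear_extension
    by (simp add: tensor_ideal_def moment_def)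
qed

lemma quantum_moment_hom: "quantum_moment G arev d \<epsilon> \<in> algebra_hom U.Q Q"
proof -
  have poly: "subst_letters moment p \<in> polys (carrier W)" if "p \<in> polys (carrier h_dual)" for p
    using that by (rule subst_letters_polys[rotated]) simp
  show ?thesis
    unfolding algebra_hom_def
    by (auto intro!: ring_hom_memI simp: U.carrier_Q U.cls_mult U.cls_add U.cls_one U.cls_smult
        quantum_moment_cls poly cls_mult cls_add cls_one cls_smult subst_letters_mult subst_letters_add)
qed

end


section \<open>The infinitesimal base change is inner\<close>

context weyl_quiver
begin

lemma commutator_moment_poly_letter:
  assumes "f \<in> carrier W"
  shows "commutator (moment_poly x) (letter f) \<doteq> (\<Sum>\<alpha>\<in>arcs G. \<Sum>k<d (head G \<alpha>). \<Sum>l<d (tail G \<alpha>).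
    scal (f (rep_unit G d \<alpha> k l)) * action_entry x \<alpha> k l)"
proof -
  have "commutator (moment_poly x) (letter f) \<doteq> commutator (moment_poly x) (\<Sum>\<alpha>\<in>arcs G. \<Sum>k<d (head G \<alpha>). \<Sum>l<d (tail G \<alpha>).
      scal (f (rep_unit G d \<alpha> k l)) * entry_letter \<alpha> k l)"
    by (intro eqmod_commutator_right letter_expand assms moment_poly_closed)
  moreover have "commutator (moment_poly x) (\<Sum>\<alpha>\<in>arcs G. \<Sum>k<d (head G \<alpha>). \<Sum>l<d (tail G \<alpha>).
      scal (f (rep_unit G d \<alpha> k l)) * entry_letter \<alpha> k l) \<doteq> (\<Sum>\<alpha>\<in>arcs G. \<Sum>k<d (head G \<alpha>). \<Sum>l<d (tail G \<alpha>).
      scal (f (rep_unit G d \<alpha> k l)) * action_entry x \<alpha> k l)"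
    unfolding commutator_sum_right commutator_scal_right
    by (intro eqmod_sum eqmod_scal commutator_moment_poly_entry_letter) auto
  ultimately show ?thesis
    by (rule eqmod_trans)
qed

text \<open>The derivative of \<open>g\<^sup>-\<^sup>1 B g\<close> along \<open>g = 1 + t X\<close> is \<open>B X - X B\<close>.\<close>

lemma base_change_letter_curve_deriv:
  assumes u: "\<And>i k m. i \<in> verts G \<Longrightarrow> k < d i \<Longrightarrow> m < d i \<Longrightarrow> ((\<lambda>t. u t i k m) has_field_derivative - x i k m) (at 0)"
    and u0: "\<And>i k m. i \<in> verts G \<Longrightarrow> k < d i \<Longrightarrow> m < d i \<Longrightarrow> u 0 i k m = (if k = m then 1 else 0)"
    and w: "\<And>i n l. i \<in> verts G \<Longrightarrow> n < d i \<Longrightarrow> l < d i \<Longrightarrow> ((\<lambda>t. w t i n l) has_field_derivative x i n l) (at 0)"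
    and w0: "\<And>i n l. i \<in> verts G \<Longrightarrow> n < d i \<Longrightarrow> l < d i \<Longrightarrow> w 0 i n l = (if n = l then 1 else 0)"
  shows "poly_curve_deriv (carrier W) (\<lambda>t. base_change_letter (u t) (w t) f)
      (\<Sum>\<alpha>\<in>arcs G. \<Sum>k<d (head G \<alpha>). \<Sum>l<d (tail G \<alpha>). scal (f (rep_unit G d \<alpha> k l)) * action_entry x \<alpha> k l)"
    and "base_change_letter (u 0) (w 0) f = (\<Sum>\<alpha>\<in>arcs G. \<Sum>k<d (head G \<alpha>). \<Sum>l<d (tail G \<alpha>).
      scal (f (rep_unit G d \<alpha> k l)) * entry_letter \<alpha> k l)"
proof -
  have action_entry: "action_entry x \<alpha> k l = (\<Sum>m<d (head G \<alpha>). \<Sum>n<d (tail G \<alpha>).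
      scal (- x (head G \<alpha>) k m * w 0 (tail G \<alpha>) n l + x (tail G \<alpha>) n l * u 0 (head G \<alpha>) k m) * entry_letter \<alpha> m n)"
    if "\<alpha> \<in> arcs G" "k < d (head G \<alpha>)" "l < d (tail G \<alpha>)" for \<alpha> k l
  proof -
    have "(\<Sum>m<d (head G \<alpha>). \<Sum>n<d (tail G \<alpha>).
      scal (- x (head G \<alpha>) k m * w 0 (tail G \<alpha>) n l + x (tail G \<alpha>) n l * u 0 (head G \<alpha>) k m) * entry_letter \<alpha> m n) =
      (\<Sum>m<d (head G \<alpha>). \<Sum>n<d (tail G \<alpha>). scal (if n = l then - x (head G \<alpha>) k m else 0) * entry_letter \<alpha> m n) +
      (\<Sum>m<d (head G \<alpha>). \<Sum>n<d (tail G \<alpha>). scal (if k = m then x (tail G \<alpha>) n l else 0) * entry_letter \<alpha> m n)"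
      unfolding sum.distrib[symmetric] distrib_right[symmetric] scal_add[symmetric]
      by (intro sum.cong refl) (use that in \<open>simp add: u0 w0\<close>)
    then show ?thesis
      using that by (simp add: action_entry_def scal_if_zero delta_simps scal_uminus sum_negf)
  qed
  have "poly_curve_deriv (carrier W) (\<lambda>t. base_change_poly (u t) (w t) \<alpha> k l) (action_entry x \<alpha> k l)"
    if "\<alpha> \<in> arcs G" "k < d (head G \<alpha>)" "l < d (tail G \<alpha>)" for \<alpha> k l
    unfolding base_change_poly_def action_entry[OF that]
    by (intro poly_curve_deriv_sum poly_curve_deriv_scal DERIV_mult u w entry_letter_closed) (use that in auto)
  then show "poly_curve_deriv (carrier W) (\<lambda>t. base_change_letter (u t) (w t) f)
      (\<Sum>\<alpha>\<in>arcs G. \<Sum>k<d (head G \<alpha>). \<Sum>l<d (tail G \<alpha>). scal (f (rep_unit G d \<alpha> k l)) * action_entry x \<alpha> k l)"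
    unfolding base_change_letter_def by (intro poly_curve_deriv_sum poly_curve_deriv_scal_left) auto
  have "base_change_poly (u 0) (w 0) \<alpha> k l = entry_letter \<alpha> k l"
    if "\<alpha> \<in> arcs G" "k < d (head G \<alpha>)" "l < d (tail G \<alpha>)" for \<alpha> k l
  proof -
    have "base_change_poly (u 0) (w 0) \<alpha> k l = (\<Sum>m<d (head G \<alpha>). \<Sum>n<d (tail G \<alpha>). scal (if k = m \<and> n = l then 1 else 0) * entry_letter \<alpha> m n)"
      unfolding base_change_poly_def by (intro sum.cong refl) (use that in \<open>simp add: u0 w0\<close>)
    then show ?thesis
      using that by (simp add: scal_if_zero delta_simps)
  qed
  then show "base_change_letter (u 0) (w 0) f = (\<Sum>\<alpha>\<in>arcs G. \<Sum>k<d (head G \<alpha>). \<Sum>l<d (tail G \<alpha>).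
      scal (f (rep_unit G d \<alpha> k l)) * entry_letter \<alpha> k l)"
    unfolding base_change_letter_def by (intro sum.cong refl) simp
qed

text \<open>
  Along \<open>g = 1 + t X\<close> the base change is, for small \<open>t\<close>, a substitution by \<open>g\<^sup>-\<^sup>1 B g\<close>, whose
  derivative on letters is the commutator with the moment element of \<open>X\<close>.  Both sides being
  derivations, they agree on all polynomials.
\<close>

lemma infinitesimal_base_change_cls:
  assumes X: "X \<in> carrier (gl_sum G d)" and p: "p \<in> polys (carrier W)"
  shows "infinitesimal_base_change G arev d \<epsilon> X (cls p) =
    cls (commutator (moment_poly (\<lambda>i l k. X i $$ (l, k))) p)"
proof -
  let ?x = "\<lambda>i l k. X i $$ (l, k)"
  define g where "g t = (\<lambda>i\<in>verts G. 1\<^sub>m (d i) + t \<cdot>\<^sub>m X i)" for t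
  have Xi: "X i \<in> carrier_mat (d i) (d i)" if "i \<in> verts G" for i
    using X that by (auto simp: carrier_gl_sum mat_sum_simps)
  have "\<forall>i\<in>verts G. \<exists>N. (\<forall>t. N t \<in> carrier_mat (d i) (d i)) \<and>
    (\<forall>\<^sub>F t in nhds 0. N t * (1\<^sub>m (d i) + t \<cdot>\<^sub>m X i) = 1\<^sub>m (d i) \<and> (1\<^sub>m (d i) + t \<cdot>\<^sub>m X i) * N t = 1\<^sub>m (d i)) \<and>
    (\<forall>k<d i. \<forall>l<d i. ((\<lambda>t. N t $$ (k, l)) has_field_derivative - X i $$ (k, l)) (at 0))"
    using inverse_near_identity[OF Xi] by blast
  then obtain N where
    N: "\<And>i t. i \<in> verts G \<Longrightarrow> N i t \<in> carrier_mat (d i) (d i)" and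
    ev: "\<And>i. i \<in> verts G \<Longrightarrow> \<forall>\<^sub>F t in nhds 0. N i t * (1\<^sub>m (d i) + t \<cdot>\<^sub>m X i) = 1\<^sub>m (d i) \<and>
      (1\<^sub>m (d i) + t \<cdot>\<^sub>m X i) * N i t = 1\<^sub>m (d i)" and
    dN: "\<And>i k l. i \<in> verts G \<Longrightarrow> k < d i \<Longrightarrow> l < d i \<Longrightarrow>
      ((\<lambda>t. N i t $$ (k, l)) has_field_derivative - X i $$ (k, l)) (at 0)"
    by (subst (asm) bchoice_iff) blast
  define u where "u t i k m = N i t $$ (k, m)" for t i k m
  define w where "w t i n l = (if n = l then 1 else 0) + t * X i $$ (n, l)" for t i n l
  have g: "g t i $$ (n, l) = w t i n l" if "i \<in> verts G" "n < d i" "l < d i" for t i n l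
    using that Xi[OF that(1)] by (simp add: g_def w_def)
  have gc: "g t i \<in> carrier_mat (d i) (d i)" if "i \<in> verts G" for t i
    using Xi[OF that] that by (simp add: g_def)
  have g_ext: "g t \<in> extensional (verts G)" for t
    unfolding g_def by (rule restrict_extensional)
  have "\<forall>\<^sub>F t in nhds 0. \<forall>i\<in>verts G. N i t * g t i = 1\<^sub>m (d i) \<and> g t i * N i t = 1\<^sub>m (d i)"
    using ev by (intro eventually_ball_finite) (auto simp: g_def)
  then have inv: "\<forall>\<^sub>F t in nhds 0. base_change G arev d \<epsilon> (g t) (cls p) = cls (subst_letters (base_change_letter (u t) (w t)) p)"
  proof eventually_elim
    case (elim t)
    have gi: "(inv\<^bsub>base_group G d\<^esub> g t) i = N i t" if "i \<in> verts G" for i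
    proof (rule base_group_inv[where g = "g t" and N = "\<lambda>i. N i t", OF _ g_ext])
      show "N j t * g t j = 1\<^sub>m (d j) \<and> g t j * N j t = 1\<^sub>m (d j)" if "j \<in> verts G" for j
        using elim that by blast
    qed (use that in \<open>simp_all add: gc N\<close>)
    have entries: "base_change_letter (\<lambda>i k m. (inv\<^bsub>base_group G d\<^esub> g t) i $$ (k, m)) (\<lambda>i n l. g t i $$ (n, l)) = base_change_letter (u t) (w t)"
      unfolding base_change_letter_def base_change_poly_def
      by (intro ext sum.cong refl) (auto simp: gi g u_def)
    have "mult_entries (d i) (\<lambda>k m. (inv\<^bsub>base_group G d\<^esub> g t) i $$ (k, m)) (\<lambda>n l. g t i $$ (n, l)) k l =
        (if k = l then 1 else 0)" if "i \<in> verts G" "k < d i" "l < d i" for i k l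
    proof -
      have "(N i t * g t i) $$ (k, l) = (\<Sum>m<d i. N i t $$ (k, m) * g t i $$ (m, l))"
        using that carrier_matD[OF N[OF that(1), of t]] carrier_matD[OF gc[OF that(1), of t]]
        by (simp add: scalar_prod_def lessThan_atLeast0)
      then show ?thesis
        using elim that by (simp add: mult_entries_def gi)
    qed
    then show ?case
      using base_change_cls[of "g t" p] p by (simp add: entries)
  qed
  have u0: "u 0 i k m = (if k = m then 1 else 0)" if "i \<in> verts G" "k < d i" "m < d i" for i k m
  proof -
    have "N i 0 * (1\<^sub>m (d i) + 0 \<cdot>\<^sub>m X i) = 1\<^sub>m (d i)"
      using eventually_nhds_x_imp_x[OF ev[OF that(1)]] by blast
    moreover have "1\<^sub>m (d i) + 0 \<cdot>\<^sub>m X i = 1\<^sub>m (d i)"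
      using Xi[OF that(1)] by (auto intro!: eq_matI)
    ultimately have "N i 0 = 1\<^sub>m (d i)"
      using N[OF that(1), of 0] by simp
    then show ?thesis
      using that by (simp add: u_def)
  qed

  have du: "((\<lambda>t. u t i k m) has_field_derivative - ?x i k m) (at 0)" if "i \<in> verts G" "k < d i" "m < d i" for i k m
    unfolding u_def by (rule dN[OF that])
  have dw: "((\<lambda>t. w t i n l) has_field_derivative ?x i n l) (at 0)" for i n l
    unfolding w_def by (auto intro!: derivative_eq_intros)
  have w0: "w 0 i n l = (if n = l then 1 else 0)" for i n l
    by (simp add: w_def)
  have "\<exists>D. poly_curve_deriv (carrier W) (\<lambda>t. subst_letters (base_change_letter (u t) (w t)) p) D \<and>
      D \<doteq> moment_poly ?x * p - p * moment_poly ?x"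
  proof (rule subst_letters_curve_deriv[OF _ _ _ _ p])
    fix f assume f: "f \<in> carrier W"
    show "\<exists>D. poly_curve_deriv (carrier W) (\<lambda>t. base_change_letter (u t) (w t) f) D \<and>
        D \<doteq> moment_poly ?x * letter f - letter f * moment_poly ?x"
      using base_change_letter_curve_deriv(1)[of u ?x w f, OF du u0 dw w0]
        eqmod_sym[OF commutator_moment_poly_letter[OF f, of ?x]]
      unfolding commutator_def by blast
    show "base_change_letter (u 0) (w 0) f \<doteq> letter f"
      using base_change_letter_curve_deriv(2)[of u ?x w f, OF du u0 dw w0] eqmod_sym[OF letter_expand[OF f]]
      by simp
  qed simp_all
  then obtain D where D: "poly_curve_deriv (carrier W) (\<lambda>t. subst_letters (base_change_letter (u t) (w t)) p) D"
      "D \<doteq> moment_poly ?x * p - p * moment_poly ?x"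
    by blast
  have deriv: "has_derivative_at_0 Q (\<lambda>t. base_change G arev d \<epsilon> (g t) (cls p)) (cls D)"
    using D(1) inv by (rule has_derivative_at_0_cls)
  have "infinitesimal_base_change G arev d \<epsilon> X (cls p) = cls D"
    unfolding infinitesimal_base_change_def weyl_algebra_eq g_def[symmetric]
    using deriv has_derivative_at_0_unique[OF _ deriv] by (rule the_equality)
  also have "\<dots> = cls (commutator (moment_poly ?x) p)"
    using D(2) by (simp add: cls_eq_iff commutator_def)
  finally show ?thesis .
qed

lemma dual_base_change_cls:
  assumes "\<Lambda> \<in> carrier h_dual" "p \<in> polys (carrier W)"
  shows "dual_base_change G arev d \<epsilon> \<Lambda> (cls p) = cls (commutator (moment \<Lambda>) p)"
proof -
  have "moment_poly (\<lambda>i l k. dual_mat \<Lambda> i $$ (l, k)) = moment \<Lambda>"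
    unfolding moment_def by (rule moment_poly_cong) (simp add: dual_mat_def)
  then show ?thesis
    using assms by (simp add: dual_base_change_def inv_trace_duality infinitesimal_base_change_cls dual_mat_closed)
qed

text \<open>
  All axioms follow from the description of the action by commutators: inner derivations obey the
  Leibniz rule, and compatibility with brackets is the Jacobi identity for commutators together with
  the fact that the moment elements represent the Lie bracket.
\<close>

lemma derivation_action_dual_base_change:
  "derivation_action h_dual Q (dual_base_change G arev d \<epsilon>)"
proof (intro derivation_action.intro derivation_action_axioms.intro
    complex_lie_algebra_gl_sum_dual complex_algebra_Q)
  interpret L: complex_lie_algebra h_dual
    by (rule complex_lie_algebra_gl_sum_dual)
  have smult_closed: "a \<odot>\<^bsub>h_dual\<^esub> x \<in> carrier h_dual" if "x \<in> carrier h_dual" for a x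
    using L.smult_closed[of a x] that by simp
  fix x y b c assume x: "x \<in> carrier h_dual"
  show "dual_base_change G arev d \<epsilon> x \<in> Der Q"
    using x unfolding Der_def
    by (auto simp: carrier_Q dual_base_change_cls cls_add cls_mult cls_smult commutator_add_right
        commutator_scal_right commutator_mult_right)
  {
    assume "b \<in> carrier Q"
    then obtain p where p: "p \<in> polys (carrier W)" "b = cls p"
      by (auto simp: carrier_Q)
    show "dual_base_change G arev d \<epsilon> (c \<odot>\<^bsub>h_dual\<^esub> x) b = c \<odot>\<^bsub>Q\<^esub> dual_base_change G arev d \<epsilon> x b"
      using x p by (simp add: dual_base_change_cls smult_closed moment_smult commutator_scal_left cls_smult)
    assume y: "y \<in> carrier h_dual"
    show "dual_base_change G arev d \<epsilon> (x \<oplus>\<^bsub>h_dual\<^esub> y) b =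
        dual_base_change G arev d \<epsilon> x b \<oplus>\<^bsub>Q\<^esub> dual_base_change G arev d \<epsilon> y b"
      using x y p by (simp add: dual_base_change_cls L.a_closed moment_add commutator_add_left cls_add)
    have "moment (lie_bracket h_dual x y) \<doteq> commutator (moment x) (moment y)"
      using moment_bracket[OF x y] by (rule eqmod_sym)
    then have "commutator (moment (lie_bracket h_dual x y)) p \<doteq> commutator (commutator (moment x) (moment y)) p"
      using p(1) unfolding commutator_def[of _ p] by (intro eqmod_diff eqmod_left eqmod_right)
    then show "dual_base_change G arev d \<epsilon> (lie_bracket h_dual x y) b =
        dual_base_change G arev d \<epsilon> x (dual_base_change G arev d \<epsilon> y b) \<ominus>\<^bsub>Q\<^esub>
        dual_base_change G arev d \<epsilon> y (dual_base_change G arev d \<epsilon> x b)"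
      using x y p
      by (simp add: dual_base_change_cls L.bracket_closed cls_diff cls_eq_iff commutator_jacobi)
  }
qed

lemma quantum_comoment_map_base_change:
  "quantum_comoment_map h_dual (weyl_algebra G arev d \<epsilon>) (dual_base_change G arev d \<epsilon>)
    (quantum_moment G arev d \<epsilon>)"
  unfolding weyl_algebra_eq
proof (intro quantum_comoment_map.intro quantum_comoment_map_axioms.intro
    derivation_action_dual_base_change)
  show "quantum_moment G arev d \<epsilon> \<in> algebra_hom (enveloping_algebra h_dual) Q"
    unfolding enveloping_algebra_eq by (rule quantum_moment_hom)
  fix x b assume x: "x \<in> carrier h_dual" and "b \<in> carrier Q"
  then obtain p where p: "p \<in> polys (carrier W)" "b = cls p"
    by (auto simp: carrier_Q)
  show "dual_base_change G arev d \<epsilon> x b =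
      (quantum_moment G arev d \<epsilon> (enveloping_incl h_dual x) \<otimes>\<^bsub>Q\<^esub> b) \<ominus>\<^bsub>Q\<^esub>
      (b \<otimes>\<^bsub>Q\<^esub> quantum_moment G arev d \<epsilon> (enveloping_incl h_dual x))"
    using x p
    by (simp add: enveloping_incl_eq quantum_moment_cls dual_base_change_cls cls_mult cls_diff commutator_def)
qed

end

theorem lemma7p13:
  fixes G :: "('v, 'e) pre_digraph" and arev :: "'e \<Rightarrow> 'e"
    and d :: "'v \<Rightarrow> nat" and \<epsilon> :: "'e \<Rightarrow> complex"
  assumes "graph G" and "bidirected_digraph G arev"
    and "\<And>\<alpha>. \<alpha> \<in> arcs G \<Longrightarrow> \<epsilon> \<alpha> \<noteq> 0"
    and "\<And>\<alpha>. \<alpha> \<in> arcs G \<Longrightarrow> \<epsilon> \<alpha> + \<epsilon> (arev \<alpha>) = 0"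
  shows "quantum_comoment_map (gl_sum_dual G d) (weyl_algebra G arev d \<epsilon>)
           (dual_base_change G arev d \<epsilon>) (quantum_moment G arev d \<epsilon>)"
proof -
  interpret weyl_quiver G arev d \<epsilon>
    using assms by (intro weyl_quiver.intro weyl_quiver_axioms.intro)
  show ?thesis
    by (rule quantum_comoment_map_base_change)
qed

end
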